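(* Let $(M,F)$ be a Finsler space and let $\nabla$ be a linear connection on the vector bundle $\hat\pi^*TM\to N$. Then the formula $$\langle\nabla\rangle_XY:=\big\langle\,\pi_2|_u\,\nabla_{\iota_u(X)}\hat\pi^*Y\,\big\rangle=\frac{1}{vol(I_x)}\int_{I_x}\pi_2\big(\nabla_{\iota_u(X)}\hat\pi^*Y\big)\,dvol_x(u),\qquad X\in T_xM,\; Y\in\Gamma TM,\; x\in M,$$ is the covariant derivative of an affine connection $\langle\nabla\rangle$ of $M$.
   Context: The summation convention is used. $M$ is an $n$-dimensional smooth manifold, $\hat\pi:N=TM\setminus\{0\}\to M$ is the slit tangent bundle, and local coordinates $(x^i)$ on $M$ induce natural coordinates $(x^i,y^i)$ on $TM$. A Finsler space $(M,F)$ is a manifold $M$ with a function $F:TM\to[0,\infty)$ that is smooth on $N$, satisfies $F(x,\lambda y)=\lambda F(x,y)$ for $\lambda\ge 0$, and for which $g_{ij}(x,y):=\frac12\frac{\partial^2F^2}{\partial y^i\partial y^j}$ is positive definite on $N$. Put $A_{ijk}=\frac F2\frac{\partial g_{ij}}{\partial y^k}$, $A^i_{jk}=g^{il}A_{ljk}$, $\gamma^i_{jk}=\frac12g^{is}\big(\frac{\partial g_{sj}}{\partial x^k}-\frac{\partial g_{jk}}{\partial x^s}+\frac{\partial g_{sk}}{\partial x^j}\big)$, and define $N^i_j$ by $\frac{N^i_j}{F}=\gamma^i_{jk}\frac{y^k}{F}-A^i_{jk}\gamma^k_{rs}\frac{y^r}{F}\frac{y^s}{F}$. Put $\frac{\delta}{\delta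 x^j}=\frac{\partial}{\partial x^j}-N^i_j\frac{\partial}{\partial y^i}$ and $\delta y^i=dy^i+N^i_jdx^j$. The horizontal lift at $u\in\hat\pi^{-1}(x)$ is $\iota_u:T_xM\to T_uN$, $\iota_u\big(X^i\frac{\partial}{\partial x^i}\big)=X^i\frac{\delta}{\delta x^i}|_u$. $\hat\pi^*TM\to N$ is the pull-back bundle, with fiber over $u$ canonically identified with $T_{\hat\pi(u)}M$ through the map $\pi_2:\hat\pi^*TM\to TM$. $\hat\pi^*Y$ is the pull-back section of a vector field $Y$. A linear connection on $\hat\pi^*TM$ has covariant derivative $\nabla:\Gamma\hat\pi^*TM\times\Gamma TN\to\Gamma\hat\pi^*TM$, which is function-linear in the $TN$ argument and satisfies the Leibniz rule in the section argument. The indicatrix is $I_x=\{y\in T_xM:F(x,y)=1\}$. Its volume form $dvol_x$ is the pull-back to $I_x$ of the contraction of $\sqrt{\det g}\,\frac{\delta y^1}{F}\wedge\cdots\wedge\frac{\delta y^n}{F}$ with $l=\frac{y^i}{F}\frac{\partial}{\partial y^i}$ ($I_x$ is oriented so that $dvol_x$ is positive), and $vol(I_x)=\int_{I_x}dvol_x$. The integrand in the claim is a $T_xM$-valued function of $u\in I_x$. *)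

theory Defs
  imports "HOL-Analysis.Analysis"
begin

section \<open>Smooth maps between Euclidean spaces\<close>

text \<open>Intended for open \<open>S\<close> in a finite-dimensional space, where requiring that all directional
  derivatives be of class \<open>k\<close> is the usual notion of a map of class \<open>Suc k\<close>.\<close>

fun Ck_on :: "nat \<Rightarrow> ('a::real_normed_vector \<Rightarrow> 'b::real_normed_vector) \<Rightarrow> 'a set \<Rightarrow> bool" where
  "Ck_on 0 f S \<longleftrightarrow> continuous_on S f"
| "Ck_on (Suc k) f S \<longleftrightarrow>
     (\<forall>x\<in>S. f differentiable (at x)) \<and> (\<forall>v. Ck_on k (\<lambda>x. frechet_derivative f (at x) v) S)"

definition smooth_on :: "('a::real_normed_vector \<Rightarrow> 'b::real_normed_vector) \<Rightarrow> 'a set \<Rightarrow> bool" where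
  "smooth_on f S \<longleftrightarrow> (\<forall>k. Ck_on k f S)"


section \<open>Smooth manifolds\<close>

text \<open>A chart is a pair (domain, coordinate map); values of the map outside the domain are
  irrelevant. A manifold is a set of points with an atlas, and carries the topology
  determined by the atlas.\<close>

type_synonym ('p, 'e) chart = "'p set \<times> ('p \<Rightarrow> 'e)"

definition chart_inv :: "('p, 'e) chart \<Rightarrow> 'e \<Rightarrow> 'p" where
  "chart_inv c = inv_into (fst c) (snd c)"

definition charts_at :: "('p, 'e) chart set \<Rightarrow> 'p \<Rightarrow> ('p, 'e) chart set" where
  "charts_at A p = {c \<in> A. p \<in> fst c}"

definition transition ::
    "('p, 'e) chart \<Rightarrow> ('p, 'e) chart \<Rightarrow> 'e \<Rightarrow> 'e" where
  "transition c d = snd d \<circ> chart_inv c"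

definition smooth_atlas :: "'p set \<Rightarrow> ('p, 'e::euclidean_space) chart set \<Rightarrow> bool" where
  "smooth_atlas M A \<longleftrightarrow>
     (\<Union>c\<in>A. fst c) = M \<and>
     (\<forall>c\<in>A. inj_on (snd c) (fst c) \<and> open (snd c ` fst c)) \<and>
     (\<forall>c\<in>A. \<forall>d\<in>A. open (snd c ` (fst c \<inter> fst d)) \<and>
                  smooth_on (transition c d) (snd c ` (fst c \<inter> fst d)))"

definition manifold_topology ::
    "'p set \<Rightarrow> ('p, 'e::euclidean_space) chart set \<Rightarrow> 'p topology" where
  "manifold_topology M A = topology (\<lambda>W. W \<subseteq> M \<and> (\<forall>c\<in>A. open (snd c ` (fst c \<inter> W))))"

lemma istopology_manifold:
  assumes "smooth_atlas M A"
  shows "istopology (\<lambda>W. W \<subseteq> M \<and> (\<forall>c\<in>A. open (snd c ` (fst c \<inter> W))))"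
proof -
  have inter: "open (snd c ` (fst c \<inter> (S \<inter> T)))"
    if "c \<in> A" "open (snd c ` (fst c \<inter> S))" "open (snd c ` (fst c \<inter> T))" for c S T
  proof -
    have inj: "inj_on (snd c) (fst c)" using assms that(1) unfolding smooth_atlas_def by blast
    have "snd c ` ((fst c \<inter> S) \<inter> (fst c \<inter> T)) = snd c ` (fst c \<inter> S) \<inter> snd c ` (fst c \<inter> T)"
      by (rule inj_on_image_Int[OF inj]) (rule Int_lower1)+
    moreover have "fst c \<inter> (S \<inter> T) = (fst c \<inter> S) \<inter> (fst c \<inter> T)" by blast
    ultimately show ?thesis using open_Int[OF that(2,3)] by simp
  qed
  have union: "open (snd c ` (fst c \<inter> \<Union>K))"
    if "\<forall>W\<in>K. open (snd c ` (fst c \<inter> W))" for c and K :: "'a set set"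
  proof -
    have "snd c ` (fst c \<inter> \<Union>K) = (\<Union>W\<in>K. snd c ` (fst c \<inter> W))" by blast
    then show ?thesis using open_UN[of K "\<lambda>W. snd c ` (fst c \<inter> W)"] that by simp
  qed
  show ?thesis
    unfolding istopology_def
  proof (intro conjI allI impI)
    fix S T
    assume "S \<subseteq> M \<and> (\<forall>c\<in>A. open (snd c ` (fst c \<inter> S)))"
      and "T \<subseteq> M \<and> (\<forall>c\<in>A. open (snd c ` (fst c \<inter> T)))"
    then show "S \<inter> T \<subseteq> M" and "\<forall>c\<in>A. open (snd c ` (fst c \<inter> (S \<inter> T)))"
      using inter by blast+
  next
    fix K
    assume K: "\<forall>W\<in>K. W \<subseteq> M \<and> (\<forall>c\<in>A. open (snd c ` (fst c \<inter> W)))"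
    then show "\<Union>K \<subseteq> M" by blast
    show "\<forall>c\<in>A. open (snd c ` (fst c \<inter> \<Union>K))"
      using K union by blast
  qed
qed

definition smooth_manifold :: "'p set \<Rightarrow> ('p, 'e::euclidean_space) chart set \<Rightarrow> bool" where
  "smooth_manifold M A \<longleftrightarrow>
     smooth_atlas M A \<and>
     Hausdorff_space (manifold_topology M A) \<and> second_countable (manifold_topology M A)"

definition smooth_fun :: "('p, 'e::euclidean_space) chart set \<Rightarrow> ('p \<Rightarrow> real) \<Rightarrow> bool" where
  "smooth_fun A h \<longleftrightarrow> (\<forall>c\<in>A. smooth_on (h \<circ> chart_inv c) (snd c ` fst c))"


subsection \<open>Tangent vectors\<close>

text \<open>A tangent vector at \<open>p\<close> is the family of its components with respect to the charts around
  \<open>p\<close>, related by the Jacobians of the coordinate changes. The value at everything that is not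
  a chart around \<open>p\<close> is \<open>0\<close>, so that equality of tangent vectors is equality of functions and
  the vector space operations are pointwise.\<close>

type_synonym ('p, 'e) tvec = "('p, 'e) chart \<Rightarrow> 'e"

definition tangent_space ::
    "('p, 'e::euclidean_space) chart set \<Rightarrow> 'p \<Rightarrow> ('p, 'e) tvec set" where
  "tangent_space A p =
     {v. (\<forall>c. c \<notin> charts_at A p \<longrightarrow> v c = 0) \<and>
         (\<forall>c\<in>charts_at A p. \<forall>d\<in>charts_at A p.
            v d = frechet_derivative (transition c d) (at (snd c p)) (v c))}"

text \<open>The derivative \<open>v h\<close> of the function \<open>h\<close> along the tangent vector \<open>v\<close> at \<open>p\<close>. For smooth
  \<open>h\<close> it does not depend on the chart that is chosen.\<close>

definition dir_deriv ::
    "('p, 'e::euclidean_space) chart set \<Rightarrow> ('p \<Rightarrow> real) \<Rightarrow> 'p \<Rightarrow> ('p, 'e) tvec \<Rightarrow> real" where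
  "dir_deriv A h p v =
     (let c = (SOME c. c \<in> charts_at A p)
      in frechet_derivative (h \<circ> chart_inv c) (at (snd c p)) (v c))"


subsection \<open>Linear connections on pull-back bundles\<close>

text \<open>For a smooth map \<open>f\<close> from the manifold \<open>(B, AB)\<close> to the manifold with atlas \<open>A\<close>, the fibre
  of the pull-back bundle \<open>f\<^sup>*TM\<close> over \<open>b\<close> is identified with the tangent space at \<open>f b\<close>.
  Sections are extended by the zero vector outside \<open>B\<close>, so that they are determined by their
  restriction to \<open>B\<close>.\<close>

definition pullback_sections ::
    "'b set \<Rightarrow> ('b, 'g::euclidean_space) chart set \<Rightarrow> ('b \<Rightarrow> 'p) \<Rightarrow>
     ('p, 'e::euclidean_space) chart set \<Rightarrow> ('b \<Rightarrow> ('p, 'e) tvec) set" where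
  "pullback_sections B AB f A =
     {\<sigma>. (\<forall>b\<in>B. \<sigma> b \<in> tangent_space A (f b)) \<and> (\<forall>b. b \<notin> B \<longrightarrow> \<sigma> b = (\<lambda>_. 0)) \<and>
         (\<forall>d\<in>AB. \<forall>c\<in>A.
            smooth_on (\<lambda>z. \<sigma> (chart_inv d z) c) (snd d ` (fst d \<inter> f -` fst c)))}"

definition vector_fields ::
    "'p set \<Rightarrow> ('p, 'e::euclidean_space) chart set \<Rightarrow> ('p \<Rightarrow> ('p, 'e) tvec) set" where
  "vector_fields M A = pullback_sections M A (\<lambda>p. p) A"

text \<open>Here \<open>D \<sigma> V\<close> is the covariant derivative of the section \<open>\<sigma>\<close> of \<open>f\<^sup>*TM\<close> along the vector
  field \<open>V\<close> on \<open>B\<close>. Linearity over the reals in \<open>\<sigma>\<close> is the Leibniz rule for constant functions.\<close>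

definition linear_connection ::
    "'b set \<Rightarrow> ('b, 'g::euclidean_space) chart set \<Rightarrow> ('b \<Rightarrow> 'p) \<Rightarrow>
     ('p, 'e::euclidean_space) chart set \<Rightarrow>
     (('b \<Rightarrow> ('p, 'e) tvec) \<Rightarrow> ('b \<Rightarrow> ('b, 'g) tvec) \<Rightarrow> ('b \<Rightarrow> ('p, 'e) tvec)) \<Rightarrow> bool" where
  "linear_connection B AB f A D \<longleftrightarrow>
     (\<forall>\<sigma>\<in>pullback_sections B AB f A. \<forall>V\<in>vector_fields B AB.
        D \<sigma> V \<in> pullback_sections B AB f A) \<and>
     (\<forall>\<sigma>\<in>pullback_sections B AB f A. \<forall>V\<in>vector_fields B AB. \<forall>W\<in>vector_fields B AB.
        D \<sigma> (\<lambda>b d. V b d + W b d) = (\<lambda>b c. D \<sigma> V b c + D \<sigma> W b c)) \<and>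
     (\<forall>\<sigma>\<in>pullback_sections B AB f A. \<forall>V\<in>vector_fields B AB. \<forall>h. smooth_fun AB h \<longrightarrow>
        D \<sigma> (\<lambda>b d. h b *\<^sub>R V b d) = (\<lambda>b c. h b *\<^sub>R D \<sigma> V b c)) \<and>
     (\<forall>\<sigma>\<in>pullback_sections B AB f A. \<forall>\<tau>\<in>pullback_sections B AB f A. \<forall>V\<in>vector_fields B AB.
        D (\<lambda>b c. \<sigma> b c + \<tau> b c) V = (\<lambda>b c. D \<sigma> V b c + D \<tau> V b c)) \<and>
     (\<forall>\<sigma>\<in>pullback_sections B AB f A. \<forall>V\<in>vector_fields B AB. \<forall>h. smooth_fun AB h \<longrightarrow>
        D (\<lambda>b c. h b *\<^sub>R \<sigma> b c) V =
          (\<lambda>b c. dir_deriv AB h b (V b) *\<^sub>R \<sigma> b c + h b *\<^sub>R D \<sigma> V b c))"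

text \<open>The tangent bundle is its own pull-back along the identity.\<close>

definition affine_connection ::
    "'p set \<Rightarrow> ('p, 'e::euclidean_space) chart set \<Rightarrow>
     (('p \<Rightarrow> ('p, 'e) tvec) \<Rightarrow> ('p \<Rightarrow> ('p, 'e) tvec) \<Rightarrow> ('p \<Rightarrow> ('p, 'e) tvec)) \<Rightarrow> bool" where
  "affine_connection M A D \<longleftrightarrow> linear_connection M A (\<lambda>p. p) A D"

text \<open>The covariant derivative along a single tangent vector \<open>v\<close> at \<open>b\<close>: extend \<open>v\<close> to a vector
  field. By function-linearity the value does not depend on the extension.\<close>

definition cov_deriv_at ::
    "'b set \<Rightarrow> ('b, 'g::euclidean_space) chart set \<Rightarrow>
     (('b \<Rightarrow> ('p, 'e) tvec) \<Rightarrow> ('b \<Rightarrow> ('b, 'g) tvec) \<Rightarrow> ('b \<Rightarrow> ('p, 'e) tvec)) \<Rightarrow>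
     ('b \<Rightarrow> ('p, 'e) tvec) \<Rightarrow> 'b \<Rightarrow> ('b, 'g) tvec \<Rightarrow> ('p, 'e::euclidean_space) tvec" where
  "cov_deriv_at B AB D \<sigma> b v = D \<sigma> (SOME V. V \<in> vector_fields B AB \<and> V b = v) b"


section \<open>The tangent bundle and the slit tangent bundle\<close>

text \<open>A point of the tangent bundle is a pair of a point of the manifold and a tangent vector
  there, so that the bundle projection is \<open>fst\<close>.\<close>

type_synonym ('p, 'n) tpoint = "'p \<times> ('p, real^'n) tvec"

definition tangent_bundle ::
    "'p set \<Rightarrow> ('p, real^'n) chart set \<Rightarrow> ('p, 'n::finite) tpoint set" where
  "tangent_bundle M A = {(p, v). p \<in> M \<and> v \<in> tangent_space A p}"

definition slit_bundle ::
    "'p set \<Rightarrow> ('p, real^'n) chart set \<Rightarrow> ('p, 'n::finite) tpoint set" where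
  "slit_bundle M A = {(p, v). (p, v) \<in> tangent_bundle M A \<and> v \<noteq> (\<lambda>_. 0)}"

definition nat_chart ::
    "('p, real^'n) chart set \<Rightarrow> ('p, real^'n) chart \<Rightarrow>
     (('p, 'n::finite) tpoint, (real^'n) \<times> (real^'n)) chart" where
  "nat_chart A c = ({(p, v). p \<in> fst c \<and> v \<in> tangent_space A p}, \<lambda>(p, v). (snd c p, v c))"

definition slit_chart ::
    "('p, real^'n) chart set \<Rightarrow> ('p, real^'n) chart \<Rightarrow>
     (('p, 'n::finite) tpoint, (real^'n) \<times> (real^'n)) chart" where
  "slit_chart A c = ({(p, v). (p, v) \<in> fst (nat_chart A c) \<and> v \<noteq> (\<lambda>_. 0)}, snd (nat_chart A c))"

definition slit_atlas ::
    "('p, real^'n) chart set \<Rightarrow>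
     (('p, 'n::finite) tpoint, (real^'n) \<times> (real^'n)) chart set" where
  "slit_atlas A = slit_chart A ` A"

definition pullback_field ::
    "'p set \<Rightarrow> ('p, real^'n) chart set \<Rightarrow> ('p \<Rightarrow> ('p, real^'n) tvec) \<Rightarrow>
     ('p, 'n::finite) tpoint \<Rightarrow> ('p, real^'n) tvec" where
  "pullback_field M A Y = (\<lambda>u. if u \<in> slit_bundle M A then Y (fst u) else (\<lambda>_. 0))"


section \<open>Finsler geometry in natural coordinates\<close>

text \<open>Below, \<open>z = (x, y)\<close> are the natural coordinates on the tangent bundle that are induced by the
  chart \<open>c\<close>.\<close>

definition pd_x :: "'n \<Rightarrow> ((real^'n) \<times> (real^'n) \<Rightarrow> real) \<Rightarrow> (real^'n::finite) \<times> (real^'n) \<Rightarrow> real" where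
  "pd_x k h z = frechet_derivative h (at z) (axis k 1, 0)"

definition pd_y :: "'n \<Rightarrow> ((real^'n) \<times> (real^'n) \<Rightarrow> real) \<Rightarrow> (real^'n::finite) \<times> (real^'n) \<Rightarrow> real" where
  "pd_y k h z = frechet_derivative h (at z) (0, axis k 1)"

context
  fixes A :: "('p, real^'n::finite) chart set"
    and F :: "('p, 'n) tpoint \<Rightarrow> real"
begin

definition F_coord :: "('p, real^'n) chart \<Rightarrow> (real^'n) \<times> (real^'n) \<Rightarrow> real" where
  "F_coord c = F \<circ> chart_inv (nat_chart A c)"

definition fund_tensor :: "('p, real^'n) chart \<Rightarrow> (real^'n) \<times> (real^'n) \<Rightarrow> real^'n^'n" where
  "fund_tensor c z = (\<chi> i j. 1/2 * pd_y i (pd_y j (\<lambda>w. (F_coord c w)\<^sup>2)) z)"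

definition cartan_low :: "('p, real^'n) chart \<Rightarrow> (real^'n) \<times> (real^'n) \<Rightarrow> 'n \<Rightarrow> 'n \<Rightarrow> 'n \<Rightarrow> real" where
  "cartan_low c z i j k = F_coord c z / 2 * pd_y k (\<lambda>w. fund_tensor c w $ i $ j) z"

definition cartan_up :: "('p, real^'n) chart \<Rightarrow> (real^'n) \<times> (real^'n) \<Rightarrow> 'n \<Rightarrow> 'n \<Rightarrow> 'n \<Rightarrow> real" where
  "cartan_up c z i j k =
     (\<Sum>l\<in>UNIV. matrix_inv (fund_tensor c z) $ i $ l * cartan_low c z l j k)"

definition formal_christoffel ::
    "('p, real^'n) chart \<Rightarrow> (real^'n) \<times> (real^'n) \<Rightarrow> 'n \<Rightarrow> 'n \<Rightarrow> 'n \<Rightarrow> real" where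
  "formal_christoffel c z i j k =
     1/2 * (\<Sum>s\<in>UNIV. matrix_inv (fund_tensor c z) $ i $ s *
        (pd_x k (\<lambda>w. fund_tensor c w $ s $ j) z
         - pd_x s (\<lambda>w. fund_tensor c w $ j $ k) z
         + pd_x j (\<lambda>w. fund_tensor c w $ s $ k) z))"

text \<open>Row \<open>i\<close>, column \<open>j\<close> of the following matrix is the coefficient with upper index \<open>i\<close> and lower
  index \<open>j\<close>.\<close>

definition nonlin_conn :: "('p, real^'n) chart \<Rightarrow> (real^'n) \<times> (real^'n) \<Rightarrow> real^'n^'n" where
  "nonlin_conn c z =
     (let f = F_coord c z; y = snd z in
      \<chi> i j. f *
        ((\<Sum>k\<in>UNIV. formal_christoffel c z i j k * (y $ k / f))
         - (\<Sum>k\<in>UNIV. \<Sum>r\<in>UNIV. \<Sum>s\<in>UNIV.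
              cartan_up c z i j k * formal_christoffel c z k r s * (y $ r / f) * (y $ s / f))))"

text \<open>The value on \<open>(\<xi>, \<eta>)\<close> of the column of the one-forms \<open>\<delta>y = dy + N dx\<close>.\<close>

definition delta_y ::
    "('p, real^'n) chart \<Rightarrow> (real^'n) \<times> (real^'n) \<Rightarrow> (real^'n) \<times> (real^'n) \<Rightarrow> real^'n" where
  "delta_y c z w = snd w + nonlin_conn c z *v fst w"

text \<open>The horizontal lift is the tangent vector of the slit tangent bundle that is
  \<open>X\<^sup>i \<delta>/\<delta>x\<^sup>i = X\<^sup>i \<partial>/\<partial>x\<^sup>i - N\<^sup>i\<^sub>j X\<^sup>j \<partial>/\<partial>y\<^sup>i\<close> in every system of natural coordinates.\<close>

definition horizontal_lift ::
    "('p, 'n) tpoint \<Rightarrow> ('p, real^'n) tvec \<Rightarrow>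
     (('p, 'n) tpoint, (real^'n) \<times> (real^'n)) tvec" where
  "horizontal_lift u X =
     (THE \<xi>. \<xi> \<in> tangent_space (slit_atlas A) u \<and>
        (\<forall>c\<in>charts_at A (fst u).
           \<xi> (slit_chart A c) = (X c, - (nonlin_conn c (snd (nat_chart A c) u) *v X c))))"


subsection \<open>The indicatrix and its volume\<close>

definition indicatrix :: "'p \<Rightarrow> ('p, real^'n) tvec set" where
  "indicatrix x = {v \<in> tangent_space A x. F (x, v) = 1}"

text \<open>The \<open>n\<close>-form \<open>sqrt(det g) (\<delta>y\<^sup>1/F) \<and> \<dots> \<and> (\<delta>y\<^sup>n/F)\<close> at \<open>z\<close>, on \<open>n\<close> vectors.\<close>

definition vol_form ::
    "('p, real^'n) chart \<Rightarrow> (real^'n) \<times> (real^'n) \<Rightarrow> ('n \<Rightarrow> (real^'n) \<times> (real^'n)) \<Rightarrow> real" where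
  "vol_form c z w =
     sqrt (det (fund_tensor c z)) * det (\<chi> i j. delta_y c z (w j) $ i / F_coord c z)"

text \<open>The density of the contraction of the volume form with \<open>l\<close> in a local parametrization \<open>\<phi>\<close>
  of the indicatrix (in the fibre coordinates \<open>y\<close>) by \<open>n - 1\<close> real parameters, which are indexed
  by all indices except \<open>k\<close>: the form is evaluated on \<open>l\<close>, in the slot \<open>k\<close>, and on the vertical
  vectors tangent to the parameter lines. The orientation making the form positive (and the
  position of the slot for \<open>l\<close>) is accounted for by the absolute value.\<close>

definition indicatrix_density ::
    "('p, real^'n) chart \<Rightarrow> real^'n \<Rightarrow> 'n \<Rightarrow> (real^'n \<Rightarrow> real^'n) \<Rightarrow> real^'n \<Rightarrow> real" where
  "indicatrix_density c x k \<phi> t =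
     (let z = (x, \<phi> t) in
      \<bar>vol_form c z (\<lambda>j. if j = k then (0, \<phi> t /\<^sub>R F_coord c z)
                         else (0, frechet_derivative \<phi> (at t) (axis j 1)))\<bar>)"

end

text \<open>The space of \<open>n - 1\<close> parameters, realized as a coordinate hyperplane, with its
  \<open>(n - 1)\<close>-dimensional Lebesgue measure (for \<open>n = 1\<close>, the unit mass at the origin).\<close>

definition coord_hyperplane :: "'n \<Rightarrow> (real^'n::finite) set" where
  "coord_hyperplane k = {t. t $ k = 0}"

definition hyperplane_measure :: "'n \<Rightarrow> (real^'n::finite) measure" where
  "hyperplane_measure k =
     distr (Pi\<^sub>M (- {k}) (\<lambda>_. lborel)) borel (\<lambda>f. \<chi> i. if i = k then 0 else f i)"

definition hypersurface_param ::
    "'n \<Rightarrow> (real^'n) set \<Rightarrow> (real^'n \<Rightarrow> real^'n) \<Rightarrow> (real^'n::finite) set \<Rightarrow> bool" where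
  "hypersurface_param k W \<phi> S \<longleftrightarrow>
     open W \<and> smooth_on \<phi> W \<and>
     \<phi> ` (W \<inter> coord_hyperplane k) \<subseteq> S \<and> inj_on \<phi> (W \<inter> coord_hyperplane k) \<and>
     (\<forall>t \<in> W \<inter> coord_hyperplane k. \<forall>w \<in> coord_hyperplane k.
        frechet_derivative \<phi> (at t) w = 0 \<longrightarrow> w = 0)"

text \<open>The measure on the indicatrix that integrates the volume form: on the image of every local
  parametrization, in the fibre coordinates of every chart, it is given by the integral of the
  density over the parameters.\<close>

definition is_indicatrix_measure ::
    "('p, real^'n) chart set \<Rightarrow> (('p, 'n::finite) tpoint \<Rightarrow> real) \<Rightarrow> 'p \<Rightarrow>
     ('p, real^'n) tvec measure \<Rightarrow> bool" where
  "is_indicatrix_measure A F x \<mu> \<longleftrightarrow>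
     space \<mu> = indicatrix A F x \<and>
     (\<forall>c\<in>charts_at A x.
        sets \<mu> = sets (vimage_algebra (indicatrix A F x) (\<lambda>v. v c) borel) \<and>
        (\<forall>k W \<phi>. hypersurface_param k W \<phi> ((\<lambda>v. v c) ` indicatrix A F x) \<longrightarrow>
           (\<forall>E\<in>sets borel. E \<subseteq> \<phi> ` (W \<inter> coord_hyperplane k) \<longrightarrow>
              emeasure \<mu> {v \<in> indicatrix A F x. v c \<in> E} =
              (\<integral>\<^sup>+ t \<in> {t \<in> W \<inter> coord_hyperplane k. \<phi> t \<in> E}.
                 ennreal (indicatrix_density A F c (snd c x) k \<phi> t) \<partial>hyperplane_measure k))))"

definition dvol ::
    "('p, real^'n) chart set \<Rightarrow> (('p, 'n::finite) tpoint \<Rightarrow> real) \<Rightarrow> 'p \<Rightarrow>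
     ('p, real^'n) tvec measure" where
  "dvol A F x = (THE \<mu>. is_indicatrix_measure A F x \<mu>)"

definition vol_indicatrix ::
    "('p, real^'n) chart set \<Rightarrow> (('p, 'n::finite) tpoint \<Rightarrow> real) \<Rightarrow> 'p \<Rightarrow> real" where
  "vol_indicatrix A F x = measure (dvol A F x) (indicatrix A F x)"


subsection \<open>Finsler spaces\<close>

definition finsler_space ::
    "'p set \<Rightarrow> ('p, real^'n) chart set \<Rightarrow> (('p, 'n::finite) tpoint \<Rightarrow> real) \<Rightarrow> bool" where
  "finsler_space M A F \<longleftrightarrow>
     smooth_manifold M A \<and>
     (\<forall>u \<in> tangent_bundle M A. 0 \<le> F u) \<and>
     smooth_fun (slit_atlas A) F \<and>
     (\<forall>(x, v) \<in> tangent_bundle M A. \<forall>r\<ge>0. F (x, \<lambda>c. r *\<^sub>R v c) = r * F (x, v)) \<and>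
     (\<forall>u \<in> slit_bundle M A. \<forall>c \<in> charts_at A (fst u).
        \<forall>w. w \<noteq> 0 \<longrightarrow> 0 < w \<bullet> (fund_tensor A F c (snd (nat_chart A c) u) *v w))"


section \<open>The averaged connection\<close>

text \<open>The averaged covariant derivative of \<open>Y\<close> along \<open>X\<close>, a tangent vector at \<open>x\<close>. Sections of the
  pull-back bundle take their values in the tangent spaces of \<open>M\<close>, so the projection to the
  tangent bundle of \<open>M\<close> is not visible. The integral of a function with values in the tangent
  space at \<open>x\<close> is taken componentwise.\<close>

definition averaged_deriv ::
    "'p set \<Rightarrow> ('p, real^'n) chart set \<Rightarrow> (('p, 'n::finite) tpoint \<Rightarrow> real) \<Rightarrow>
     ((('p, 'n) tpoint \<Rightarrow> ('p, real^'n) tvec) \<Rightarrow>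
      (('p, 'n) tpoint \<Rightarrow> (('p, 'n) tpoint, (real^'n) \<times> (real^'n)) tvec) \<Rightarrow>
      (('p, 'n) tpoint \<Rightarrow> ('p, real^'n) tvec)) \<Rightarrow>
     'p \<Rightarrow> ('p, real^'n) tvec \<Rightarrow> ('p \<Rightarrow> ('p, real^'n) tvec) \<Rightarrow> ('p, real^'n) tvec" where
  "averaged_deriv M A F D x X Y =
     (\<lambda>c. if c \<in> charts_at A x
          then (1 / vol_indicatrix A F x) *\<^sub>R
            (LINT v | dvol A F x.
               cov_deriv_at (slit_bundle M A) (slit_atlas A) D (pullback_field M A Y)
                 (x, v) (horizontal_lift A F (x, v) X) c)
          else 0)"

definition averaged_connection ::
    "'p set \<Rightarrow> ('p, real^'n) chart set \<Rightarrow> (('p, 'n::finite) tpoint \<Rightarrow> real) \<Rightarrow>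
     ((('p, 'n) tpoint \<Rightarrow> ('p, real^'n) tvec) \<Rightarrow>
      (('p, 'n) tpoint \<Rightarrow> (('p, 'n) tpoint, (real^'n) \<times> (real^'n)) tvec) \<Rightarrow>
      (('p, 'n) tpoint \<Rightarrow> ('p, real^'n) tvec)) \<Rightarrow>
     ('p \<Rightarrow> ('p, real^'n) tvec) \<Rightarrow> ('p \<Rightarrow> ('p, real^'n) tvec) \<Rightarrow> ('p \<Rightarrow> ('p, real^'n) tvec)" where
  "averaged_connection M A F D Y X = (\<lambda>x. averaged_deriv M A F D x (X x) Y)"

end

theory Submission
  imports Defs
begin

text \<open>Write \<open>\<pi>\<close> for the projection of the slit tangent bundle, \<open>X\<^sup>H\<close> for the horizontal lift of a
  vector field \<open>X\<close> and \<open>\<pi>\<^sup>*Y\<close> for the pull-back of \<open>Y\<close>. The averaged derivative of \<open>Y\<close> along \<open>X\<close> is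
  the fibrewise average of the section \<open>\<nabla>\<^bsub>X\<^sup>H\<^esub> \<pi>\<^sup>*Y\<close>. Both lifts are additive and turn multiplication by
  \<open>h\<close> into multiplication by \<open>h \<circ> \<pi>\<close>, which is constant on the fibres and leaves the average as a
  factor. Moreover \<open>X\<^sup>H (h \<circ> \<pi>) = (X h) \<circ> \<pi>\<close>, and the average of \<open>\<pi>\<^sup>*Y\<close> is \<open>Y\<close>. Hence function-linearity
  and the Leibniz rule for \<open>\<nabla>\<close> give those for the averaged connection. What remains is that the
  objects in this argument exist and that the average of a smooth section is smooth.

  A connection is a pointwise operation in the direction (\<open>connection_pointwise\<close>), and every tangent
  vector extends to a vector field (\<open>vector_field_extension\<close>). Both use bump functions; on the slit
  bundle these are pulled back from \<open>M\<close>, because its charts live over whole chart domains of \<open>M\<close>.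

  The horizontal lift is independent of coordinates because the nonlinear connection is half of the
  vertical derivative of the geodesic spray (\<open>nonlin_conn_spray\<close>). The spray is characterized by the
  Euler-Lagrange equation of \<open>F\<^sup>2/2\<close>, which has the same form in all coordinates; this yields the
  transformation law of the spray, and its vertical derivative is the transformation law of the
  nonlinear connection (\<open>spray_transition\<close>, \<open>nonlin_conn_transition\<close>).

  The measure on the indicatrix is obtained from cones. The fundamental tensor is homogeneous of
  degree \<open>0\<close>, so in polar coordinates along a parametrized piece of the indicatrix the radial variable
  separates, and what is left is the density of the contracted volume form (\<open>polar_formula\<close>). The
  measure is thus the image under \<open>y \<mapsto> y/F(x,y)\<close> of the density \<open>\<surd>(det g) (|y|/F)\<^sup>n\<close> on the shell
  \<open>1 \<le> |y| \<le> 2\<close>, up to a constant. It does not depend on the chart, since the determinants of the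
  coordinate change cancel, and it is the only one with the required values on parametrized pieces
  (\<open>indicatrix_measure_unique\<close>). In this form an average is an integral over a fixed compact set of
  a function that is smooth in the base point and the fibre coordinate, and it is smooth by
  differentiation under the integral sign (\<open>smooth_on_parametric_integral\<close>).\<close>

section \<open>Calculus of smooth maps\<close>

lemma Ck_on_cong_imp:
  assumes "Ck_on k f S" "open S" "\<And>x. x \<in> S \<Longrightarrow> f x = g x"
  shows "Ck_on k g S"
  using assms
proof (induction k arbitrary: f g)
  case 0
  then show ?case using continuous_on_cong[of S S f g] by auto
next
  case (Suc k)
  have fd: "(f has_derivative frechet_derivative f (at x)) (at x)" if "x \<in> S" for x
    using Suc.prems(1) that by (auto simp: frechet_derivative_works)
  have gd: "(g has_derivative frechet_derivative f (at x)) (at x)" if "x \<in> S" for x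
    using has_derivative_transform_within_open[OF fd[OF that] Suc.prems(2) that] Suc.prems(3)
    by blast
  have eq: "frechet_derivative f (at x) = frechet_derivative g (at x)" if "x \<in> S" for x
    using frechet_derivative_at[OF gd[OF that]] .
  have "Ck_on k (\<lambda>x. frechet_derivative g (at x) v) S" for v
    by (rule Suc.IH[of "\<lambda>x. frechet_derivative f (at x) v"])
      (use Suc.prems eq in auto)
  then show ?case using gd by (auto simp: differentiable_def)
qed

text \<open>The derivative may be given by any expression, which is then shown to be of class \<open>k\<close>; this
  is the induction step in all closure properties below.\<close>

lemma Ck_on_SucI:
  assumes "open S" "\<And>x. x \<in> S \<Longrightarrow> (f has_derivative f' x) (at x)"
    and "\<And>v. Ck_on k (\<lambda>x. f' x v) S"
  shows "Ck_on (Suc k) f S"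
proof -
  have "f' x = frechet_derivative f (at x)" if "x \<in> S" for x
    using frechet_derivative_at assms(2)[OF that] by blast
  then have "Ck_on k (\<lambda>x. frechet_derivative f (at x) v) S" for v
    using Ck_on_cong_imp[OF assms(3)[of v] assms(1)] by simp
  then show ?thesis using assms(2) by (auto simp: differentiable_def)
qed

lemma Ck_on_has_derivative:
  "Ck_on (Suc k) f S \<Longrightarrow> x \<in> S \<Longrightarrow> (f has_derivative frechet_derivative f (at x)) (at x)"
  by (auto simp: frechet_derivative_works)

lemma Ck_on_lower: "Ck_on (Suc k) f S \<Longrightarrow> Ck_on k f S"
proof (induction k arbitrary: f)
  case 0
  then have "\<forall>x\<in>S. f differentiable (at x)" by simp
  then show ?case
    by (auto intro!: continuous_at_imp_continuous_on differentiable_imp_continuous_within)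
next
  case (Suc k)
  from Suc.prems have "Ck_on (Suc k) (\<lambda>x. frechet_derivative f (at x) v) S" for v by simp
  then have "Ck_on k (\<lambda>x. frechet_derivative f (at x) v) S" for v by (rule Suc.IH)
  then show ?case using Suc.prems by simp
qed

lemma Ck_on_imp_continuous_on: "Ck_on k f S \<Longrightarrow> continuous_on S f"
  by (induction k) (auto dest: Ck_on_lower simp del: Ck_on.simps(2))

lemma Ck_on_subset: "Ck_on k f S \<Longrightarrow> T \<subseteq> S \<Longrightarrow> Ck_on k f T"
  by (induction k arbitrary: f) (auto intro: continuous_on_subset)

lemma Ck_on_local:
  assumes "\<And>x. x \<in> S \<Longrightarrow> \<exists>U. open U \<and> x \<in> U \<and> Ck_on k f U"
  shows "Ck_on k f S"
  using assms
proof (induction k arbitrary: f)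
  case 0
  have "continuous (at x) f" if "x \<in> S" for x
    using 0[OF that] by (auto simp: continuous_on_eq_continuous_at)
  then show ?case by (simp add: continuous_at_imp_continuous_on)
next
  case (Suc k)
  have "Ck_on k (\<lambda>x. frechet_derivative f (at x) v) S" for v
    by (rule Suc.IH) (use Suc.prems in fastforce)
  then show ?case using Suc.prems by fastforce
qed

lemma Ck_on_const: "Ck_on k (\<lambda>x. c) S"
  by (induction k arbitrary: c) auto

lemma Ck_on_bounded_linear:
  assumes "bounded_linear L" "open S"
  shows "Ck_on k L S"
proof (cases k)
  case 0
  then show ?thesis using linear_continuous_on[OF assms(1)] by simp
next
  case (Suc j)
  show ?thesis unfolding Suc
    by (rule Ck_on_SucI[where f' = "\<lambda>_. L"])
      (auto intro: assms bounded_linear_imp_has_derivative Ck_on_const)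
qed

lemma Ck_on_add:
  assumes "open S"
  shows "Ck_on k f S \<Longrightarrow> Ck_on k g S \<Longrightarrow> Ck_on k (\<lambda>x. f x + g x) S"
proof (induction k arbitrary: f g)
  case 0
  then show ?case by (auto intro: continuous_intros)
next
  case (Suc k)
  show ?case
    by (rule Ck_on_SucI[OF assms, where f' = "\<lambda>x v. frechet_derivative f (at x) v + frechet_derivative g (at x) v"])
      (use Suc.prems Suc.IH in \<open>auto intro!: has_derivative_add Ck_on_has_derivative\<close>)
qed

lemma Ck_on_bilinear:
  assumes "open S" "bounded_bilinear B"
  shows "Ck_on k f S \<Longrightarrow> Ck_on k g S \<Longrightarrow> Ck_on k (\<lambda>x. B (f x) (g x)) S"
proof (induction k arbitrary: f g)
  case 0
  then show ?case using bounded_bilinear.continuous_on[OF assms(2)] by auto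
next
  case (Suc k)
  show ?case
  proof (rule Ck_on_SucI[OF assms(1)])
    show "((\<lambda>x. B (f x) (g x)) has_derivative
        (\<lambda>v. B (f x) (frechet_derivative g (at x) v) + B (frechet_derivative f (at x) v) (g x))) (at x)"
      if "x \<in> S" for x
      by (rule bounded_bilinear.FDERIV[OF assms(2)]) (use Suc.prems that in \<open>auto intro: Ck_on_has_derivative\<close>)
    show "Ck_on k (\<lambda>x. B (f x) (frechet_derivative g (at x) v) + B (frechet_derivative f (at x) v) (g x)) S" for v
      by (intro Ck_on_add[OF assms(1)] Suc.IH Ck_on_lower[of k f] Ck_on_lower[of k g] Suc.prems)
        (use Suc.prems in auto)
  qed
qed

lemma Ck_on_sum:
  assumes "open S" "\<And>i. i \<in> I \<Longrightarrow> Ck_on k (f i) S"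
  shows "Ck_on k (\<lambda>x. \<Sum>i\<in>I. f i x) S"
  using assms(2)
  by (induction I rule: infinite_finite_induct) (auto intro: Ck_on_const Ck_on_add[OF assms(1)])

text \<open>The derivative of a composition is, by linearity, a finite sum of products of lower-order
  data: the components of the inner derivative times the partial derivatives of the outer map.\<close>

lemma Ck_on_compose:
  fixes f :: "'a::real_normed_vector \<Rightarrow> 'b::euclidean_space"
  assumes "open S" "open T" "f ` S \<subseteq> T"
  shows "Ck_on k g T \<Longrightarrow> Ck_on k f S \<Longrightarrow> Ck_on k (\<lambda>x. g (f x)) S"
proof (induction k arbitrary: g)
  case 0
  then show ?case using assms(3) by (auto intro: continuous_on_compose2)
next
  case (Suc k)
  have gd: "(g has_derivative frechet_derivative g (at y)) (at y)" if "y \<in> T" for y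
    using Suc.prems(1) that by (rule Ck_on_has_derivative)
  have lin: "linear (frechet_derivative g (at y))" if "y \<in> T" for y
    using gd[OF that] has_derivative_linear by blast
  have *: "frechet_derivative g (at y) w = (\<Sum>b\<in>Basis. (w \<bullet> b) *\<^sub>R frechet_derivative g (at y) b)"
    if "y \<in> T" for y w
    by (subst euclidean_representation[of w, symmetric])
      (simp only: linear_sum[OF lin[OF that]] linear_scale[OF lin[OF that]])
  show ?case
  proof (rule Ck_on_SucI[OF assms(1)])
    fix x assume x: "x \<in> S"
    then have fx: "f x \<in> T" using assms(3) by blast
    have "((\<lambda>x. g (f x)) has_derivative
        (\<lambda>v. frechet_derivative g (at (f x)) (frechet_derivative f (at x) v))) (at x)"
      by (rule has_derivative_compose[OF Ck_on_has_derivative[OF Suc.prems(2) x] gd[OF fx]])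
    then show "((\<lambda>x. g (f x)) has_derivative
        (\<lambda>v. \<Sum>b\<in>Basis. (frechet_derivative f (at x) v \<bullet> b) *\<^sub>R frechet_derivative g (at (f x)) b)) (at x)"
      by (subst (asm) *[OF fx])
  next
    fix v
    show "Ck_on k (\<lambda>x. \<Sum>b\<in>Basis. (frechet_derivative f (at x) v \<bullet> b) *\<^sub>R frechet_derivative g (at (f x)) b) S"
      by (intro Ck_on_sum[OF assms(1)] Ck_on_bilinear[OF assms(1) bounded_bilinear_scaleR]
          Ck_on_bilinear[OF assms(1) bounded_bilinear_inner] Ck_on_const Suc.IH Ck_on_lower[OF Suc.prems(2)])
        (use Suc.prems in auto)
  qed
qed

text \<open>The derivative of the reciprocal is built from the derivative of \<open>f\<close> and from the reciprocal
  itself, which is of class \<open>k\<close> by the induction hypothesis. The same argument works for the square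
  root.\<close>

lemma Ck_on_inverse:
  fixes f :: "'a::real_normed_vector \<Rightarrow> real"
  assumes "open S" "\<And>x. x \<in> S \<Longrightarrow> f x \<noteq> 0"
  shows "Ck_on k f S \<Longrightarrow> Ck_on k (\<lambda>x. inverse (f x)) S"
proof (induction k)
  case 0
  then show ?case using assms by (auto intro: continuous_on_inverse)
next
  case (Suc k)
  have IH: "Ck_on k (\<lambda>x. inverse (f x)) S" using Suc by (auto dest: Ck_on_lower simp del: Ck_on.simps(2))
  show ?case
  proof (rule Ck_on_SucI[OF assms(1)])
    fix x assume x: "x \<in> S"
    show "((\<lambda>x. inverse (f x)) has_derivative
        (\<lambda>v. - 1 * (inverse (f x) * frechet_derivative f (at x) v * inverse (f x)))) (at x)"
      using Deriv.has_derivative_inverse[OF assms(2)[OF x] Ck_on_has_derivative[OF Suc.prems x]] by simp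
  next
    fix v
    show "Ck_on k (\<lambda>x. - 1 * (inverse (f x) * frechet_derivative f (at x) v * inverse (f x))) S"
      by (intro Ck_on_bilinear[OF assms(1) bounded_bilinear_mult] Ck_on_const IH)
        (use Suc.prems in auto)
  qed
qed

lemma Ck_on_sqrt:
  fixes f :: "'a::real_normed_vector \<Rightarrow> real"
  assumes "open S" "\<And>x. x \<in> S \<Longrightarrow> 0 < f x"
  shows "Ck_on k f S \<Longrightarrow> Ck_on k (\<lambda>x. sqrt (f x)) S"
proof (induction k)
  case 0
  then show ?case by (auto intro: continuous_on_real_sqrt)
next
  case (Suc k)
  have nz: "sqrt (f x) \<noteq> 0" if "x \<in> S" for x using assms(2)[OF that] by simp
  have IH: "Ck_on k (\<lambda>x. sqrt (f x)) S" using Suc by (auto dest: Ck_on_lower simp del: Ck_on.simps(2))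
  show ?case
  proof (rule Ck_on_SucI[OF assms(1)])
    fix x assume x: "x \<in> S"
    show "((\<lambda>x. sqrt (f x)) has_derivative
        (\<lambda>v. frechet_derivative f (at x) v * (inverse (sqrt (f x)) * (1/2)))) (at x)"
      using has_derivative_real_sqrt[OF assms(2)[OF x] Ck_on_has_derivative[OF Suc.prems x]]
      by (simp add: field_simps)
  next
    fix v
    show "Ck_on k (\<lambda>x. frechet_derivative f (at x) v * (inverse (sqrt (f x)) * (1/2))) S"
      by (intro Ck_on_bilinear[OF assms(1) bounded_bilinear_mult] Ck_on_const Ck_on_inverse[OF assms(1)] IH nz)
        (use Suc.prems in auto)
  qed
qed

lemma smooth_on_cong:
  assumes "smooth_on f S" "open S" "\<And>x. x \<in> S \<Longrightarrow> f x = g x"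
  shows "smooth_on g S"
  using assms Ck_on_cong_imp unfolding smooth_on_def by blast

lemma smooth_on_subset: "smooth_on f S \<Longrightarrow> T \<subseteq> S \<Longrightarrow> smooth_on f T"
  using Ck_on_subset unfolding smooth_on_def by blast

lemma smooth_on_local:
  assumes "\<And>x. x \<in> S \<Longrightarrow> \<exists>U. open U \<and> x \<in> U \<and> smooth_on f U"
  shows "smooth_on f S"
  using assms Ck_on_local unfolding smooth_on_def by metis

lemma smooth_on_has_derivative:
  "smooth_on f S \<Longrightarrow> x \<in> S \<Longrightarrow> (f has_derivative frechet_derivative f (at x)) (at x)"
  unfolding smooth_on_def using Ck_on_has_derivative by blast

lemma smooth_on_linear_derivative:
  "smooth_on f S \<Longrightarrow> x \<in> S \<Longrightarrow> linear (frechet_derivative f (at x))"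
  by (meson has_derivative_linear smooth_on_has_derivative)

lemma smooth_on_continuous_on: "smooth_on f S \<Longrightarrow> continuous_on S f"
  unfolding smooth_on_def using Ck_on_imp_continuous_on by blast

lemma smooth_on_derivative: "smooth_on f S \<Longrightarrow> smooth_on (\<lambda>x. frechet_derivative f (at x) v) S"
  unfolding smooth_on_def by (metis Ck_on.simps(2))

lemma smooth_on_const: "smooth_on (\<lambda>x. c) S"
  unfolding smooth_on_def using Ck_on_const by blast

lemma smooth_on_bounded_linear: "bounded_linear L \<Longrightarrow> open S \<Longrightarrow> smooth_on L S"
  unfolding smooth_on_def using Ck_on_bounded_linear by blast

lemma smooth_on_add:
  "open S \<Longrightarrow> smooth_on f S \<Longrightarrow> smooth_on g S \<Longrightarrow> smooth_on (\<lambda>x. f x + g x) S"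
  unfolding smooth_on_def using Ck_on_add by blast

lemma smooth_on_bilinear:
  "bounded_bilinear B \<Longrightarrow> open S \<Longrightarrow> smooth_on f S \<Longrightarrow> smooth_on g S \<Longrightarrow>
    smooth_on (\<lambda>x. B (f x) (g x)) S"
  unfolding smooth_on_def using Ck_on_bilinear by blast

lemmas smooth_on_scaleR = smooth_on_bilinear[OF bounded_bilinear_scaleR]
lemmas smooth_on_inner = smooth_on_bilinear[OF bounded_bilinear_inner]

lemma smooth_on_mult:
  fixes f g :: "'a::real_normed_vector \<Rightarrow> real"
  shows "open S \<Longrightarrow> smooth_on f S \<Longrightarrow> smooth_on g S \<Longrightarrow> smooth_on (\<lambda>x. f x * g x) S"
  by (rule smooth_on_bilinear[OF bounded_bilinear_mult])

lemma smooth_on_sum: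
  "open S \<Longrightarrow> (\<And>i. i \<in> I \<Longrightarrow> smooth_on (f i) S) \<Longrightarrow> smooth_on (\<lambda>x. \<Sum>i\<in>I. f i x) S"
  unfolding smooth_on_def by (auto intro: Ck_on_sum)

lemma smooth_on_compose:
  fixes f :: "'a::real_normed_vector \<Rightarrow> 'b::euclidean_space"
  shows "smooth_on g T \<Longrightarrow> smooth_on f S \<Longrightarrow> open S \<Longrightarrow> open T \<Longrightarrow> f ` S \<subseteq> T \<Longrightarrow>
    smooth_on (\<lambda>x. g (f x)) S"
  unfolding smooth_on_def by (auto intro: Ck_on_compose)

lemma smooth_on_linear_compose:
  fixes f :: "'a::real_normed_vector \<Rightarrow> 'b::euclidean_space"
  assumes "linear L" "open S" "smooth_on f S"
  shows "smooth_on (\<lambda>x. L (f x)) S"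
  using smooth_on_compose[OF smooth_on_bounded_linear[OF linear_conv_bounded_linear[THEN iffD1, OF assms(1)] open_UNIV] assms(3,2)]
  by simp

lemma smooth_on_inverse:
  fixes f :: "'a::real_normed_vector \<Rightarrow> real"
  shows "open S \<Longrightarrow> (\<And>x. x \<in> S \<Longrightarrow> f x \<noteq> 0) \<Longrightarrow> smooth_on f S \<Longrightarrow> smooth_on (\<lambda>x. inverse (f x)) S"
  unfolding smooth_on_def using Ck_on_inverse[of S f] by blast

lemma smooth_on_divide:
  fixes f g :: "'a::real_normed_vector \<Rightarrow> real"
  shows "open S \<Longrightarrow> (\<And>x. x \<in> S \<Longrightarrow> g x \<noteq> 0) \<Longrightarrow> smooth_on f S \<Longrightarrow> smooth_on g S \<Longrightarrow>
    smooth_on (\<lambda>x. f x / g x) S"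
  unfolding divide_inverse by (intro smooth_on_mult smooth_on_inverse)

lemma smooth_on_sqrt:
  fixes f :: "'a::real_normed_vector \<Rightarrow> real"
  shows "open S \<Longrightarrow> (\<And>x. x \<in> S \<Longrightarrow> 0 < f x) \<Longrightarrow> smooth_on f S \<Longrightarrow> smooth_on (\<lambda>x. sqrt (f x)) S"
  unfolding smooth_on_def using Ck_on_sqrt[of S f] by blast

lemma smooth_on_minus: "open S \<Longrightarrow> smooth_on f S \<Longrightarrow> smooth_on (\<lambda>x. - f x) S"
  using smooth_on_scaleR[of S "\<lambda>_. - 1" f] by (simp add: smooth_on_const)

lemma smooth_on_diff:
  "open S \<Longrightarrow> smooth_on f S \<Longrightarrow> smooth_on g S \<Longrightarrow> smooth_on (\<lambda>x. f x - g x) S"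
  using smooth_on_add[of S f "\<lambda>x. - g x"] by (simp add: smooth_on_minus)

lemma smooth_on_prod:
  fixes f :: "'i \<Rightarrow> 'a::real_normed_vector \<Rightarrow> real"
  assumes "open S" "\<And>i. i \<in> I \<Longrightarrow> smooth_on (f i) S"
  shows "smooth_on (\<lambda>x. \<Prod>i\<in>I. f i x) S"
  using assms(2)
  by (induction I rule: infinite_finite_induct)
    (auto intro: smooth_on_const smooth_on_mult[OF assms(1)])

lemma smooth_on_power:
  fixes f :: "'a::real_normed_vector \<Rightarrow> real"
  shows "open S \<Longrightarrow> smooth_on f S \<Longrightarrow> smooth_on (\<lambda>x. f x ^ m) S"
  by (induction m) (auto intro: smooth_on_const smooth_on_mult)

lemma smooth_on_fst: "open S \<Longrightarrow> smooth_on fst S"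
  and smooth_on_snd: "open S \<Longrightarrow> smooth_on snd S"
  by (auto intro: smooth_on_bounded_linear bounded_linear_fst bounded_linear_snd)

lemma smooth_on_id: "open S \<Longrightarrow> smooth_on (\<lambda>x. x) S"
  by (rule smooth_on_bounded_linear[OF bounded_linear_ident])

lemma smooth_on_Pair:
  fixes f :: "'a::real_normed_vector \<Rightarrow> 'b::euclidean_space" and g :: "'a \<Rightarrow> 'c::euclidean_space"
  assumes "open S" "smooth_on f S" "smooth_on g S"
  shows "smooth_on (\<lambda>x. (f x, g x)) S"
proof -
  have "linear (\<lambda>u::'b. (u, 0::'c))" "linear (\<lambda>v::'c. (0::'b, v))"
    by (auto intro!: linearI)
  from smooth_on_add[OF assms(1) smooth_on_linear_compose[OF this(1) assms(1,2)]
      smooth_on_linear_compose[OF this(2) assms(1,3)]]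
  show ?thesis by simp
qed

lemma smooth_on_nth:
  fixes f :: "'a::real_normed_vector \<Rightarrow> 'b::euclidean_space^'n"
  shows "open S \<Longrightarrow> smooth_on f S \<Longrightarrow> smooth_on (\<lambda>x. f x $ i) S"
  by (rule smooth_on_linear_compose[of "\<lambda>u. u $ i"]) (auto intro: linearI)

lemma smooth_on_vec_lambda:
  fixes f :: "'a::real_normed_vector \<Rightarrow> 'n::finite \<Rightarrow> 'b::euclidean_space"
  assumes "open S" "\<And>i. smooth_on (\<lambda>x. f x i) S"
  shows "smooth_on (\<lambda>x. \<chi> i. f x i) S"
proof -
  have lin: "linear (\<lambda>u::'b. \<chi> j. if j = i then u else 0)" for i :: 'n
    by (auto intro!: linearI simp: vec_eq_iff)
  have "(\<chi> i. f x i) = (\<Sum>i\<in>UNIV. (\<chi> j. if j = i then f x i else 0))" for x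
    by (simp add: vec_eq_iff)
  moreover have "smooth_on (\<lambda>x. \<Sum>i\<in>UNIV. (\<chi> j. if j = i then f x i else 0)) S"
    by (rule smooth_on_sum[OF assms(1)]) (rule smooth_on_linear_compose[OF lin assms(1,2)])
  ultimately show ?thesis by simp
qed

lemma smooth_on_matrix_vector_mult:
  fixes P :: "'a::real_normed_vector \<Rightarrow> real^'n^'m"
  shows "open S \<Longrightarrow> smooth_on P S \<Longrightarrow> smooth_on v S \<Longrightarrow> smooth_on (\<lambda>x. P x *v v x) S"
  unfolding matrix_vector_mult_def
  by (intro smooth_on_vec_lambda smooth_on_sum smooth_on_mult smooth_on_nth) auto

lemma smooth_on_det:
  fixes P :: "'a::real_normed_vector \<Rightarrow> real^'n^'n"
  shows "open S \<Longrightarrow> smooth_on P S \<Longrightarrow> smooth_on (\<lambda>x. det (P x)) S"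
  unfolding det_def
  by (intro smooth_on_sum smooth_on_mult smooth_on_prod smooth_on_nth smooth_on_const) auto

lemma matrix_inv_inverse:
  fixes P :: "real^'n^'n"
  assumes "invertible P"
  shows "P ** matrix_inv P = mat 1 \<and> matrix_inv P ** P = mat 1"
  using assms unfolding invertible_def matrix_inv_def by (rule someI_ex)

text \<open>Cramer's rule expresses the entries of the inverse matrix as quotients of determinants.\<close>

lemma smooth_on_matrix_inv:
  fixes P :: "'a::real_normed_vector \<Rightarrow> real^'n^'n"
  assumes "open S" "smooth_on P S" "\<And>x. x \<in> S \<Longrightarrow> invertible (P x)"
  shows "smooth_on (\<lambda>x. matrix_inv (P x)) S"
proof -
  have nz: "det (P x) \<noteq> 0" if "x \<in> S" for x
    using assms(3)[OF that] invertible_det_nz by blast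
  define Q where "Q x = (\<chi> k l. det (\<chi> i j. if j = k then axis l 1 $ i else P x $ i $ j) / det (P x))" for x
  have "smooth_on Q S"
  proof -
    have "smooth_on (\<lambda>x. if j = k then axis l 1 $ i else P x $ i $ j) S" for i j k l :: 'n
      using smooth_on_nth[OF assms(1) smooth_on_nth[OF assms(1,2)]]
      by (cases "j = k") (simp_all add: smooth_on_const)
    then show ?thesis
      unfolding Q_def
      by (intro smooth_on_vec_lambda smooth_on_divide smooth_on_det assms nz)
  qed
  moreover have "Q x = matrix_inv (P x)" if "x \<in> S" for x
  proof -
    have inv: "P x ** matrix_inv (P x) = mat 1"
      using matrix_inv_inverse[OF assms(3)[OF that]] by blast
    have "matrix_inv (P x) $ k $ l = Q x $ k $ l" for k l
    proof -
      have "P x *v column l (matrix_inv (P x)) = axis l 1"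
        using inv by (simp add: vec_eq_iff column_def matrix_matrix_mult_def matrix_vector_mult_def mat_def axis_def)
      with cramer[OF nz[OF that]] have "column l (matrix_inv (P x)) =
         (\<chi> k. det (\<chi> i j. if j = k then axis l 1 $ i else P x $ i $ j) / det (P x))" by blast
      then show ?thesis by (simp add: Q_def vec_eq_iff column_def)
    qed
    then show ?thesis by (simp add: vec_eq_iff)
  qed
  ultimately show ?thesis by (rule smooth_on_cong[OF _ assms(1)])
qed

lemma linear_basis_expansion:
  fixes L :: "'b::euclidean_space \<Rightarrow> 'c::real_vector"
  assumes "linear L"
  shows "L w = (\<Sum>b\<in>Basis. (w \<bullet> b) *\<^sub>R L b)"
  by (subst euclidean_representation[of w, symmetric])
    (simp only: linear_sum[OF assms] linear_scale[OF assms])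

text \<open>By linearity in the direction, it is enough that the derivatives along the vectors of a basis
  are smooth functions of the base point.\<close>

lemma smooth_on_derivative_apply:
  fixes f :: "'a::real_normed_vector \<Rightarrow> 'b::euclidean_space" and g :: "'b \<Rightarrow> 'c::real_normed_vector"
  assumes "open S" "open T" "smooth_on g T" "smooth_on f S" "f ` S \<subseteq> T" "smooth_on w S"
  shows "smooth_on (\<lambda>x. frechet_derivative g (at (f x)) (w x)) S"
proof (rule smooth_on_cong)
  show "smooth_on (\<lambda>x. \<Sum>b\<in>Basis. (w x \<bullet> b) *\<^sub>R frechet_derivative g (at (f x)) b) S"
    by (intro smooth_on_sum smooth_on_scaleR smooth_on_inner smooth_on_const assms(1,6)
        smooth_on_compose[OF smooth_on_derivative assms(4,1,2,5)] assms(3))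
  show "(\<Sum>b\<in>Basis. (w x \<bullet> b) *\<^sub>R frechet_derivative g (at (f x)) b)
      = frechet_derivative g (at (f x)) (w x)" if "x \<in> S" for x
    using linear_basis_expansion[OF smooth_on_linear_derivative[OF assms(3)], of "f x" "w x"] assms(5) that
    by auto
qed fact

subsection \<open>Symmetry of second derivatives\<close>

text \<open>The second difference is symmetric in the two directions, and by the mean value theorem,
  applied twice, it is the mixed second derivative at an intermediate point.\<close>

lemma second_difference_mean_value:
  fixes f :: "'a::real_normed_vector \<Rightarrow> real"
  assumes "smooth_on f S" "0 < h" "cball x (h * (norm u + norm v)) \<subseteq> S"
  obtains p where "dist x p \<le> h * (norm u + norm v)"
    and "f (x + h *\<^sub>R u + h *\<^sub>R v) - f (x + h *\<^sub>R u) - f (x + h *\<^sub>R v) + f x =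
      h * h * frechet_derivative (\<lambda>z. frechet_derivative f (at z) u) (at p) v"
proof -
  let ?D = "\<lambda>z. frechet_derivative f (at z) u"
  have near: "dist x (x + s *\<^sub>R u + t *\<^sub>R v) \<le> h * (norm u + norm v)"
    if "0 \<le> s" "s \<le> h" "0 \<le> t" "t \<le> h" for s t
  proof -
    have "norm (s *\<^sub>R u + t *\<^sub>R v) \<le> s * norm u + t * norm v"
      using norm_triangle_ineq[of "s *\<^sub>R u" "t *\<^sub>R v"] that by simp
    also have "\<dots> \<le> h * norm u + h * norm v"
      using that by (intro add_mono mult_right_mono) auto
    finally show ?thesis by (simp add: dist_norm add.assoc distrib_left norm_minus_commute
          flip: norm_minus_cancel[of "s *\<^sub>R u + t *\<^sub>R v"])
  qed
  then have inS: "x + s *\<^sub>R u + t *\<^sub>R v \<in> S" if "0 \<le> s" "s \<le> h" "0 \<le> t" "t \<le> h" for s t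
    using assms(3) that by auto
  define \<phi> where "\<phi> s = f (x + s *\<^sub>R u + h *\<^sub>R v) - f (x + s *\<^sub>R u + 0 *\<^sub>R v)" for s
  have line: "((\<lambda>s. f (x + s *\<^sub>R u + t *\<^sub>R v)) has_real_derivative ?D (x + s *\<^sub>R u + t *\<^sub>R v)) (at s)"
    if "0 \<le> s" "s \<le> h" "0 \<le> t" "t \<le> h" for s t
  proof -
    let ?z = "x + s *\<^sub>R u + t *\<^sub>R v"
    have fd: "(f has_derivative frechet_derivative f (at ?z)) (at ?z)"
      using smooth_on_has_derivative[OF assms(1) inS[OF that]] .
    have "((\<lambda>s. x + s *\<^sub>R u + t *\<^sub>R v) has_derivative (\<lambda>r. r *\<^sub>R u)) (at s)"
      by (auto intro!: derivative_eq_intros)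
    from has_derivative_compose[OF this fd]
    have "((\<lambda>s. f (x + s *\<^sub>R u + t *\<^sub>R v)) has_derivative (\<lambda>r. ?D ?z * r)) (at s)"
      by (simp add: linear_scale[OF has_derivative_linear[OF fd]] mult.commute)
    then show ?thesis by (simp add: has_field_derivative_def)
  qed
  have "\<And>s. 0 \<le> s \<Longrightarrow> s \<le> h \<Longrightarrow> (\<phi> has_real_derivative
      ?D (x + s *\<^sub>R u + h *\<^sub>R v) - ?D (x + s *\<^sub>R u + 0 *\<^sub>R v)) (at s)"
    unfolding \<phi>_def using assms(2) by (intro DERIV_diff line) auto
  from MVT2[OF assms(2) this] obtain s where s: "0 < s" "s < h"
    and eq1: "\<phi> h - \<phi> 0 = (h - 0) * (?D (x + s *\<^sub>R u + h *\<^sub>R v) - ?D (x + s *\<^sub>R u + 0 *\<^sub>R v))" by blast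
  have "((\<lambda>t. ?D (x + s *\<^sub>R u + t *\<^sub>R v)) has_real_derivative
      frechet_derivative ?D (at (x + s *\<^sub>R u + t *\<^sub>R v)) v) (at t)" if "0 \<le> t" "t \<le> h" for t
  proof -
    let ?z = "x + s *\<^sub>R u + t *\<^sub>R v"
    have fd: "(?D has_derivative frechet_derivative ?D (at ?z)) (at ?z)"
      using smooth_on_has_derivative[OF smooth_on_derivative[OF assms(1)]] inS that s by auto
    have "((\<lambda>t. x + s *\<^sub>R u + t *\<^sub>R v) has_derivative (\<lambda>r. r *\<^sub>R v)) (at t)"
      by (auto intro!: derivative_eq_intros)
    from has_derivative_compose[OF this fd]
    have "((\<lambda>t. ?D (x + s *\<^sub>R u + t *\<^sub>R v)) has_derivative
        (\<lambda>r. frechet_derivative ?D (at ?z) v * r)) (at t)"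
      by (simp add: linear_scale[OF has_derivative_linear[OF fd]] mult.commute)
    then show ?thesis by (simp add: has_field_derivative_def)
  qed
  from MVT2[OF assms(2) this] obtain t where t: "0 < t" "t < h"
    and eq2: "?D (x + s *\<^sub>R u + h *\<^sub>R v) - ?D (x + s *\<^sub>R u + 0 *\<^sub>R v)
      = (h - 0) * frechet_derivative ?D (at (x + s *\<^sub>R u + t *\<^sub>R v)) v" by blast
  show ?thesis
  proof (rule that)
    show "dist x (x + s *\<^sub>R u + t *\<^sub>R v) \<le> h * (norm u + norm v)"
      using near s t by auto
    show "f (x + h *\<^sub>R u + h *\<^sub>R v) - f (x + h *\<^sub>R u) - f (x + h *\<^sub>R v) + f x =
      h * h * frechet_derivative ?D (at (x + s *\<^sub>R u + t *\<^sub>R v)) v"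
      using eq1 unfolding eq2 by (simp add: \<phi>_def)
  qed
qed

text \<open>Both mixed derivatives at \<open>x\<close> are limits, for step size tending to \<open>0\<close>, of the same second
  difference quotient.\<close>

lemma frechet_derivative_commute:
  fixes f :: "'a::real_normed_vector \<Rightarrow> real"
  assumes "open S" "smooth_on f S" "x \<in> S"
  shows "frechet_derivative (\<lambda>z. frechet_derivative f (at z) u) (at x) v =
    frechet_derivative (\<lambda>z. frechet_derivative f (at z) v) (at x) u"
proof (rule ccontr)
  let ?A = "\<lambda>z. frechet_derivative (\<lambda>z. frechet_derivative f (at z) u) (at z) v"
  let ?B = "\<lambda>z. frechet_derivative (\<lambda>z. frechet_derivative f (at z) v) (at z) u"
  assume ne: "?A x \<noteq> ?B x"
  define e where "e = \<bar>?A x - ?B x\<bar> / 2"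
  have "e > 0" using ne by (simp add: e_def)
  have "continuous_on S ?A" "continuous_on S ?B"
    by (intro smooth_on_continuous_on smooth_on_derivative assms)+
  then have "isCont ?A x" "isCont ?B x"
    using assms by (auto simp: continuous_on_eq_continuous_at)
  then obtain d1 d2 where d: "d1 > 0" "d2 > 0" "\<And>z. dist z x < d1 \<Longrightarrow> dist (?A z) (?A x) < e"
     "\<And>z. dist z x < d2 \<Longrightarrow> dist (?B z) (?B x) < e"
    unfolding continuous_at_eps_delta using \<open>e > 0\<close> by (metis dist_commute)
  obtain r where r: "r > 0" "cball x r \<subseteq> S" using assms open_contains_cball by blast
  define m where "m = min (min d1 d2) r"
  define h where "h = m / 2 / (norm u + norm v + 1)"
  have m: "m > 0" using d r by (simp add: m_def)
  have pos: "norm u + norm v + 1 > 0" by (smt (verit) norm_ge_zero)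
  have h: "h > 0" using m pos by (simp add: h_def)
  have hb: "h * (norm u + norm v) < m"
  proof -
    define N where "N = norm u + norm v + 1"
    have "h * (norm u + norm v) \<le> h * N" using h by (simp add: N_def)
    also have "\<dots> = m / 2" using pos unfolding h_def N_def[symmetric] by simp
    finally show ?thesis using m by simp
  qed
  then have sub: "cball x (h * (norm u + norm v)) \<subseteq> S" "cball x (h * (norm v + norm u)) \<subseteq> S"
    using r by (auto simp: m_def add.commute)
  obtain p where p: "dist x p \<le> h * (norm u + norm v)"
    "f (x + h *\<^sub>R u + h *\<^sub>R v) - f (x + h *\<^sub>R u) - f (x + h *\<^sub>R v) + f x = h * h * ?A p"
    using second_difference_mean_value[OF assms(2) h sub(1)] .
  obtain q where q: "dist x q \<le> h * (norm v + norm u)"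
    "f (x + h *\<^sub>R v + h *\<^sub>R u) - f (x + h *\<^sub>R v) - f (x + h *\<^sub>R u) + f x = h * h * ?B q"
    using second_difference_mean_value[OF assms(2) h sub(2)] .
  have "x + h *\<^sub>R v + h *\<^sub>R u = x + h *\<^sub>R u + h *\<^sub>R v" by simp
  from p(2) q(2)[unfolded this] have "h * h * ?A p = h * h * ?B q" by linarith
  then have "?A p = ?B q" using h by simp
  moreover have "dist (?A p) (?A x) < e" "dist (?B q) (?B x) < e"
    using d(3)[of p] d(4)[of q] p(1) q(1) hb by (auto simp: dist_commute m_def add.commute)
  moreover have "False" if "c = d" "\<bar>c - a\<bar> < \<bar>a - b\<bar> / 2" "\<bar>d - b\<bar> < \<bar>a - b\<bar> / 2" for a b c d :: real
    using that by (smt (verit) field_sum_of_halves)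
  ultimately show False unfolding e_def dist_real_def by blast
qed

subsection \<open>Second derivatives as bilinear maps\<close>

abbreviation D2 :: "('a::real_normed_vector \<Rightarrow> 'b::real_normed_vector) \<Rightarrow> 'a \<Rightarrow> 'a \<Rightarrow> 'a \<Rightarrow> 'b" where
  "D2 f x u v \<equiv> frechet_derivative (\<lambda>z. frechet_derivative f (at z) u) (at x) v"

lemma frechet_derivative_eqI: "(f has_derivative f') (at x) \<Longrightarrow> frechet_derivative f (at x) = f'"
  using frechet_derivative_at by metis

lemma frechet_derivative_cong:
  assumes "open S" "x \<in> S" "\<And>z. z \<in> S \<Longrightarrow> f z = g z" "f differentiable (at x)"
  shows "frechet_derivative f (at x) = frechet_derivative g (at x)"
  using frechet_derivative_transform_within_open[OF assms(4,1,2,3)] .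

lemma smooth_on_differentiable: "smooth_on f S \<Longrightarrow> x \<in> S \<Longrightarrow> f differentiable (at x)"
  using smooth_on_has_derivative unfolding differentiable_def by blast

lemma D2_linear_right: "smooth_on f S \<Longrightarrow> x \<in> S \<Longrightarrow> linear (D2 f x u)"
  by (rule smooth_on_linear_derivative[OF smooth_on_derivative])

lemma D2_commute:
  fixes f :: "'a::real_normed_vector \<Rightarrow> 'b::euclidean_space"
  assumes "open S" "smooth_on f S" "x \<in> S"
  shows "D2 f x u v = D2 f x v u"
proof (rule euclidean_eqI)
  fix e :: 'b assume "e \<in> Basis"
  have comp: "frechet_derivative (\<lambda>z. g z \<bullet> e) (at z) = (\<lambda>w. frechet_derivative g (at z) w \<bullet> e)"
    if "smooth_on g S" "z \<in> S" for g z
    by (rule frechet_derivative_eqI) (rule has_derivative_inner_left[OF smooth_on_has_derivative[OF that]])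
  have sm: "smooth_on (\<lambda>z. f z \<bullet> e) S"
    by (intro smooth_on_inner assms smooth_on_const)
  have "D2 f x u v \<bullet> e = D2 (\<lambda>z. f z \<bullet> e) x u v" for u v
  proof -
    have "frechet_derivative (\<lambda>z. frechet_derivative (\<lambda>z. f z \<bullet> e) (at z) u) (at x)
       = frechet_derivative (\<lambda>z. frechet_derivative f (at z) u \<bullet> e) (at x)"
      by (rule frechet_derivative_cong[OF assms(1,3)])
        (use comp[OF assms(2)] smooth_on_differentiable[OF smooth_on_derivative[OF sm] assms(3)] in auto)
    then show ?thesis using comp[OF smooth_on_derivative[OF assms(2)] assms(3)] by simp
  qed
  then show "D2 f x u v \<bullet> e = D2 f x v u \<bullet> e"
    using frechet_derivative_commute[OF assms(1) sm assms(3)] by simp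
qed

lemma D2_linear_left:
  fixes f :: "'a::real_normed_vector \<Rightarrow> 'b::euclidean_space"
  assumes "open S" "smooth_on f S" "x \<in> S"
  shows "linear (\<lambda>u. D2 f x u v)"
  using D2_linear_right[OF assms(2,3), of v] D2_commute[OF assms] by simp

text \<open>The product rule for a derivative that is taken at a moving point and applied to a moving
  direction.\<close>

lemma has_derivative_derivative_apply:
  fixes f :: "'b::euclidean_space \<Rightarrow> 'c::euclidean_space" and \<phi> q :: "'a::real_normed_vector \<Rightarrow> 'b"
  assumes "open S" "smooth_on f S" "\<phi> x \<in> S"
    and \<phi>: "(\<phi> has_derivative \<phi>') (at x)" and q: "(q has_derivative q') (at x)"
  shows "((\<lambda>z. frechet_derivative f (at (\<phi> z)) (q z)) has_derivative
    (\<lambda>w. D2 f (\<phi> x) (q x) (\<phi>' w) + frechet_derivative f (at (\<phi> x)) (q' w))) (at x)"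
proof -
  have "isCont \<phi> x" using \<phi> has_derivative_continuous by blast
  then obtain U where U: "open U" "x \<in> U" "\<phi> ` U \<subseteq> S"
    using assms(1,3) unfolding continuous_at_open by (metis image_subsetI)
  have ex: "frechet_derivative f (at (\<phi> z)) w = (\<Sum>b\<in>Basis. (w \<bullet> b) *\<^sub>R frechet_derivative f (at (\<phi> z)) b)"
    if "z \<in> U" for z w
    using linear_basis_expansion[OF smooth_on_linear_derivative[OF assms(2)]] U that by blast
  have sb: "((\<lambda>z. frechet_derivative f (at (\<phi> z)) b) has_derivative (\<lambda>w. D2 f (\<phi> x) b (\<phi>' w))) (at x)" for b
    by (rule has_derivative_compose[OF \<phi> smooth_on_has_derivative[OF smooth_on_derivative[OF assms(2)] assms(3)]])
  have "((\<lambda>z. \<Sum>b\<in>Basis. (q z \<bullet> b) *\<^sub>R frechet_derivative f (at (\<phi> z)) b) has_derivative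
      (\<lambda>w. \<Sum>b\<in>Basis. (q x \<bullet> b) *\<^sub>R D2 f (\<phi> x) b (\<phi>' w) + (q' w \<bullet> b) *\<^sub>R frechet_derivative f (at (\<phi> x)) b)) (at x)"
    by (intro has_derivative_sum has_derivative_scaleR has_derivative_inner_left q sb)
  then have "((\<lambda>z. frechet_derivative f (at (\<phi> z)) (q z)) has_derivative
      (\<lambda>w. \<Sum>b\<in>Basis. (q x \<bullet> b) *\<^sub>R D2 f (\<phi> x) b (\<phi>' w) + (q' w \<bullet> b) *\<^sub>R frechet_derivative f (at (\<phi> x)) b)) (at x)"
    by (rule has_derivative_transform_within_open[OF _ U(1,2)]) (simp add: ex)
  moreover have "(\<Sum>b\<in>Basis. (q x \<bullet> b) *\<^sub>R D2 f (\<phi> x) b (\<phi>' w) + (q' w \<bullet> b) *\<^sub>R frechet_derivative f (at (\<phi> x)) b)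
      = D2 f (\<phi> x) (q x) (\<phi>' w) + frechet_derivative f (at (\<phi> x)) (q' w)" for w
    unfolding sum.distrib ex[OF U(2), of "q' w"]
      linear_basis_expansion[OF D2_linear_left[OF assms(1,2,3)], of "q x"] ..
  ultimately show ?thesis by simp
qed

subsection \<open>Bump functions\<close>

text \<open>The functions \<open>x\<^sup>-\<^sup>m e\<^sup>-\<^sup>1\<^sup>/\<^sup>x\<close>, extended by \<open>0\<close>. The case \<open>m = 0\<close> is the classical smooth
  function that is flat at \<open>0\<close>; the others occur in its derivatives.\<close>

definition flat_exp :: "nat \<Rightarrow> real \<Rightarrow> real" where
  "flat_exp m x = (if 0 < x then inverse x ^ m / exp (inverse x) else 0)"

lemma flat_exp_tendsto_0: "(flat_exp m \<longlongrightarrow> 0) (at 0)"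
proof -
  have "((\<lambda>x. inverse x ^ m / exp (inverse x)) \<longlongrightarrow> (0::real)) (at_right 0)"
    using filterlim_compose[OF tendsto_power_div_exp_0 filterlim_inverse_at_top_right] .
  then have "(flat_exp m \<longlongrightarrow> 0) (at_right 0)"
    by (rule Lim_transform_eventually) (auto simp: flat_exp_def eventually_at_filter)
  moreover have "(flat_exp m \<longlongrightarrow> 0) (at_left 0)"
    by (rule Lim_transform_eventually[OF tendsto_const]) (auto simp: flat_exp_def eventually_at_filter)
  ultimately show ?thesis by (simp add: filterlim_split_at)
qed

text \<open>All one-sided derivatives at \<open>0\<close> vanish because the exponential beats every power; away from
  \<open>0\<close> the family is closed under differentiation up to linear combinations.\<close>

lemma flat_exp_deriv:
  "(flat_exp m has_real_derivative flat_exp (m + 2) x - m * flat_exp (m + 1) x) (at x)"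
proof -
  consider "x > 0" | "x < 0" | "x = 0" by linarith
  then show ?thesis
  proof cases
    case 1
    have "((\<lambda>x. inverse x ^ m / exp (inverse x)) has_real_derivative
       flat_exp (m + 2) x - m * flat_exp (m + 1) x) (at x)"
    proof -
      have inner: "(inverse has_real_derivative - (inverse x)\<^sup>2) (at x)"
        using DERIV_inverse[of x UNIV] 1 by (simp add: numeral_2_eq_2)
      have "((\<lambda>y. y ^ m * exp (- y)) has_real_derivative
          (real m * y ^ (m - 1) - y ^ m) * exp (- y)) (at y)" for y :: real
        by (auto intro!: derivative_eq_intros simp: algebra_simps)
      from DERIV_chain2[OF this inner]
      have "((\<lambda>x. inverse x ^ m * exp (- inverse x)) has_real_derivative
          (real m * inverse x ^ (m - 1) - inverse x ^ m) * exp (- inverse x) * - (inverse x)\<^sup>2) (at x)" .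
      moreover have "(real m * inverse x ^ (m - 1) - inverse x ^ m) * exp (- inverse x) * - (inverse x)\<^sup>2
        = flat_exp (m + 2) x - m * flat_exp (m + 1) x"
      proof -
        have "(real m * y ^ (m - 1) - y ^ m) * E * - y\<^sup>2 = y ^ (m + 2) * E - m * (y ^ (m + 1) * E)" for y E :: real
          by (cases m) (simp_all add: algebra_simps power_add power2_eq_square)
        then show ?thesis using 1 by (simp add: flat_exp_def exp_minus divide_inverse)
      qed
      ultimately show ?thesis by (simp add: exp_minus divide_inverse)
    qed
    then show ?thesis
      by (rule has_field_derivative_transform_within_open[of _ _ _ "{0<..}"])
        (use 1 in \<open>auto simp: flat_exp_def\<close>)
  next
    case 2
    have "((\<lambda>x. 0) has_real_derivative 0) (at x)" by simp
    then have "(flat_exp m has_real_derivative 0) (at x)"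
      by (rule has_field_derivative_transform_within_open[of _ _ _ "{..<0}"])
        (use 2 in \<open>auto simp: flat_exp_def\<close>)
    then show ?thesis using 2 by (simp add: flat_exp_def)
  next
    case 3
    have "((\<lambda>h. (flat_exp m (0 + h) - flat_exp m 0) / h) \<longlongrightarrow> 0) (at 0)"
      by (rule Lim_transform_eventually[OF flat_exp_tendsto_0[of "Suc m"]])
        (auto simp: flat_exp_def field_simps eventually_at_filter)
    then show ?thesis using 3 by (simp add: DERIV_def flat_exp_def)
  qed
qed

lemma smooth_on_flat_exp: "smooth_on (flat_exp m) UNIV"
proof -
  have "Ck_on k (flat_exp m) UNIV" for k
  proof (induction k arbitrary: m)
    case 0
    show ?case using flat_exp_deriv[of m] by (auto intro!: continuous_at_imp_continuous_on DERIV_isCont)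
  next
    case (Suc k)
    show ?case
    proof (rule Ck_on_SucI)
      show "(flat_exp m has_derivative (\<lambda>v. (flat_exp (m + 2) x + (- m) * flat_exp (m + 1) x) * v)) (at x)" for x
        using flat_exp_deriv[of m x] by (simp add: has_field_derivative_def)
      show "Ck_on k (\<lambda>x. (flat_exp (m + 2) x + (- m) * flat_exp (m + 1) x) * v) UNIV" for v
        by (intro Ck_on_bilinear[OF _ bounded_bilinear_mult] Ck_on_add Ck_on_const Suc.IH) auto
    qed simp
  qed
  then show ?thesis by (simp add: smooth_on_def)
qed

text \<open>The squared distance to the centre is a polynomial, so composing it with the flat exponential
  gives a function that is smooth at the centre as well.\<close>

lemma euclidean_bump:
  fixes a :: "'e::euclidean_space"
  assumes "0 < r"
  shows "\<exists>\<psi> :: 'e \<Rightarrow> real. smooth_on \<psi> UNIV \<and> \<psi> a = 1 \<and> (\<forall>x. x \<notin> cball a r \<longrightarrow> \<psi> x = 0)"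
proof (intro exI conjI allI impI)
  let ?\<psi> = "\<lambda>x. flat_exp 0 (r\<^sup>2 - (x - a) \<bullet> (x - a)) / flat_exp 0 (r\<^sup>2)"
  have pos: "flat_exp 0 (r\<^sup>2) > 0" using assms by (simp add: flat_exp_def)
  show "smooth_on ?\<psi> UNIV"
  proof (rule smooth_on_divide)
    have "smooth_on (\<lambda>x. r\<^sup>2 - (x - a) \<bullet> (x - a)) UNIV"
      by (intro smooth_on_diff smooth_on_inner smooth_on_const smooth_on_id open_UNIV)
    then show "smooth_on (\<lambda>x. flat_exp 0 (r\<^sup>2 - (x - a) \<bullet> (x - a))) UNIV"
      by (rule smooth_on_compose[OF smooth_on_flat_exp]) auto
  qed (use pos smooth_on_const in auto)
  show "?\<psi> a = 1" using pos by simp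
  fix x assume "x \<notin> cball a r"
  then have "r < norm (x - a)" by (simp add: dist_norm norm_minus_commute)
  then have "r\<^sup>2 < (norm (x - a))\<^sup>2" using assms by (simp add: power_strict_mono)
  then show "?\<psi> x = 0" by (simp add: flat_exp_def power2_norm_eq_inner)
qed

section \<open>Manifolds, tangent vectors and the tensoriality of connections\<close>

subsection \<open>Charts and coordinate changes\<close>

abbreviation jac :: "('p, 'e::euclidean_space) chart \<Rightarrow> ('p, 'e) chart \<Rightarrow> 'p \<Rightarrow> 'e \<Rightarrow> 'e" where
  "jac c d p \<equiv> frechet_derivative (transition c d) (at (snd c p))"

lemma charts_atI: "c \<in> A \<Longrightarrow> p \<in> fst c \<Longrightarrow> c \<in> charts_at A p"
  by (simp add: charts_at_def)

context
  fixes M :: "'p set" and A :: "('p, 'e::euclidean_space) chart set"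
  assumes atlas: "smooth_atlas M A"
begin

lemma chart_inv_chart: "c \<in> A \<Longrightarrow> p \<in> fst c \<Longrightarrow> chart_inv c (snd c p) = p"
  using atlas unfolding smooth_atlas_def chart_inv_def by (auto intro: inv_into_f_f)

lemma chart_chart_inv: "z \<in> snd c ` fst c \<Longrightarrow> snd c (chart_inv c z) = z"
  unfolding chart_inv_def by (rule f_inv_into_f)

lemma chart_inv_in: "z \<in> snd c ` fst c \<Longrightarrow> chart_inv c z \<in> fst c"
  unfolding chart_inv_def by (rule inv_into_into)

lemma chart_image_iff:
  "c \<in> A \<Longrightarrow> z \<in> snd c ` (fst c \<inter> W) \<longleftrightarrow> z \<in> snd c ` fst c \<and> chart_inv c z \<in> W"
  by (auto simp: chart_inv_chart)

lemma chart_domain_subset: "c \<in> A \<Longrightarrow> fst c \<subseteq> M"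
  using atlas unfolding smooth_atlas_def by blast

lemma charts_at_nonempty: "p \<in> M \<Longrightarrow> \<exists>c. c \<in> charts_at A p"
  using atlas unfolding smooth_atlas_def charts_at_def by blast

lemma charts_at_outside: "p \<notin> M \<Longrightarrow> charts_at A p = {}"
  using chart_domain_subset unfolding charts_at_def by blast

lemma open_chart: "c \<in> A \<Longrightarrow> open (snd c ` fst c)"
  and open_overlap: "c \<in> A \<Longrightarrow> d \<in> A \<Longrightarrow> open (snd c ` (fst c \<inter> fst d))"
  and smooth_transition:
    "c \<in> A \<Longrightarrow> d \<in> A \<Longrightarrow> smooth_on (transition c d) (snd c ` (fst c \<inter> fst d))"
  using atlas unfolding smooth_atlas_def by blast+

lemma transition_chart: "c \<in> A \<Longrightarrow> p \<in> fst c \<Longrightarrow> transition c d (snd c p) = snd d p"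
  by (simp add: transition_def chart_inv_chart)

lemma transition_derivative:
  assumes "c \<in> charts_at A p" "d \<in> charts_at A p"
  shows "(transition c d has_derivative jac c d p) (at (snd c p))"
  using smooth_on_has_derivative[OF smooth_transition] assms unfolding charts_at_def by blast

lemma linear_jac: "c \<in> charts_at A p \<Longrightarrow> d \<in> charts_at A p \<Longrightarrow> linear (jac c d p)"
  using transition_derivative has_derivative_linear by blast

lemma jac_self: "c \<in> charts_at A p \<Longrightarrow> jac c c p v = v"
proof -
  assume c: "c \<in> charts_at A p"
  have "((\<lambda>z. z) has_derivative (\<lambda>v. v)) (at (snd c p))" by simp
  then have "(transition c c has_derivative (\<lambda>v. v)) (at (snd c p))"
    by (rule has_derivative_transform_within_open[OF _ open_chart])
      (use c in \<open>auto simp: charts_at_def transition_def chart_inv_chart\<close>)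
  then show ?thesis using frechet_derivative_at by metis
qed

lemma jac_compose:
  assumes "c \<in> charts_at A p" "d \<in> charts_at A p" "e \<in> charts_at A p"
  shows "jac d e p (jac c d p v) = jac c e p v"
proof -
  have mem: "c \<in> A" "d \<in> A" "e \<in> A" "p \<in> fst c" "p \<in> fst d" "p \<in> fst e"
    using assms by (auto simp: charts_at_def)
  have "(transition d e has_derivative jac d e p) (at (transition c d (snd c p)))"
    using transition_derivative[OF assms(2,3)] transition_chart[of c p d] mem by simp
  from has_derivative_compose[OF transition_derivative[OF assms(1,2)] this]
  have "((\<lambda>z. transition d e (transition c d z)) has_derivative
      (\<lambda>v. jac d e p (jac c d p v))) (at (snd c p))" .
  then have "(transition c e has_derivative (\<lambda>v. jac d e p (jac c d p v))) (at (snd c p))"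
    by (rule has_derivative_transform_within_open[OF _ open_overlap[OF mem(1,2)]])
      (use mem in \<open>auto simp: transition_def chart_inv_chart\<close>)
  then show ?thesis using frechet_derivative_at by metis
qed

definition tvec_of :: "('p, 'e) chart \<Rightarrow> 'p \<Rightarrow> 'e \<Rightarrow> ('p, 'e) tvec" where
  "tvec_of c p w = (\<lambda>d. if d \<in> charts_at A p then jac c d p w else 0)"

lemma tvec_of_in: "c \<in> charts_at A p \<Longrightarrow> tvec_of c p w \<in> tangent_space A p"
  unfolding tangent_space_def tvec_of_def by (auto simp: jac_compose)

lemma tvec_of_self: "c \<in> charts_at A p \<Longrightarrow> tvec_of c p w c = w"
  by (simp add: tvec_of_def jac_self)

lemma tangent_change:
  "v \<in> tangent_space A p \<Longrightarrow> c \<in> charts_at A p \<Longrightarrow> d \<in> charts_at A p \<Longrightarrow> v d = jac c d p (v c)"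
  unfolding tangent_space_def by blast

lemma tangent_outside: "v \<in> tangent_space A p \<Longrightarrow> c \<notin> charts_at A p \<Longrightarrow> v c = 0"
  unfolding tangent_space_def by blast

lemma tvec_of_component: "v \<in> tangent_space A p \<Longrightarrow> c \<in> charts_at A p \<Longrightarrow> tvec_of c p (v c) = v"
proof (rule ext)
  fix d assume "v \<in> tangent_space A p" "c \<in> charts_at A p"
  then show "tvec_of c p (v c) d = v d"
    by (cases "d \<in> charts_at A p") (simp_all add: tvec_of_def tangent_outside tangent_change[of v p c d, symmetric])
qed

lemma tangent_eqI:
  "v \<in> tangent_space A p \<Longrightarrow> w \<in> tangent_space A p \<Longrightarrow> c \<in> charts_at A p \<Longrightarrow> v c = w c \<Longrightarrow> v = w"
  using tvec_of_component by metis

lemma tangent_spaceI: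
  assumes "\<And>c. c \<notin> charts_at A p \<Longrightarrow> v c = 0"
    and "\<And>c d. c \<in> charts_at A p \<Longrightarrow> d \<in> charts_at A p \<Longrightarrow> v d = jac c d p (v c)"
  shows "v \<in> tangent_space A p"
  using assms unfolding tangent_space_def by blast

lemma tangent_zero: "(\<lambda>_. 0) \<in> tangent_space A p"
  by (rule tangent_spaceI) (simp_all add: linear_0[OF linear_jac])

lemma tangent_add:
  assumes "v \<in> tangent_space A p" "w \<in> tangent_space A p"
  shows "(\<lambda>c. v c + w c) \<in> tangent_space A p"
  by (rule tangent_spaceI)
    (simp_all add: tangent_outside[OF assms(1)] tangent_outside[OF assms(2)] linear_add[OF linear_jac]
      tangent_change[OF assms(1), symmetric] tangent_change[OF assms(2), symmetric])

lemma tangent_scale: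
  assumes "v \<in> tangent_space A p"
  shows "(\<lambda>c. r *\<^sub>R v c) \<in> tangent_space A p"
  by (rule tangent_spaceI)
    (simp_all add: tangent_outside[OF assms] linear_scale[OF linear_jac] tangent_change[OF assms, symmetric])

text \<open>By the chain rule for the coordinate change, every chart around the point gives the same
  derivative.\<close>

lemma dir_deriv_chart:
  assumes "smooth_fun A h" "p \<in> M" "v \<in> tangent_space A p" "d \<in> charts_at A p"
  shows "dir_deriv A h p v = frechet_derivative (h \<circ> chart_inv d) (at (snd d p)) (v d)"
proof -
  define c where "c = (SOME c. c \<in> charts_at A p)"
  have c: "c \<in> charts_at A p" unfolding c_def using assms(4) by (rule someI)
  have mem: "c \<in> A" "d \<in> A" "p \<in> fst c" "p \<in> fst d"
    using assms(4) c by (auto simp: charts_at_def)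
  have dd: "((h \<circ> chart_inv d) has_derivative frechet_derivative (h \<circ> chart_inv d) (at (snd d p)))
      (at (transition c d (snd c p)))"
    unfolding transition_chart[OF mem(1,3)]
    using smooth_on_has_derivative assms(1) mem unfolding smooth_fun_def by blast
  have "((\<lambda>z. (h \<circ> chart_inv d) (transition c d z)) has_derivative
      (\<lambda>w. frechet_derivative (h \<circ> chart_inv d) (at (snd d p)) (jac c d p w))) (at (snd c p))"
    using has_derivative_compose[OF transition_derivative[OF c assms(4)] dd] .
  then have "((h \<circ> chart_inv c) has_derivative
      (\<lambda>w. frechet_derivative (h \<circ> chart_inv d) (at (snd d p)) (jac c d p w))) (at (snd c p))"
    by (rule has_derivative_transform_within_open[OF _ open_overlap[OF mem(1,2)]])
      (use mem in \<open>auto simp: transition_def chart_inv_chart\<close>)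
  from frechet_derivative_at[OF this] show ?thesis
    unfolding dir_deriv_def Let_def c_def[symmetric] tangent_change[OF assms(3) c assms(4)] by metis
qed

subsection \<open>Vector fields\<close>

lemma smooth_fun_const: "smooth_fun A (\<lambda>_. r)"
  by (auto simp: smooth_fun_def comp_def smooth_on_const)

lemma smooth_fun_mult: "smooth_fun A g \<Longrightarrow> smooth_fun A h \<Longrightarrow> smooth_fun A (\<lambda>p. g p * h p)"
  unfolding smooth_fun_def comp_def by (auto intro: smooth_on_mult open_chart)

lemma vector_fieldsI:
  assumes "\<And>b. b \<in> M \<Longrightarrow> V b \<in> tangent_space A b" "\<And>b. b \<notin> M \<Longrightarrow> V b = (\<lambda>_. 0)"
    and "\<And>c d. c \<in> A \<Longrightarrow> d \<in> A \<Longrightarrow>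
      smooth_on (\<lambda>z. V (chart_inv c z) d) (snd c ` (fst c \<inter> fst d))"
  shows "V \<in> vector_fields M A"
  using assms unfolding vector_fields_def pullback_sections_def by simp

lemma vector_fields_tangent: "V \<in> vector_fields M A \<Longrightarrow> b \<in> M \<Longrightarrow> V b \<in> tangent_space A b"
  and vector_fields_outside: "V \<in> vector_fields M A \<Longrightarrow> b \<notin> M \<Longrightarrow> V b = (\<lambda>_. 0)"
  and vector_fields_smooth: "V \<in> vector_fields M A \<Longrightarrow> c \<in> A \<Longrightarrow> d \<in> A \<Longrightarrow>
      smooth_on (\<lambda>z. V (chart_inv c z) d) (snd c ` (fst c \<inter> fst d))"
  unfolding vector_fields_def pullback_sections_def by auto

lemma vector_fields_add:
  "V \<in> vector_fields M A \<Longrightarrow> W \<in> vector_fields M A \<Longrightarrow> (\<lambda>b c. V b c + W b c) \<in> vector_fields M A"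
  by (intro vector_fieldsI smooth_on_add)
    (auto simp: vector_fields_outside vector_fields_smooth
      intro: tangent_add vector_fields_tangent open_overlap)

lemma vector_fields_scale:
  assumes "V \<in> vector_fields M A" "smooth_fun A h"
  shows "(\<lambda>b c. h b *\<^sub>R V b c) \<in> vector_fields M A"
proof (rule vector_fieldsI)
  fix c d assume c: "c \<in> A" and d: "d \<in> A"
  have "smooth_on (\<lambda>z. h (chart_inv c z)) (snd c ` (fst c \<inter> fst d))"
    using assms(2) c unfolding smooth_fun_def comp_def by (blast intro: smooth_on_subset)
  then show "smooth_on (\<lambda>z. h (chart_inv c z) *\<^sub>R V (chart_inv c z) d) (snd c ` (fst c \<inter> fst d))"
    by (rule smooth_on_scaleR[OF open_overlap[OF c d] _ vector_fields_smooth[OF assms(1) c d]])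
qed (use assms in \<open>auto simp: vector_fields_outside intro: tangent_scale vector_fields_tangent\<close>)

lemma vector_fields_zero: "(\<lambda>_ _. 0) \<in> vector_fields M A"
  by (intro vector_fieldsI) (auto intro: tangent_zero smooth_on_const)

lemma vector_fields_sum:
  assumes "\<And>i. i \<in> I \<Longrightarrow> C i \<in> vector_fields M A"
  shows "(\<lambda>b c. \<Sum>i\<in>I. C i b c) \<in> vector_fields M A"
  using assms by (induction I rule: infinite_finite_induct) (auto intro: vector_fields_zero vector_fields_add)

subsection \<open>Localization\<close>

text \<open>A smooth function that, seen from every other chart, vanishes near the complement of the
  domain of \<open>d\<close>. Products with objects defined on the domain of \<open>d\<close> then extend smoothly by zero.\<close>

definition localized_in :: "('p, 'e) chart \<Rightarrow> ('p \<Rightarrow> real) \<Rightarrow> bool" where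
  "localized_in d \<beta> \<longleftrightarrow> smooth_fun A \<beta> \<and>
     (\<forall>c\<in>A. \<exists>Z. open Z \<and> Z \<subseteq> snd c ` fst c \<and> (\<forall>z\<in>Z. \<beta> (chart_inv c z) = 0) \<and>
        snd c ` fst c \<subseteq> Z \<union> snd c ` (fst c \<inter> fst d))"

definition has_bumps :: bool where
  "has_bumps \<longleftrightarrow> (\<forall>b\<in>M. \<forall>d\<in>charts_at A b. \<exists>\<beta>. localized_in d \<beta> \<and> \<beta> b = 1)"

text \<open>The set \<open>T\<close> is covered by an open set on which \<open>g\<close> vanishes and an open set on which \<open>g\<close> is
  smooth by assumption.\<close>

lemma smooth_extension_by_zero:
  assumes "localized_in d \<beta>" "c \<in> A" "T \<subseteq> snd c ` fst c" "open T"
    and "smooth_on g (T \<inter> snd c ` (fst c \<inter> fst d))"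
    and "\<And>z. z \<in> T \<Longrightarrow> \<beta> (chart_inv c z) = 0 \<Longrightarrow> g z = 0"
    and "d \<in> A"
  shows "smooth_on g T"
proof (rule smooth_on_local)
  fix z assume z: "z \<in> T"
  obtain Z where Z: "open Z" "\<And>z. z \<in> Z \<Longrightarrow> \<beta> (chart_inv c z) = 0"
    "snd c ` fst c \<subseteq> Z \<union> snd c ` (fst c \<inter> fst d)"
    using assms(1,2) unfolding localized_in_def by meson
  show "\<exists>U. open U \<and> z \<in> U \<and> smooth_on g U"
  proof (cases "z \<in> Z")
    case True
    have "smooth_on g (T \<inter> Z)"
      by (rule smooth_on_cong[OF smooth_on_const[of 0]]) (use Z assms in auto)
    moreover have "open (T \<inter> Z)" using assms(4) Z(1) by (rule open_Int)
    ultimately show ?thesis using True z by blast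
  next
    case False
    then have "z \<in> T \<inter> snd c ` (fst c \<inter> fst d)" using z Z(3) assms(3) by blast
    moreover have "open (T \<inter> snd c ` (fst c \<inter> fst d))"
      using open_overlap[OF assms(2,7)] assms(4) by (rule open_Int[rotated])
    ultimately show ?thesis using assms(5) by blast
  qed
qed

text \<open>The coordinate field \<open>\<beta> \<partial>\<^sub>w\<close> of the chart \<open>d\<close>, extended by zero.\<close>

definition coord_field :: "('p \<Rightarrow> real) \<Rightarrow> ('p, 'e) chart \<Rightarrow> 'e \<Rightarrow> 'p \<Rightarrow> ('p, 'e) tvec" where
  "coord_field \<beta> d w = (\<lambda>b c. if b \<in> fst d then \<beta> b *\<^sub>R tvec_of d b w c else 0)"

lemma coord_field_vector_field:
  assumes "localized_in d \<beta>" "d \<in> A"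
  shows "coord_field \<beta> d w \<in> vector_fields M A"
proof (rule vector_fieldsI)
  fix b assume "b \<in> M"
  show "coord_field \<beta> d w b \<in> tangent_space A b"
    unfolding coord_field_def using assms(2)
    by (cases "b \<in> fst d") (auto intro: tangent_zero tangent_scale tvec_of_in charts_atI)
next
  fix b assume "b \<notin> M"
  then have "b \<notin> fst d" using chart_domain_subset[OF assms(2)] by blast
  then show "coord_field \<beta> d w b = (\<lambda>_. 0)" unfolding coord_field_def by simp
next
  fix c e assume c: "c \<in> A" and e: "e \<in> A"
  let ?T = "snd c ` (fst c \<inter> fst e)"
  let ?S = "?T \<inter> snd c ` (fst c \<inter> fst d)"
  show "smooth_on (\<lambda>z. coord_field \<beta> d w (chart_inv c z) e) ?T"
  proof (rule smooth_extension_by_zero[OF assms(1) c _ open_overlap[OF c e] _ _ assms(2)])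
    have op: "open ?S" using open_overlap c e assms(2) by blast
    have ops: "open (snd d ` (fst d \<inter> fst e))" using open_overlap e assms(2) by blast
    have sub: "transition c d ` ?S \<subseteq> snd d ` (fst d \<inter> fst e)"
    proof (rule image_subsetI)
      fix z assume "z \<in> ?S"
      then have "chart_inv c z \<in> fst d \<inter> fst e" using chart_image_iff[OF c] by blast
      then show "transition c d z \<in> snd d ` (fst d \<inter> fst e)" unfolding transition_def comp_def by blast
    qed
    have 1: "smooth_on (\<lambda>z. \<beta> (chart_inv c z)) ?S"
      using assms(1) c unfolding localized_in_def smooth_fun_def comp_def
      by (blast intro: smooth_on_subset)
    have 2: "smooth_on (\<lambda>z. frechet_derivative (transition d e) (at (transition c d z)) w) ?S"
      by (rule smooth_on_derivative_apply[OF op ops smooth_transition[OF assms(2) e] _ sub smooth_on_const])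
        (rule smooth_on_subset[OF smooth_transition[OF c assms(2)]], blast)
    show "smooth_on (\<lambda>z. coord_field \<beta> d w (chart_inv c z) e) ?S"
      by (rule smooth_on_cong[OF smooth_on_scaleR[OF op 1 2] op])
        (use c e assms(2) in \<open>auto simp: coord_field_def tvec_of_def chart_image_iff chart_inv_chart
          transition_def charts_at_def\<close>)
  qed (auto simp: coord_field_def)
qed

text \<open>Every tangent vector is the value of a vector field.\<close>

lemma vector_field_extension:
  assumes "has_bumps" "b \<in> M" "v \<in> tangent_space A b"
  obtains V where "V \<in> vector_fields M A" "V b = v"
proof -
  obtain d where d: "d \<in> charts_at A b" using charts_at_nonempty[OF assms(2)] by blast
  obtain \<beta> where \<beta>: "localized_in d \<beta>" "\<beta> b = 1" using assms(1,2) d unfolding has_bumps_def by blast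
  have "coord_field \<beta> d (v d) b = v"
    using d \<beta>(2) tvec_of_component[OF assms(3) d] by (auto simp: coord_field_def charts_at_def)
  then show ?thesis using that coord_field_vector_field[OF \<beta>(1)] d by (auto simp: charts_at_def)
qed

context
  fixes f :: "'p \<Rightarrow> 'q" and AQ :: "('q, 'h::euclidean_space) chart set"
    and D :: "('p \<Rightarrow> ('q, 'h) tvec) \<Rightarrow> ('p \<Rightarrow> ('p, 'e) tvec) \<Rightarrow> ('p \<Rightarrow> ('q, 'h) tvec)"
  assumes conn: "linear_connection M A f AQ D"
begin

lemma connection_add:
  "\<sigma> \<in> pullback_sections M A f AQ \<Longrightarrow> V \<in> vector_fields M A \<Longrightarrow> W \<in> vector_fields M A \<Longrightarrow>
    D \<sigma> (\<lambda>b d. V b d + W b d) = (\<lambda>b c. D \<sigma> V b c + D \<sigma> W b c)"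
  using conn unfolding linear_connection_def by blast

lemma connection_scale:
  "\<sigma> \<in> pullback_sections M A f AQ \<Longrightarrow> V \<in> vector_fields M A \<Longrightarrow> smooth_fun A h \<Longrightarrow>
    D \<sigma> (\<lambda>b d. h b *\<^sub>R V b d) = (\<lambda>b c. h b *\<^sub>R D \<sigma> V b c)"
  using conn unfolding linear_connection_def by blast

lemma connection_sum:
  assumes "\<sigma> \<in> pullback_sections M A f AQ" "finite I"
    and "\<And>i. i \<in> I \<Longrightarrow> C i \<in> vector_fields M A" "\<And>i. i \<in> I \<Longrightarrow> smooth_fun A (a i)"
  shows "D \<sigma> (\<lambda>b d. \<Sum>i\<in>I. a i b *\<^sub>R C i b d) = (\<lambda>b c. \<Sum>i\<in>I. a i b *\<^sub>R D \<sigma> (C i) b c)"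
  using assms(2-)
proof (induction I rule: finite_induct)
  case empty
  show ?case using connection_scale[OF assms(1) vector_fields_zero smooth_fun_const[of 0]] by simp
next
  case (insert i I)
  have "(\<lambda>b d. \<Sum>i\<in>I. a i b *\<^sub>R C i b d) \<in> vector_fields M A"
    by (rule vector_fields_sum[of I "\<lambda>i b d. a i b *\<^sub>R C i b d"]) (use insert.prems in \<open>auto intro: vector_fields_scale\<close>)
  with insert show ?case
    using connection_add[OF assms(1) vector_fields_scale, of "C i" "a i" "\<lambda>b d. \<Sum>i\<in>I. a i b *\<^sub>R C i b d"]
      connection_scale[OF assms(1), of "C i" "a i"] by simp
qed

text \<open>With a bump function \<open>\<beta>\<close> around \<open>b\<close>, the field \<open>\<beta>\<^sup>2V\<close> is a combination of global fields
  whose coefficients are the components of \<open>V\<close>, so the derivative along it vanishes where \<open>V\<close> does.\<close>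

lemma connection_vanishes:
  assumes "has_bumps" "\<sigma> \<in> pullback_sections M A f AQ" "V \<in> vector_fields M A" "b \<in> M" "V b = (\<lambda>_. 0)"
  shows "D \<sigma> V b = (\<lambda>_. 0)"
proof -
  obtain d where d: "d \<in> charts_at A b" using charts_at_nonempty[OF assms(4)] by blast
  then have dA: "d \<in> A" by (simp add: charts_at_def)
  obtain \<beta> where \<beta>: "localized_in d \<beta>" "\<beta> b = 1" using assms(1,4) d unfolding has_bumps_def by blast
  have sm: "smooth_fun A \<beta>" using \<beta>(1) unfolding localized_in_def by blast
  define a where "a e p = \<beta> p * (V p d \<bullet> e)" for e p
  have a: "smooth_fun A (a e)" for e
    unfolding smooth_fun_def
  proof
    fix c assume c: "c \<in> A"
    show "smooth_on (a e \<circ> chart_inv c) (snd c ` fst c)"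
    proof (rule smooth_extension_by_zero[OF \<beta>(1) c order_refl open_chart[OF c] _ _ dA])
      have "snd c ` fst c \<inter> snd c ` (fst c \<inter> fst d) = snd c ` (fst c \<inter> fst d)" by blast
      moreover have "smooth_on (\<lambda>z. \<beta> (chart_inv c z)) (snd c ` (fst c \<inter> fst d))"
        using sm c unfolding smooth_fun_def comp_def by (blast intro: smooth_on_subset)
      ultimately show "smooth_on (a e \<circ> chart_inv c) (snd c ` fst c \<inter> snd c ` (fst c \<inter> fst d))"
        unfolding a_def comp_def
        by (auto intro!: smooth_on_mult smooth_on_inner smooth_on_const open_overlap c dA
            vector_fields_smooth assms(3))
    qed (auto simp: a_def)
  qed
  have "(\<lambda>p c. (\<beta> p * \<beta> p) *\<^sub>R V p c) = (\<lambda>p c. \<Sum>e\<in>Basis. a e p *\<^sub>R coord_field \<beta> d e p c)"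
  proof (intro ext)
    fix p c
    show "(\<beta> p * \<beta> p) *\<^sub>R V p c = (\<Sum>e\<in>Basis. a e p *\<^sub>R coord_field \<beta> d e p c)"
    proof (cases "p \<in> fst d \<and> c \<in> charts_at A p")
      case True
      then have dp: "d \<in> charts_at A p" using dA by (auto simp: charts_at_def)
      have p: "p \<in> M" using True dA chart_domain_subset by blast
      have "V p c = jac d c p (V p d)"
        using tangent_change[OF vector_fields_tangent[OF assms(3) p] dp] True by blast
      also have "\<dots> = (\<Sum>e\<in>Basis. (V p d \<bullet> e) *\<^sub>R jac d c p e)"
        by (rule linear_basis_expansion[OF linear_jac[OF dp]]) (use True in blast)
      finally show ?thesis using True
        by (simp add: a_def coord_field_def tvec_of_def scaleR_sum_right mult_ac)
    next
      case False
      have "\<beta> p = 0 \<or> V p c = 0"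
      proof (cases "p \<in> M \<and> c \<in> charts_at A p")
        case True
        then have "p \<notin> fst d" and "c \<in> A" "p \<in> fst c" using False by (auto simp: charts_at_def)
        then obtain Z where "\<forall>z\<in>Z. \<beta> (chart_inv c z) = 0" "snd c ` fst c \<subseteq> Z \<union> snd c ` (fst c \<inter> fst d)"
          using \<beta>(1) unfolding localized_in_def by meson
        moreover have "snd c p \<notin> snd c ` (fst c \<inter> fst d)"
          using \<open>p \<notin> fst d\<close> \<open>c \<in> A\<close> \<open>p \<in> fst c\<close> by (simp add: chart_image_iff chart_inv_chart)
        ultimately have "\<beta> (chart_inv c (snd c p)) = 0" using \<open>p \<in> fst c\<close> by blast
        then show ?thesis using chart_inv_chart \<open>c \<in> A\<close> \<open>p \<in> fst c\<close> by simp
      next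
        case False
        then show ?thesis
          using vector_fields_outside[OF assms(3)] tangent_outside[OF vector_fields_tangent[OF assms(3)]]
          by (metis (no_types))
      qed
      moreover have "coord_field \<beta> d e p c = 0" for e
        using False by (auto simp: coord_field_def tvec_of_def)
      ultimately show ?thesis by auto
    qed
  qed
  then have "D \<sigma> (\<lambda>p c. (\<beta> p * \<beta> p) *\<^sub>R V p c) b
      = (\<lambda>c. \<Sum>e\<in>Basis. a e b *\<^sub>R D \<sigma> (coord_field \<beta> d e) b c)"
    using connection_sum[OF assms(2) finite_Basis, of "coord_field \<beta> d" a]
      coord_field_vector_field[OF \<beta>(1) dA] a by simp
  then have "(\<lambda>c. (\<beta> b * \<beta> b) *\<^sub>R D \<sigma> V b c) = (\<lambda>c. \<Sum>e\<in>Basis. a e b *\<^sub>R D \<sigma> (coord_field \<beta> d e) b c)"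
    using connection_scale[OF assms(2,3) smooth_fun_mult[OF sm sm]] by simp
  then show ?thesis using \<beta>(2) assms(5) by (simp add: a_def)
qed

text \<open>Function-linearity in the direction turns the vanishing statement into locality at a point,
  so that the derivative along a single tangent vector is well defined.\<close>

lemma connection_pointwise:
  assumes "has_bumps" "\<sigma> \<in> pullback_sections M A f AQ" "V \<in> vector_fields M A" "W \<in> vector_fields M A"
    and "b \<in> M" "V b = W b"
  shows "D \<sigma> V b = D \<sigma> W b"
proof -
  have W': "(\<lambda>b c. (- 1) *\<^sub>R W b c) \<in> vector_fields M A"
    by (rule vector_fields_scale[OF assms(4) smooth_fun_const])
  have "D \<sigma> (\<lambda>b c. V b c + (- 1) *\<^sub>R W b c) b = (\<lambda>_. 0)"
    by (rule connection_vanishes[OF assms(1,2) vector_fields_add[OF assms(3) W'] assms(5)]) (simp add: assms(6))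
  then have "(\<lambda>c. D \<sigma> V b c + (- 1) *\<^sub>R D \<sigma> W b c) = (\<lambda>_. 0)"
    unfolding connection_add[OF assms(2,3) W'] connection_scale[OF assms(2,4) smooth_fun_const] .
  then show ?thesis by (auto simp: fun_eq_iff)
qed

lemma cov_deriv_at_eq:
  assumes "has_bumps" "\<sigma> \<in> pullback_sections M A f AQ" "V \<in> vector_fields M A" "b \<in> M"
  shows "cov_deriv_at M A D \<sigma> b (V b) = D \<sigma> V b"
proof -
  have "(SOME W. W \<in> vector_fields M A \<and> W b = V b) \<in> vector_fields M A \<and>
      (SOME W. W \<in> vector_fields M A \<and> W b = V b) b = V b"
    by (rule someI_ex[of "\<lambda>W. W \<in> vector_fields M A \<and> W b = V b"]) (use assms in blast)
  then show ?thesis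
    unfolding cov_deriv_at_def using connection_pointwise[OF assms(1,2)] assms(3,4) by blast
qed

end

subsection \<open>Bump functions on Hausdorff manifolds\<close>

lemma openin_manifold:
  "openin (manifold_topology M A) W \<longleftrightarrow> W \<subseteq> M \<and> (\<forall>c\<in>A. open (snd c ` (fst c \<inter> W)))"
  unfolding manifold_topology_def topology_inverse'[OF istopology_manifold[OF atlas]] ..

lemma topspace_manifold: "topspace (manifold_topology M A) = M"
proof -
  have "openin (manifold_topology M A) M"
    unfolding openin_manifold using chart_domain_subset open_chart by (auto simp: Int_absorb2)
  moreover have "topspace (manifold_topology M A) \<subseteq> M"
    using openin_manifold openin_topspace by blast
  ultimately show ?thesis using openin_subset by blast
qed

text \<open>In a Hausdorff manifold the closed coordinate ball that supports a bump function is
  compact, hence closed, so that the function extends smoothly by zero.\<close>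

lemma has_bumps_Hausdorff:
  assumes "Hausdorff_space (manifold_topology M A)"
  shows "has_bumps"
  unfolding has_bumps_def
proof (intro ballI)
  fix b d assume "b \<in> M" and db: "d \<in> charts_at A b"
  then have dA: "d \<in> A" and bd: "b \<in> fst d" by (auto simp: charts_at_def)
  let ?a = "snd d b" let ?U = "snd d ` fst d"
  obtain r where r: "0 < r" "cball ?a r \<subseteq> ?U"
    using open_chart[OF dA] bd open_contains_cball by (metis image_eqI)
  obtain \<psi> :: "'e \<Rightarrow> real"
    where \<psi>: "smooth_on \<psi> UNIV" "\<psi> ?a = 1" "\<And>x. x \<notin> cball ?a r \<Longrightarrow> \<psi> x = 0"
    using euclidean_bump[OF r(1), of ?a] by auto
  define \<beta> where "\<beta> p = (if p \<in> fst d then \<psi> (snd d p) else 0)" for p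
  let ?K = "chart_inv d ` cball ?a r"
  have cont: "continuous_map (top_of_set ?U) (manifold_topology M A) (chart_inv d)"
    unfolding continuous_map_def
  proof (intro conjI allI impI)
    show "chart_inv d \<in> topspace (top_of_set ?U) \<rightarrow> topspace (manifold_topology M A)"
      unfolding topspace_manifold topspace_euclidean_subtopology
      by (intro Pi_I subsetD[OF chart_domain_subset[OF dA]] chart_inv_in)
    fix W assume "openin (manifold_topology M A) W"
    then have "open (snd d ` (fst d \<inter> W))" using dA openin_manifold by blast
    moreover have "{x \<in> topspace (top_of_set ?U). chart_inv d x \<in> W} = snd d ` (fst d \<inter> W)"
      using chart_image_iff[OF dA, of _ W] by auto
    ultimately show "openin (top_of_set ?U) {x \<in> topspace (top_of_set ?U). chart_inv d x \<in> W}"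
      by (metis Int_lower1 image_mono openin_open_eq open_chart[OF dA])
  qed
  have "compactin (top_of_set ?U) (cball ?a r)" using r(2) by (simp add: compactin_subtopology)
  then have "closedin (manifold_topology M A) ?K"
    using image_compactin[OF _ cont] compactin_imp_closedin[OF assms] by blast
  then have opK: "openin (manifold_topology M A) (M - ?K)" by (simp add: closedin_def topspace_manifold)
  have zero: "\<beta> p = 0" if "p \<notin> ?K" for p
  proof (cases "p \<in> fst d")
    case True
    then have "snd d p \<notin> cball ?a r" using that chart_inv_chart[OF dA True] by force
    then show ?thesis using \<psi>(3) by (simp add: \<beta>_def)
  qed (simp add: \<beta>_def)
  have Kd: "?K \<subseteq> fst d" by (intro image_subsetI chart_inv_in subsetD[OF r(2)])
  have cover: "\<exists>Z. open Z \<and> Z \<subseteq> snd c ` fst c \<and> (\<forall>z\<in>Z. \<beta> (chart_inv c z) = 0) \<and>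
        snd c ` fst c \<subseteq> Z \<union> snd c ` (fst c \<inter> fst d)" if c: "c \<in> A" for c
  proof (intro exI conjI)
    show "open (snd c ` (fst c \<inter> (M - ?K)))" using opK c openin_manifold by blast
    show "\<forall>z\<in>snd c ` (fst c \<inter> (M - ?K)). \<beta> (chart_inv c z) = 0"
    proof
      fix z assume "z \<in> snd c ` (fst c \<inter> (M - ?K))"
      then have "chart_inv c z \<notin> ?K" unfolding chart_image_iff[OF c] by simp
      then show "\<beta> (chart_inv c z) = 0" by (rule zero)
    qed
    show "snd c ` fst c \<subseteq> snd c ` (fst c \<inter> (M - ?K)) \<union> snd c ` (fst c \<inter> fst d)"
      unfolding image_Un[symmetric] by (rule image_mono) (use Kd chart_domain_subset[OF c] in auto)
  qed (rule image_mono, rule Int_lower1)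
  have "smooth_fun A \<beta>"
    unfolding smooth_fun_def
  proof
    fix c assume c: "c \<in> A"
    have ov: "smooth_on (\<beta> \<circ> chart_inv c) (snd c ` (fst c \<inter> fst d))"
    proof (rule smooth_on_cong)
      show "smooth_on (\<lambda>z. \<psi> (transition c d z)) (snd c ` (fst c \<inter> fst d))"
        by (rule smooth_on_compose[OF \<psi>(1) smooth_transition]) (use c dA open_overlap in auto)
    qed (use c dA open_overlap in \<open>auto simp: \<beta>_def transition_def chart_inv_chart\<close>)
    obtain Z where Z: "open Z" "\<forall>z\<in>Z. \<beta> (chart_inv c z) = 0"
        "snd c ` fst c \<subseteq> Z \<union> snd c ` (fst c \<inter> fst d)" using cover[OF c] by blast
    have "smooth_on (\<beta> \<circ> chart_inv c) Z"
      by (rule smooth_on_cong[OF smooth_on_const[of 0] Z(1)]) (use Z in auto)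
    then show "smooth_on (\<beta> \<circ> chart_inv c) (snd c ` fst c)"
      using smooth_on_local[of "snd c ` fst c" "\<beta> \<circ> chart_inv c"] ov Z open_overlap[OF c dA] by (meson UnE subsetD)
  qed
  then have "localized_in d \<beta>" using cover unfolding localized_in_def by blast
  moreover have "\<beta> b = 1" using bd \<psi>(2) by (simp add: \<beta>_def)
  ultimately show "\<exists>\<beta>. localized_in d \<beta> \<and> \<beta> b = 1" by blast
qed

end

section \<open>The slit tangent bundle\<close>

text \<open>The coordinate expression \<open>(x, y) \<mapsto> (T x, T'(x) y)\<close> of the differential of \<open>T\<close>.\<close>

definition tangent_map :: "('a::euclidean_space \<Rightarrow> 'b::euclidean_space) \<Rightarrow> 'a \<times> 'a \<Rightarrow> 'b \<times> 'b" where
  "tangent_map T z = (T (fst z), frechet_derivative T (at (fst z)) (snd z))"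

lemma smooth_on_tangent_map:
  assumes "open S" "smooth_on T S"
  shows "smooth_on (tangent_map T) (S \<times> UNIV)"
  unfolding tangent_map_def
proof (rule smooth_on_Pair)
  have op: "open (S \<times> (UNIV::'a set))" using assms(1) by (simp add: open_Times)
  then show "open (S \<times> (UNIV::'a set))" .
  show "smooth_on (\<lambda>z. T (fst z)) (S \<times> (UNIV::'a set))"
    by (rule smooth_on_compose[OF assms(2) smooth_on_fst[OF op] op assms(1)]) auto
  show "smooth_on (\<lambda>z. frechet_derivative T (at (fst z)) (snd z)) (S \<times> (UNIV::'a set))"
    by (rule smooth_on_derivative_apply[OF op assms smooth_on_fst[OF op] _ smooth_on_snd[OF op]]) auto
qed

lemma tangent_map_has_derivative:
  assumes "open S" "smooth_on T S" "x \<in> S"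
  shows "(tangent_map T has_derivative
    (\<lambda>w. (frechet_derivative T (at x) (fst w), D2 T x y (fst w) + frechet_derivative T (at x) (snd w)))) (at (x, y))"
  unfolding tangent_map_def
proof (rule has_derivative_Pair)
  have 1: "(fst has_derivative fst) (at (x, y))" "(snd has_derivative snd) (at (x, y))"
    by (rule bounded_linear_imp_has_derivative, rule bounded_linear_fst bounded_linear_snd)+
  have "(T has_derivative frechet_derivative T (at x)) (at (fst (x, y)))"
    using smooth_on_has_derivative[OF assms(2,3)] by simp
  from has_derivative_compose[OF 1(1) this]
  show "((\<lambda>z. T (fst z)) has_derivative (\<lambda>w. frechet_derivative T (at x) (fst w))) (at (x, y))" .
  show "((\<lambda>z. frechet_derivative T (at (fst z)) (snd z)) has_derivative
     (\<lambda>w. D2 T x y (fst w) + frechet_derivative T (at x) (snd w))) (at (x, y))"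
    using has_derivative_derivative_apply[OF assms(1,2) _ 1] assms(3) by simp
qed

text \<open>Two different charts are told apart by a family of components that is nonzero in only one
  of them.\<close>

lemma slit_chart_inject: "slit_chart A c = slit_chart A d \<longleftrightarrow> c = d"
proof
  assume "slit_chart A c = slit_chart A d"
  then have "snd (slit_chart A c) (undefined, \<lambda>e. if e = c then 1 else 0)
      = snd (slit_chart A d) (undefined, \<lambda>e. if e = c then 1 else 0)" by simp
  then show "c = d" by (auto simp: slit_chart_def nat_chart_def split: if_splits)
qed simp

lemma fst_slit_chart: "fst (slit_chart A c) = {(p, v). p \<in> fst c \<and> v \<in> tangent_space A p \<and> v \<noteq> (\<lambda>_. 0)}"
  and snd_slit_chart: "snd (slit_chart A c) u = (snd c (fst u), snd u c)"
  and fst_nat_chart: "fst (nat_chart A c) = {(p, v). p \<in> fst c \<and> v \<in> tangent_space A p}"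
  and snd_nat_chart: "snd (nat_chart A c) u = (snd c (fst u), snd u c)"
  by (auto simp: slit_chart_def nat_chart_def split: prod.splits)

context
  fixes M :: "'p set" and A :: "('p, real^'n::finite) chart set"
  assumes atlas: "smooth_atlas M A"
begin

lemma slit_bundle_iff:
  "u \<in> slit_bundle M A \<longleftrightarrow> fst u \<in> M \<and> snd u \<in> tangent_space A (fst u) \<and> snd u \<noteq> (\<lambda>_. 0)"
  by (auto simp: slit_bundle_def tangent_bundle_def split: prod.splits)

lemma tangent_nonzero:
  assumes "v \<in> tangent_space A p" "c \<in> charts_at A p"
  shows "v = (\<lambda>_. 0) \<longleftrightarrow> v c = 0"
  using tangent_eqI[OF atlas assms(1) tangent_zero[OF atlas] assms(2)] by auto

lemma charts_at_chart_inv: "c \<in> A \<Longrightarrow> x \<in> snd c ` fst c \<Longrightarrow> c \<in> charts_at A (chart_inv c x)"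
  using chart_inv_in[OF atlas] by (simp add: charts_at_def)

lemma tvec_of_nonzero:
  assumes "c \<in> charts_at A p" "y \<noteq> 0"
  shows "tvec_of A c p y \<noteq> (\<lambda>_. 0)"
  using tvec_of_self[OF atlas assms(1)] assms(2) by metis

lemma nat_chart_inv:
  assumes "c \<in> A" "x \<in> snd c ` fst c"
  shows "chart_inv (nat_chart A c) (x, y) = (chart_inv c x, tvec_of A c (chart_inv c x) y)"
proof -
  let ?p = "chart_inv c x"
  have c: "c \<in> charts_at A ?p" using charts_at_chart_inv[OF assms] .
  have inj: "inj_on (snd (nat_chart A c)) (fst (nat_chart A c))"
  proof (rule inj_onI)
    fix u w assume "u \<in> fst (nat_chart A c)" "w \<in> fst (nat_chart A c)"
      and eq: "snd (nat_chart A c) u = snd (nat_chart A c) w"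
    then have mem: "fst u \<in> fst c" "fst w \<in> fst c" "snd u \<in> tangent_space A (fst u)" "snd w \<in> tangent_space A (fst w)"
      by (auto simp: fst_nat_chart)
    have "fst u = fst w" using eq chart_inv_chart[OF atlas assms(1)] mem by (metis fst_conv snd_nat_chart)
    moreover have "snd u c = snd w c" using eq by (simp add: snd_nat_chart)
    ultimately show "u = w"
      using tangent_eqI[OF atlas mem(3)] mem assms(1) by (metis charts_atI prod_eq_iff)
  qed
  have mem: "(?p, tvec_of A c ?p y) \<in> fst (nat_chart A c)"
    using tvec_of_in[OF atlas c] c by (simp add: fst_nat_chart charts_at_def)
  have im: "snd (nat_chart A c) (?p, tvec_of A c ?p y) = (x, y)"
    using tvec_of_self[OF atlas c] chart_chart_inv[OF atlas assms(2)] by (simp add: snd_nat_chart)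
  show ?thesis unfolding chart_inv_def[of "nat_chart A c"] im[symmetric] by (rule inv_into_f_f[OF inj mem])
qed

lemma inj_slit_chart:
  assumes "c \<in> A"
  shows "inj_on (snd (slit_chart A c)) (fst (slit_chart A c))"
proof (rule inj_onI)
  fix u w assume "u \<in> fst (slit_chart A c)" "w \<in> fst (slit_chart A c)"
    and eq: "snd (slit_chart A c) u = snd (slit_chart A c) w"
  then have mem: "fst u \<in> fst c" "fst w \<in> fst c" "snd u \<in> tangent_space A (fst u)" "snd w \<in> tangent_space A (fst w)"
    by (auto simp: fst_slit_chart)
  have "fst u = fst w" using eq chart_inv_chart[OF atlas assms(1)] mem by (metis fst_conv snd_slit_chart)
  moreover have "snd u c = snd w c" using eq by (simp add: snd_slit_chart)
  ultimately show "u = w"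
    using tangent_eqI[OF atlas mem(3)] mem assms(1) by (metis charts_atI prod_eq_iff)
qed

lemma slit_chart_inv:
  assumes "c \<in> A" "x \<in> snd c ` fst c" "y \<noteq> 0"
  shows "chart_inv (slit_chart A c) (x, y) = (chart_inv c x, tvec_of A c (chart_inv c x) y)"
    and "(chart_inv c x, tvec_of A c (chart_inv c x) y) \<in> fst (slit_chart A c)"
    and "snd (slit_chart A c) (chart_inv c x, tvec_of A c (chart_inv c x) y) = (x, y)"
proof -
  let ?p = "chart_inv c x"
  have c: "c \<in> charts_at A ?p" using charts_at_chart_inv[OF assms(1,2)] .
  show mem: "(?p, tvec_of A c ?p y) \<in> fst (slit_chart A c)"
    using tvec_of_in[OF atlas c] tvec_of_nonzero[OF c assms(3)] c by (simp add: fst_slit_chart charts_at_def)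
  show im: "snd (slit_chart A c) (?p, tvec_of A c ?p y) = (x, y)"
    using tvec_of_self[OF atlas c] chart_chart_inv[OF atlas assms(2)] by (simp add: snd_slit_chart)
  show "chart_inv (slit_chart A c) (x, y) = (?p, tvec_of A c ?p y)"
    unfolding chart_inv_def[of "slit_chart A c"] im[symmetric] by (rule inv_into_f_f[OF inj_slit_chart[OF assms(1)] mem])
qed

lemma fst_slit_chart_inv:
  "c \<in> A \<Longrightarrow> z \<in> snd c ` fst c \<times> (- {0}) \<Longrightarrow> fst (chart_inv (slit_chart A c) z) = chart_inv c (fst z)"
  using slit_chart_inv(1)[of c "fst z" "snd z"] by (cases z) simp

lemma slit_image:
  assumes "c \<in> A"
  shows "snd (slit_chart A c) ` (fst (slit_chart A c) \<inter> fst -` W) = snd c ` (fst c \<inter> W) \<times> (- {0})"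
proof (intro equalityI subsetI)
  fix z :: "(real^'n) \<times> (real^'n)"
  assume "z \<in> snd (slit_chart A c) ` (fst (slit_chart A c) \<inter> fst -` W)"
  then obtain p v where z: "z = (snd c p, v c)" "p \<in> fst c" "p \<in> W" "v \<in> tangent_space A p" "v \<noteq> (\<lambda>_. 0)"
    by (auto simp: fst_slit_chart snd_slit_chart)
  then show "z \<in> snd c ` (fst c \<inter> W) \<times> (- {0})"
    using tangent_nonzero[OF z(4) charts_atI[OF assms z(2)]] by auto
next
  fix z :: "(real^'n) \<times> (real^'n)" assume "z \<in> snd c ` (fst c \<inter> W) \<times> (- {0})"
  moreover obtain x y where z1: "z = (x, y)" by (cases z)
  ultimately have z: "z = (x, y)" "x \<in> snd c ` fst c" "chart_inv c x \<in> W" "y \<noteq> 0"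
    unfolding z1 mem_Sigma_iff chart_image_iff[OF atlas assms] by simp_all
  then show "z \<in> snd (slit_chart A c) ` (fst (slit_chart A c) \<inter> fst -` W)"
    using slit_chart_inv(2,3)[OF assms z(2,4)] by (auto intro!: rev_image_eqI)
qed

lemma slit_image_full:
  assumes "c \<in> A"
  shows "snd (slit_chart A c) ` fst (slit_chart A c) = snd c ` fst c \<times> (- {0})"
  using slit_image[OF assms, of UNIV] by simp

lemma slit_image_overlap:
  assumes "c \<in> A"
  shows "snd (slit_chart A c) ` (fst (slit_chart A c) \<inter> fst (slit_chart A d)) = snd c ` (fst c \<inter> fst d) \<times> (- {0})"
proof -
  have "fst (slit_chart A c) \<inter> fst (slit_chart A d) = fst (slit_chart A c) \<inter> fst -` fst d"
    by (auto simp: fst_slit_chart)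
  then show ?thesis using slit_image[OF assms] by simp
qed

lemma open_slit_image: "c \<in> A \<Longrightarrow> d \<in> A \<Longrightarrow> open (snd c ` (fst c \<inter> fst d) \<times> (- {0::real^'n}))"
  by (intro open_Times open_overlap[OF atlas]) auto

lemma slit_transition:
  assumes "c \<in> A" "d \<in> A" "z \<in> snd c ` (fst c \<inter> fst d) \<times> (- {0})"
  shows "transition (slit_chart A c) (slit_chart A d) z = tangent_map (transition c d) z"
proof -
  obtain x y where z1: "z = (x, y)" by (cases z)
  have z: "z = (x, y)" "x \<in> snd c ` fst c" "chart_inv c x \<in> fst d" "y \<noteq> 0"
    using assms(3) unfolding z1 mem_Sigma_iff chart_image_iff[OF atlas assms(1)] by simp_all
  have d: "d \<in> charts_at A (chart_inv c x)" using z assms by (simp add: charts_at_def)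
  show ?thesis
    unfolding transition_def[of "slit_chart A c"] comp_def z(1) slit_chart_inv(1)[OF assms(1) z(2,4)]
    using d chart_chart_inv[OF atlas z(2)]
    by (simp add: snd_slit_chart tangent_map_def tvec_of_def[OF atlas] transition_def)
qed

text \<open>The coordinate changes of the slit bundle are the tangent maps of those of \<open>M\<close>.\<close>

lemma slit_smooth_atlas: "smooth_atlas (slit_bundle M A) (slit_atlas A)"
  unfolding smooth_atlas_def
proof (intro conjI ballI)
  show "(\<Union>c\<in>slit_atlas A. fst c) = slit_bundle M A"
  proof (intro equalityI subsetI)
    fix u assume "u \<in> (\<Union>c\<in>slit_atlas A. fst c)"
    then obtain c where c: "c \<in> A" "u \<in> fst (slit_chart A c)" by (auto simp: slit_atlas_def)
    then show "u \<in> slit_bundle M A"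
      using chart_domain_subset[OF atlas c(1)] by (auto simp: slit_bundle_iff fst_slit_chart)
  next
    fix u assume u: "u \<in> slit_bundle M A"
    then have "fst u \<in> M" unfolding slit_bundle_iff by blast
    then obtain c where "c \<in> charts_at A (fst u)" using charts_at_nonempty[OF atlas] by blast
    with u show "u \<in> (\<Union>c\<in>slit_atlas A. fst c)"
      by (auto simp: slit_atlas_def slit_bundle_iff fst_slit_chart charts_at_def split: prod.splits intro!: bexI[of _ c])
  qed
  fix c' assume "c' \<in> slit_atlas A"
  then obtain c where c: "c \<in> A" "c' = slit_chart A c" by (auto simp: slit_atlas_def)
  show "inj_on (snd c') (fst c')" using inj_slit_chart c by simp
  show "open (snd c' ` fst c')"
    unfolding c(2) slit_image_full[OF c(1)] using open_slit_image[OF c(1) c(1)] by simp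
  fix d' assume "d' \<in> slit_atlas A"
  then obtain d where d: "d \<in> A" "d' = slit_chart A d" by (auto simp: slit_atlas_def)
  show "open (snd c' ` (fst c' \<inter> fst d'))"
    unfolding c(2) d(2) slit_image_overlap[OF c(1)] by (rule open_slit_image[OF c(1) d(1)])
  have "smooth_on (tangent_map (transition c d)) (snd c ` (fst c \<inter> fst d) \<times> (- {0}))"
    by (rule smooth_on_subset[OF smooth_on_tangent_map[OF open_overlap[OF atlas] smooth_transition[OF atlas]]])
      (use c d in auto)
  then show "smooth_on (transition c' d') (snd c' ` (fst c' \<inter> fst d'))"
    unfolding c(2) d(2) slit_image_overlap[OF c(1)]
    by (rule smooth_on_cong[OF _ open_slit_image[OF c(1) d(1)]]) (simp add: slit_transition[OF c(1) d(1)])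
qed

lemma slit_charts_at:
  assumes "u \<in> slit_bundle M A"
  shows "charts_at (slit_atlas A) u = slit_chart A ` charts_at A (fst u)"
  using assms by (auto simp: charts_at_def slit_atlas_def slit_bundle_iff fst_slit_chart split: prod.splits)

lemma slit_coordinates:
  assumes "u \<in> slit_bundle M A" "c \<in> charts_at A (fst u)"
  shows "snd (slit_chart A c) u \<in> snd c ` fst c \<times> (- {0})"
  using assms tangent_nonzero[of "snd u" "fst u" c] by (auto simp: snd_slit_chart slit_bundle_iff charts_at_def)

lemma slit_jac:
  assumes "u \<in> slit_bundle M A" "c \<in> charts_at A (fst u)" "d \<in> charts_at A (fst u)"
  shows "jac (slit_chart A c) (slit_chart A d) u w =
    (jac c d (fst u) (fst w), D2 (transition c d) (snd c (fst u)) (snd u c) (fst w) + jac c d (fst u) (snd w))"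
proof -
  have mem: "c \<in> A" "d \<in> A" "fst u \<in> fst c" "fst u \<in> fst d" using assms by (auto simp: charts_at_def)
  have z: "snd (slit_chart A c) u \<in> snd c ` (fst c \<inter> fst d) \<times> (- {0})"
    using slit_coordinates[OF assms(1,2)] mem by (auto simp: snd_slit_chart)
  then have x: "snd c (fst u) \<in> snd c ` (fst c \<inter> fst d)" by (simp add: snd_slit_chart)
  have "(tangent_map (transition c d) has_derivative
     (\<lambda>w. (jac c d (fst u) (fst w), D2 (transition c d) (snd c (fst u)) (snd u c) (fst w) + jac c d (fst u) (snd w))))
     (at (snd (slit_chart A c) u))"
    unfolding snd_slit_chart
    by (rule tangent_map_has_derivative[OF open_overlap[OF atlas mem(1,2)] smooth_transition[OF atlas mem(1,2)] x])
  then have "(transition (slit_chart A c) (slit_chart A d) has_derivative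
     (\<lambda>w. (jac c d (fst u) (fst w), D2 (transition c d) (snd c (fst u)) (snd u c) (fst w) + jac c d (fst u) (snd w))))
     (at (snd (slit_chart A c) u))"
    by (rule has_derivative_transform_within_open[OF _ open_slit_image[OF mem(1,2)] z])
      (simp add: slit_transition[OF mem(1,2)])
  from frechet_derivative_eqI[OF this] show ?thesis by simp
qed

lemma smooth_on_fst_compose:
  fixes g :: "real^'n \<Rightarrow> 'b::real_normed_vector"
  assumes "open U" "smooth_on g U"
  shows "smooth_on (\<lambda>z. g (fst z)) (U \<times> (- {0::real^'n}))"
proof -
  have op: "open (U \<times> (- {0::real^'n}))" using assms(1) by (intro open_Times) auto
  show ?thesis by (rule smooth_on_compose[OF assms(2) smooth_on_fst[OF op] op assms(1)]) auto
qed

lemma smooth_fun_pullback: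
  assumes "smooth_fun A h"
  shows "smooth_fun (slit_atlas A) (\<lambda>u. h (fst u))"
  unfolding smooth_fun_def slit_atlas_def
proof (intro ballI, elim imageE)
  fix c' c assume c': "c' = slit_chart A c" and c: "c \<in> A"
  have "smooth_on (\<lambda>z. (h \<circ> chart_inv c) (fst z)) (snd c ` fst c \<times> (- {0::real^'n}))"
    by (rule smooth_on_fst_compose[OF open_chart[OF atlas c]]) (use assms c in \<open>simp add: smooth_fun_def comp_def\<close>)
  then show "smooth_on ((\<lambda>u. h (fst u)) \<circ> chart_inv c') (snd c' ` fst c')"
    unfolding c' slit_image_full[OF c]
    by (rule smooth_on_cong) (use open_slit_image[OF c c] fst_slit_chart_inv[OF c] in \<open>simp_all add: comp_def\<close>)
qed

text \<open>The domain of a slit chart is the full preimage of a chart domain of \<open>M\<close>, so a function that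
  localizes on the base also localizes on the slit bundle.\<close>

lemma slit_has_bumps:
  assumes "has_bumps M A"
  shows "has_bumps (slit_bundle M A) (slit_atlas A)"
  unfolding has_bumps_def[OF slit_smooth_atlas]
proof (intro ballI)
  fix u d' assume u: "u \<in> slit_bundle M A" and d': "d' \<in> charts_at (slit_atlas A) u"
  then obtain d where d: "d' = slit_chart A d" "d \<in> charts_at A (fst u)" using slit_charts_at by auto
  then have dA: "d \<in> A" by (simp add: charts_at_def)
  obtain \<beta> where \<beta>: "localized_in A d \<beta>" "\<beta> (fst u) = 1"
    using assms u d unfolding has_bumps_def[OF atlas] by (auto simp: slit_bundle_iff)
  have "localized_in (slit_atlas A) d' (\<lambda>u. \<beta> (fst u))"
    unfolding localized_in_def[OF slit_smooth_atlas]
  proof (intro conjI ballI)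
    show "smooth_fun (slit_atlas A) (\<lambda>u. \<beta> (fst u))"
      using smooth_fun_pullback \<beta>(1) unfolding localized_in_def[OF atlas] by blast
    fix c' assume "c' \<in> slit_atlas A"
    then obtain c where c': "c' = slit_chart A c" and c: "c \<in> A" by (auto simp: slit_atlas_def)
    obtain Z where Z: "open Z" "Z \<subseteq> snd c ` fst c" "\<forall>z\<in>Z. \<beta> (chart_inv c z) = 0"
        "snd c ` fst c \<subseteq> Z \<union> snd c ` (fst c \<inter> fst d)"
      using \<beta>(1) c unfolding localized_in_def[OF atlas] by meson
    show "\<exists>Z. open Z \<and> Z \<subseteq> snd c' ` fst c' \<and> (\<forall>z\<in>Z. \<beta> (fst (chart_inv c' z)) = 0) \<and>
        snd c' ` fst c' \<subseteq> Z \<union> snd c' ` (fst c' \<inter> fst d')"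
      unfolding c' d(1) slit_image_full[OF c] slit_image_overlap[OF c]
    proof (intro exI conjI)
      show "open (Z \<times> (- {0::real^'n}))" using Z(1) by (intro open_Times) auto
      show "Z \<times> (- {0::real^'n}) \<subseteq> snd c ` fst c \<times> - {0}" using Z(2) by auto
      show "\<forall>z\<in>Z \<times> - {0}. \<beta> (fst (chart_inv (slit_chart A c) z)) = 0"
      proof
        fix z :: "(real^'n) \<times> (real^'n)" assume "z \<in> Z \<times> - {0}"
        then obtain x y where "z = (x, y)" "x \<in> Z" "y \<noteq> 0" by auto
        then show "\<beta> (fst (chart_inv (slit_chart A c) z)) = 0"
          using slit_chart_inv(1)[OF c, of x y] Z(2,3) by auto
      qed
      show "snd c ` fst c \<times> (- {0::real^'n}) \<subseteq> Z \<times> - {0} \<union> snd c ` (fst c \<inter> fst d) \<times> - {0}" using Z(4) by blast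
    qed
  qed
  then show "\<exists>\<beta>. localized_in (slit_atlas A) d' \<beta> \<and> \<beta> u = 1" using \<beta>(2) by blast
qed

lemma pullback_field_section:
  assumes "Y \<in> vector_fields M A"
  shows "pullback_field M A Y \<in> pullback_sections (slit_bundle M A) (slit_atlas A) fst A"
  unfolding pullback_sections_def
proof (intro CollectI conjI ballI allI impI)
  fix u assume "u \<in> slit_bundle M A"
  then show "pullback_field M A Y u \<in> tangent_space A (fst u)"
    using vector_fields_tangent[OF atlas assms] by (simp add: pullback_field_def slit_bundle_iff)
next
  fix u assume "u \<notin> slit_bundle M A"
  then show "pullback_field M A Y u = (\<lambda>_. 0)" by (simp add: pullback_field_def)
next
  fix d' c assume "d' \<in> slit_atlas A" and c: "c \<in> A"
  then obtain d where d': "d' = slit_chart A d" and d: "d \<in> A" by (auto simp: slit_atlas_def)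
  have "smooth_on (\<lambda>z. Y (chart_inv d (fst z)) c) (snd d ` (fst d \<inter> fst c) \<times> (- {0::real^'n}))"
    by (rule smooth_on_fst_compose[OF open_overlap[OF atlas d c] vector_fields_smooth[OF atlas assms d c]])
  then show "smooth_on (\<lambda>z. pullback_field M A Y (chart_inv d' z) c) (snd d' ` (fst d' \<inter> fst -` fst c))"
    unfolding d' slit_image[OF d]
  proof (rule smooth_on_cong[OF _ open_slit_image[OF d c]])
    fix z :: "(real^'n) \<times> (real^'n)" assume "z \<in> snd d ` (fst d \<inter> fst c) \<times> - {0}"
    then obtain x y where z: "z = (x, y)" "x \<in> snd d ` fst d" "y \<noteq> 0" by auto
    have "chart_inv (slit_chart A d) z \<in> slit_bundle M A"
      using slit_chart_inv(1,2)[OF d z(2,3)] chart_domain_subset[OF atlas d] unfolding z(1)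
      by (auto simp: slit_bundle_iff fst_slit_chart)
    then show "Y (chart_inv d (fst z)) c = pullback_field M A Y (chart_inv (slit_chart A d) z) c"
      using slit_chart_inv(1)[OF d z(2,3)] by (simp add: pullback_field_def z(1))
  qed
qed

text \<open>A function lifted from the base is differentiated by the projection of the direction.\<close>

lemma dir_deriv_pullback:
  assumes "smooth_fun A h" "u \<in> slit_bundle M A" "\<xi> \<in> tangent_space (slit_atlas A) u"
    and "X \<in> tangent_space A (fst u)" "c \<in> charts_at A (fst u)" "fst (\<xi> (slit_chart A c)) = X c"
  shows "dir_deriv (slit_atlas A) (\<lambda>u. h (fst u)) u \<xi> = dir_deriv A h (fst u) X"
proof -
  have mem: "c \<in> A" "fst u \<in> fst c" "fst u \<in> M" using assms(2,5) by (auto simp: charts_at_def slit_bundle_iff)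
  have c': "slit_chart A c \<in> charts_at (slit_atlas A) u" using slit_charts_at[OF assms(2)] assms(5) by blast
  have hd: "((h \<circ> chart_inv c) has_derivative frechet_derivative (h \<circ> chart_inv c) (at (snd c (fst u))))
      (at (fst (snd (slit_chart A c) u)))"
    using smooth_on_has_derivative assms(1) mem unfolding smooth_fun_def snd_slit_chart fst_conv by blast
  have fd: "(fst has_derivative fst) (at (snd (slit_chart A c) u))"
    by (rule bounded_linear_imp_has_derivative[OF bounded_linear_fst])
  have eq: "(h \<circ> chart_inv c) (fst z) = ((\<lambda>u. h (fst u)) \<circ> chart_inv (slit_chart A c)) z"
    if "z \<in> snd c ` (fst c \<inter> fst c) \<times> (- {0})" for z
    using that fst_slit_chart_inv[OF mem(1)] by simp
  have z: "snd (slit_chart A c) u \<in> snd c ` (fst c \<inter> fst c) \<times> (- {0})"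
    using slit_coordinates[OF assms(2,5)] by simp
  have "(((\<lambda>u. h (fst u)) \<circ> chart_inv (slit_chart A c)) has_derivative
      (\<lambda>w. frechet_derivative (h \<circ> chart_inv c) (at (snd c (fst u))) (fst w))) (at (snd (slit_chart A c) u))"
    by (rule has_derivative_transform_within_open[OF has_derivative_compose[OF fd hd]
        open_slit_image[OF mem(1,1)] z eq])
  from frechet_derivative_eqI[OF this] show ?thesis
    unfolding dir_deriv_chart[OF slit_smooth_atlas smooth_fun_pullback[OF assms(1)] assms(2,3) c']
      dir_deriv_chart[OF atlas assms(1) mem(3) assms(4,5)] using assms(6) by simp
qed

end

section \<open>The horizontal lift\<close>

subsection \<open>Rules for partial derivatives\<close>

lemma pd_as_derivative:
  "pd_x k h = (\<lambda>z. frechet_derivative h (at z) (axis k 1, 0))"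
  "pd_y k h = (\<lambda>z. frechet_derivative h (at z) (0, axis k 1))"
  by (simp_all add: pd_x_def pd_y_def fun_eq_iff)

lemma linear_on_vertical:
  fixes L :: "'a::real_vector \<times> (real^'n) \<Rightarrow> real"
  assumes "linear L"
  shows "L (0, b) = (\<Sum>s\<in>UNIV. b $ s * L (0, axis s 1))"
proof -
  have "(0::'a, b) = (\<Sum>s\<in>UNIV. b $ s *\<^sub>R (0, axis s 1))"
    using basis_expansion[of b] by (simp add: prod_eq_iff fst_sum snd_sum scalar_mult_eq_scaleR)
  then have "L (0, b) = L (\<Sum>s\<in>UNIV. b $ s *\<^sub>R (0, axis s 1))" by simp
  also have "\<dots> = (\<Sum>s\<in>UNIV. b $ s * L (0, axis s 1))"
    by (simp only: linear_sum[OF assms] linear_scale[OF assms] real_scaleR_def)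
  finally show ?thesis .
qed

lemma linear_on_horizontal:
  fixes L :: "(real^'n) \<times> 'a::real_vector \<Rightarrow> real"
  assumes "linear L"
  shows "L (b, 0) = (\<Sum>s\<in>UNIV. b $ s * L (axis s 1, 0))"
proof -
  have "(b, 0::'a) = (\<Sum>s\<in>UNIV. b $ s *\<^sub>R (axis s 1, 0))"
    using basis_expansion[of b] by (simp add: prod_eq_iff fst_sum snd_sum scalar_mult_eq_scaleR)
  then have "L (b, 0) = L (\<Sum>s\<in>UNIV. b $ s *\<^sub>R (axis s 1, 0))" by simp
  also have "\<dots> = (\<Sum>s\<in>UNIV. b $ s * L (axis s 1, 0))"
    by (simp only: linear_sum[OF assms] linear_scale[OF assms] real_scaleR_def)
  finally show ?thesis .
qed

context
  fixes S :: "'a::real_normed_vector set" and z :: 'a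
  assumes z: "z \<in> S"
begin

lemma derivative_mult:
  fixes f g :: "'a \<Rightarrow> real"
  assumes "smooth_on f S" "smooth_on g S"
  shows "frechet_derivative (\<lambda>z. f z * g z) (at z) w =
    frechet_derivative f (at z) w * g z + f z * frechet_derivative g (at z) w"
  using frechet_derivative_eqI[OF has_derivative_mult[OF smooth_on_has_derivative[OF assms(1) z]
      smooth_on_has_derivative[OF assms(2) z]]] by simp

lemma derivative_cmult:
  fixes f :: "'a \<Rightarrow> real"
  assumes "smooth_on f S"
  shows "frechet_derivative (\<lambda>z. r * f z) (at z) w = r * frechet_derivative f (at z) w"
  using frechet_derivative_eqI[OF has_derivative_mult_right[OF smooth_on_has_derivative[OF assms(1) z]]] by simp

lemma derivative_diff:
  fixes f g :: "'a \<Rightarrow> real"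
  assumes "smooth_on f S" "smooth_on g S"
  shows "frechet_derivative (\<lambda>z. f z - g z) (at z) w =
    frechet_derivative f (at z) w - frechet_derivative g (at z) w"
  using frechet_derivative_eqI[OF has_derivative_diff[OF smooth_on_has_derivative[OF assms(1) z]
      smooth_on_has_derivative[OF assms(2) z]]] by simp

lemma derivative_sum:
  fixes f :: "'i \<Rightarrow> 'a \<Rightarrow> real"
  assumes "\<And>i. i \<in> I \<Longrightarrow> smooth_on (f i) S"
  shows "frechet_derivative (\<lambda>z. \<Sum>i\<in>I. f i z) (at z) w = (\<Sum>i\<in>I. frechet_derivative (f i) (at z) w)"
  using frechet_derivative_eqI[OF has_derivative_sum[of I f, OF smooth_on_has_derivative[OF assms z]]] by simp

end

lemma derivative_fibre_coordinate:
  "frechet_derivative (\<lambda>z::(real^'n)\<times>(real^'n). snd z $ s) (at z) w = snd w $ s"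
proof -
  have "bounded_linear (\<lambda>z::(real^'n)\<times>(real^'n). snd z $ s)"
    by (rule bounded_linear_compose[OF bounded_linear_vec_nth bounded_linear_snd])
  from frechet_derivative_eqI[OF bounded_linear_imp_has_derivative[OF this]] show ?thesis by simp
qed

lemma smooth_on_fibre_coordinate: "open S \<Longrightarrow> smooth_on (\<lambda>z::(real^'n)\<times>(real^'n). snd z $ s) S"
  by (intro smooth_on_nth smooth_on_snd)

subsection \<open>Homogeneity\<close>

abbreviation fibre_scale :: "real \<Rightarrow> 'a::real_vector \<times> 'b::real_vector \<Rightarrow> 'a \<times> 'b" where
  "fibre_scale r z \<equiv> (fst z, r *\<^sub>R snd z)"

definition homogeneous_on :: "nat \<Rightarrow> ('a::real_vector \<times> 'b::real_vector) set \<Rightarrow> ('a \<times> 'b \<Rightarrow> real) \<Rightarrow> bool" where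
  "homogeneous_on k S h \<longleftrightarrow> (\<forall>z\<in>S. \<forall>r>0. h (fibre_scale r z) = r ^ k * h z)"

context
  fixes U :: "'a::euclidean_space set" and S :: "('a \<times> 'b::euclidean_space) set"
  assumes S: "S = U \<times> (- {0})" and U: "open U"
begin

lemma open_cone: "open S"
  unfolding S by (intro open_Times U) auto

lemma fibre_scale_in: "z \<in> S \<Longrightarrow> r > 0 \<Longrightarrow> fibre_scale r z \<in> S"
  unfolding S by auto

text \<open>Differentiating the homogeneity identity along the fibre produces a factor \<open>r\<close> on the left
  from the scaled direction, which lowers the degree by one.\<close>

lemma homogeneous_vertical_derivative:
  assumes "homogeneous_on (Suc k) S h" "smooth_on h S"
  shows "homogeneous_on k S (\<lambda>z. frechet_derivative h (at z) (0, b))"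
  unfolding homogeneous_on_def
proof (intro ballI allI impI)
  fix z and r :: real assume z: "z \<in> S" and r: "r > 0"
  let ?z = "fibre_scale r z"
  have lin: "bounded_linear (fibre_scale r :: 'a \<times> 'b \<Rightarrow> _)"
    by (intro bounded_linear_Pair bounded_linear_fst
        bounded_linear_compose[OF bounded_linear_scaleR_right bounded_linear_snd])
  have "(h has_derivative frechet_derivative h (at ?z)) (at ?z)"
    by (rule smooth_on_has_derivative[OF assms(2) fibre_scale_in[OF z r]])
  from has_derivative_compose[OF bounded_linear_imp_has_derivative[OF lin] this]
  have 1: "((\<lambda>z. h (fibre_scale r z)) has_derivative (\<lambda>w. frechet_derivative h (at ?z) (fibre_scale r w))) (at z)" .
  have "((\<lambda>z. r ^ Suc k * h z) has_derivative (\<lambda>w. r ^ Suc k * frechet_derivative h (at z) w)) (at z)"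
    by (rule has_derivative_mult_right[OF smooth_on_has_derivative[OF assms(2) z]])
  then have 2: "((\<lambda>z. h (fibre_scale r z)) has_derivative (\<lambda>w. r ^ Suc k * frechet_derivative h (at z) w)) (at z)"
    by (rule has_derivative_transform_within_open[OF _ open_cone z])
      (use assms(1) r in \<open>simp add: homogeneous_on_def\<close>)
  have "frechet_derivative h (at ?z) (fibre_scale r (0, b)) = r ^ Suc k * frechet_derivative h (at z) (0, b)"
    using has_derivative_unique[OF 1 2] by meson
  moreover have "fibre_scale r (0::'a, b) = r *\<^sub>R (0, b)" by simp
  ultimately have "r * frechet_derivative h (at ?z) (0, b) = r ^ Suc k * frechet_derivative h (at z) (0, b)"
    using linear_scale[OF smooth_on_linear_derivative[OF assms(2) fibre_scale_in[OF z r]], of r "(0, b)"] by auto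
  then show "frechet_derivative h (at ?z) (0, b) = r ^ k * frechet_derivative h (at z) (0, b)"
    using r by auto
qed

text \<open>The derivative of the homogeneity identity with respect to the factor \<open>r\<close> at \<open>r = 1\<close>.\<close>

lemma euler_identity:
  assumes "homogeneous_on k S h" "smooth_on h S" "z \<in> S"
  shows "frechet_derivative h (at z) (0, snd z) = k * h z"
proof -
  have 1: "((\<lambda>r. (fst z, r *\<^sub>R snd z)) has_derivative (\<lambda>r. (0, r *\<^sub>R snd z))) (at (1::real))"
    by (auto intro!: derivative_eq_intros)
  have "(h has_derivative frechet_derivative h (at z)) (at (fst z, 1 *\<^sub>R snd z))"
    using smooth_on_has_derivative[OF assms(2,3)] by simp
  from has_derivative_compose[OF 1 this]
  have 2: "((\<lambda>r. h (fibre_scale r z)) has_derivative (\<lambda>r. frechet_derivative h (at z) (0, r *\<^sub>R snd z))) (at 1)" .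
  have "((\<lambda>r. r ^ k * h z) has_derivative (\<lambda>r. r * k * h z)) (at (1::real))"
    by (auto intro!: derivative_eq_intros)
  then have "((\<lambda>r. h (fibre_scale r z)) has_derivative (\<lambda>r. r * k * h z)) (at 1)"
    by (rule has_derivative_transform_within_open[of _ _ _ _ "{0<..}"])
      (use assms in \<open>auto simp: homogeneous_on_def\<close>)
  from has_derivative_unique[OF 2 this] show ?thesis by (auto dest: fun_cong[of _ _ 1])
qed

end

subsection \<open>The fundamental tensor of a Finsler space\<close>

context
  fixes M :: "'p set" and A :: "('p, real^'n::finite) chart set" and F :: "('p, 'n) tpoint \<Rightarrow> real"
  assumes finsler: "finsler_space M A F"
begin

lemma finsler_atlas: "smooth_atlas M A"
  using finsler unfolding finsler_space_def smooth_manifold_def by blast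

lemma finsler_bumps: "has_bumps M A"
  using has_bumps_Hausdorff[OF finsler_atlas] finsler unfolding finsler_space_def smooth_manifold_def by blast

abbreviation slit_dom :: "('p, real^'n) chart \<Rightarrow> ((real^'n) \<times> (real^'n)) set" where
  "slit_dom c \<equiv> snd c ` fst c \<times> (- {0})"

context
  fixes c :: "('p, real^'n) chart"
  assumes c: "c \<in> A"
begin

lemma open_dom: "open (snd c ` fst c)" and open_slit_dom: "open (slit_dom c)"
  using open_chart[OF finsler_atlas c] open_cone[OF refl] by blast+

lemma F_coord_eq:
  "x \<in> snd c ` fst c \<Longrightarrow> F_coord A F c (x, y) = F (chart_inv c x, tvec_of A c (chart_inv c x) y)"
  by (simp add: F_coord_def nat_chart_inv[OF finsler_atlas c])

lemma smooth_F_coord: "smooth_on (F_coord A F c) (slit_dom c)"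
proof -
  have "smooth_on (F \<circ> chart_inv (slit_chart A c)) (slit_dom c)"
    using finsler c unfolding finsler_space_def smooth_fun_def slit_atlas_def
      slit_image_full[OF finsler_atlas c, symmetric] by blast
  then show ?thesis
  proof (rule smooth_on_cong[OF _ open_slit_dom])
    fix z :: "(real^'n) \<times> (real^'n)" assume "z \<in> slit_dom c"
    then obtain x y where z: "z = (x, y)" "x \<in> snd c ` fst c" "y \<noteq> 0" by auto
    show "(F \<circ> chart_inv (slit_chart A c)) z = F_coord A F c z"
      using slit_chart_inv(1)[OF finsler_atlas c z(2,3)] by (simp add: z(1) F_coord_eq[OF z(2)])
  qed
qed

lemma smooth_F_coord_sq: "smooth_on (\<lambda>z. (F_coord A F c z)\<^sup>2) (slit_dom c)"
  by (rule smooth_on_power[OF open_slit_dom smooth_F_coord])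

lemma coordinates_in_slit_bundle:
  assumes "x \<in> snd c ` fst c" "y \<noteq> 0"
  shows "(chart_inv c x, tvec_of A c (chart_inv c x) y) \<in> slit_bundle M A"
  using slit_chart_inv(2)[OF finsler_atlas c assms] chart_domain_subset[OF finsler_atlas c]
  by (auto simp: slit_bundle_iff[OF finsler_atlas] fst_slit_chart)

lemma fund_tensor_pos:
  assumes "z \<in> slit_dom c" "w \<noteq> 0"
  shows "0 < w \<bullet> (fund_tensor A F c z *v w)"
proof -
  obtain x y where z: "z = (x, y)" "x \<in> snd c ` fst c" "y \<noteq> 0" using assms(1) by auto
  let ?u = "(chart_inv c x, tvec_of A c (chart_inv c x) y)"
  have ca: "c \<in> charts_at A (chart_inv c x)" using charts_at_chart_inv[OF finsler_atlas c z(2)] .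
  have "snd (nat_chart A c) ?u = z"
    using slit_chart_inv(3)[OF finsler_atlas c z(2,3)] by (simp add: snd_slit_chart snd_nat_chart z(1))
  moreover have "c \<in> charts_at A (fst ?u)" using ca by simp
  moreover have "\<forall>u \<in> slit_bundle M A. \<forall>c \<in> charts_at A (fst u).
        \<forall>w. w \<noteq> 0 \<longrightarrow> 0 < w \<bullet> (fund_tensor A F c (snd (nat_chart A c) u) *v w)"
    using finsler unfolding finsler_space_def by (elim conjE)
  ultimately show ?thesis
    using coordinates_in_slit_bundle[OF z(2,3)] assms(2) by (metis (no_types))
qed

lemma F_coord_homogeneous: "homogeneous_on 1 (slit_dom c) (F_coord A F c)"
  unfolding homogeneous_on_def
proof (intro ballI allI impI)
  have hom: "\<forall>(x, v) \<in> tangent_bundle M A. \<forall>r\<ge>0. F (x, \<lambda>c. r *\<^sub>R v c) = r * F (x, v)"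
    using finsler unfolding finsler_space_def by (elim conjE)
  fix z and r :: real assume "z \<in> slit_dom c" and r: "r > 0"
  then obtain x y where z: "z = (x, y)" "x \<in> snd c ` fst c" "y \<noteq> 0" by auto
  let ?p = "chart_inv c x"
  have u: "(?p, tvec_of A c ?p y) \<in> tangent_bundle M A"
    using coordinates_in_slit_bundle[OF z(2,3)] unfolding slit_bundle_def by auto
  have ca: "c \<in> charts_at A ?p" using charts_at_chart_inv[OF finsler_atlas c z(2)] .
  have "tvec_of A c ?p (r *\<^sub>R y) = (\<lambda>e. r *\<^sub>R tvec_of A c ?p y e)"
    by (rule ext) (simp add: tvec_of_def[OF finsler_atlas] linear_scale[OF linear_jac[OF finsler_atlas ca]])
  then have "F (?p, tvec_of A c ?p (r *\<^sub>R y)) = r * F (?p, tvec_of A c ?p y)"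
    using bspec[OF hom u] less_imp_le[OF r] by simp
  then show "F_coord A F c (fibre_scale r z) = r ^ 1 * F_coord A F c z"
    by (simp add: z(1) F_coord_eq[OF z(2)])
qed

lemma F_sq_homogeneous: "homogeneous_on 2 (slit_dom c) (\<lambda>z. (F_coord A F c z)\<^sup>2)"
  using F_coord_homogeneous unfolding homogeneous_on_def by (simp add: power_mult_distrib)

private abbreviation (input) P :: "(real^'n) \<times> (real^'n) \<Rightarrow> real" where "P \<equiv> \<lambda>z. (F_coord A F c z)\<^sup>2"
private abbreviation (input) g where "g \<equiv> \<lambda>i j z. fund_tensor A F c z $ i $ j"

lemma fund_tensor_component: "fund_tensor A F c z $ i $ j = 1/2 * pd_y i (pd_y j P) z"
  by (simp add: fund_tensor_def)

lemma fund_tensor_entry: "g i j = (\<lambda>z. 1/2 * pd_y i (pd_y j P) z)"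
  by (simp add: fund_tensor_def fun_eq_iff)

lemma smooth_pd:
  assumes "smooth_on h (slit_dom c)"
  shows "smooth_on (pd_x k h) (slit_dom c)" "smooth_on (pd_y k h) (slit_dom c)"
  unfolding pd_as_derivative using smooth_on_derivative[OF assms] by auto

lemma pd_commute:
  assumes "smooth_on h (slit_dom c)" "z \<in> slit_dom c"
  shows "pd_x i (pd_y j h) z = pd_y j (pd_x i h) z" "pd_y i (pd_y j h) z = pd_y j (pd_y i h) z"
  unfolding pd_as_derivative using frechet_derivative_commute[OF open_slit_dom assms] by auto

lemma pd_cong:
  assumes "smooth_on h (slit_dom c)" "\<And>z. z \<in> slit_dom c \<Longrightarrow> h z = k z" "z \<in> slit_dom c"
  shows "pd_x i h z = pd_x i k z" "pd_y i h z = pd_y i k z"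
  unfolding pd_as_derivative
  using frechet_derivative_cong[OF open_slit_dom assms(3,2) smooth_on_differentiable[OF assms(1,3)]] by auto

lemma smooth_g: "smooth_on (g i j) (slit_dom c)"
  unfolding fund_tensor_entry
  by (intro smooth_on_mult smooth_on_const open_slit_dom smooth_pd smooth_F_coord_sq)

lemma smooth_fund_tensor: "smooth_on (fund_tensor A F c) (slit_dom c)"
proof -
  have "smooth_on (\<lambda>z. \<chi> i j. g i j z) (slit_dom c)"
    by (intro smooth_on_vec_lambda smooth_g open_slit_dom)
  moreover have "(\<lambda>z. \<chi> i j. g i j z) = fund_tensor A F c" by (simp add: fun_eq_iff vec_eq_iff)
  ultimately show ?thesis by simp
qed

lemma fund_tensor_sym:
  assumes "z \<in> slit_dom c"
  shows "g i j z = g j i z"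
  using pd_commute(2)[OF smooth_F_coord_sq assms] by (simp add: fund_tensor_component)

lemma fund_tensor_invertible:
  assumes "z \<in> slit_dom c"
  shows "invertible (fund_tensor A F c z)"
proof -
  have "w = 0" if "fund_tensor A F c z *v w = 0" for w
    using fund_tensor_pos[OF assms, of w] that by fastforce
  then show ?thesis using matrix_left_invertible_ker invertible_left_inverse by blast
qed

text \<open>The fundamental tensor is half of the vertical Hessian of \<open>F\<^sup>2\<close>. This form is free of indices
  and therefore easy to compare in two coordinate systems.\<close>

lemma fund_tensor_second_derivative:
  assumes "z \<in> slit_dom c"
  shows "D2 P z (0, a) (0, b) = 2 * (a \<bullet> (fund_tensor A F c z *v b))"
proof -
  have ax: "D2 P z (0, axis i 1) (0, axis j 1) = 2 * g i j z" for i j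
    using pd_commute(2)[OF smooth_F_coord_sq assms, of j i]
    by (simp add: fund_tensor_component pd_as_derivative)
  have "D2 P z (0, a) (0, b) = (\<Sum>j\<in>UNIV. b $ j * D2 P z (0, a) (0, axis j 1))"
    by (rule linear_on_vertical[OF D2_linear_right[OF smooth_F_coord_sq assms]])
  also have "\<dots> = (\<Sum>j\<in>UNIV. b $ j * (\<Sum>i\<in>UNIV. a $ i * D2 P z (0, axis i 1) (0, axis j 1)))"
    by (intro sum.cong refl arg_cong2[where f = "(*)"]
        linear_on_vertical[OF D2_linear_left[OF open_slit_dom smooth_F_coord_sq assms]])
  also have "\<dots> = (\<Sum>j\<in>UNIV. b $ j * (\<Sum>i\<in>UNIV. a $ i * (2 * g i j z)))"
    by (simp only: ax)
  also have "\<dots> = 2 * (\<Sum>i\<in>UNIV. a $ i * (\<Sum>j\<in>UNIV. g i j z * b $ j))"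
    unfolding sum_distrib_left by (subst sum.swap) (simp add: mult_ac)
  finally show ?thesis by (simp add: inner_vec_def matrix_vector_mult_def)
qed

lemma homogeneous_pd_y:
  "homogeneous_on (Suc k) (slit_dom c) h \<Longrightarrow> smooth_on h (slit_dom c) \<Longrightarrow> homogeneous_on k (slit_dom c) (pd_y i h)"
  unfolding pd_as_derivative by (rule homogeneous_vertical_derivative[OF refl open_dom])

lemma euler_pd:
  assumes "homogeneous_on k (slit_dom c) h" "smooth_on h (slit_dom c)" "z \<in> slit_dom c"
  shows "(\<Sum>s\<in>UNIV. snd z $ s * pd_y s h z) = k * h z"
  using euler_identity[OF refl open_dom assms]
    linear_on_vertical[OF smooth_on_linear_derivative[OF assms(2,3)], of "snd z"]
  by (simp add: pd_y_def)

lemma fund_tensor_homogeneous: "homogeneous_on 0 (slit_dom c) (g i j)"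
proof -
  have "homogeneous_on 0 (slit_dom c) (pd_y i (pd_y j P))"
    by (intro homogeneous_pd_y smooth_pd smooth_F_coord_sq)
      (simp add: F_sq_homogeneous flip: numeral_2_eq_2)
  then show ?thesis unfolding fund_tensor_entry homogeneous_on_def by simp
qed

lemma fund_tensor_euler1:
  assumes "z \<in> slit_dom c"
  shows "(\<Sum>s\<in>UNIV. g a s z * snd z $ s) = 1/2 * pd_y a P z"
proof -
  have "homogeneous_on 1 (slit_dom c) (pd_y a P)"
    by (intro homogeneous_pd_y smooth_F_coord_sq) (simp add: F_sq_homogeneous flip: numeral_2_eq_2)
  from euler_pd[OF this smooth_pd(2)[OF smooth_F_coord_sq] assms]
  have e: "(\<Sum>s\<in>UNIV. snd z $ s * pd_y s (pd_y a P) z) = pd_y a P z" by simp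
  have t: "g a s z * snd z $ s = 1/2 * (snd z $ s * pd_y s (pd_y a P) z)" for s
    using pd_commute(2)[OF smooth_F_coord_sq assms, of a s] by (simp add: fund_tensor_component)
  show ?thesis unfolding t sum_distrib_left[symmetric] e ..
qed

lemma F_sq_euler: "z \<in> slit_dom c \<Longrightarrow> (\<Sum>s\<in>UNIV. snd z $ s * pd_y s P z) = 2 * P z"
  using euler_pd[OF F_sq_homogeneous smooth_F_coord_sq] by simp

text \<open>Euler's identities give \<open>g(y, y) = F\<^sup>2\<close>, and \<open>g\<close> is positive definite.\<close>

lemma F_coord_pos:
  assumes "z \<in> slit_dom c"
  shows "0 < F_coord A F c z"
proof -
  obtain x y where z: "z = (x, y)" "x \<in> snd c ` fst c" "y \<noteq> 0" using assms by auto
  have "y \<bullet> (fund_tensor A F c z *v y) = (\<Sum>a\<in>UNIV. y $ a * (\<Sum>s\<in>UNIV. g a s z * y $ s))"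
    by (simp add: inner_vec_def matrix_vector_mult_def)
  also have "\<dots> = (\<Sum>a\<in>UNIV. 1/2 * (snd z $ a * pd_y a P z))"
    by (rule sum.cong) (use fund_tensor_euler1[OF assms] in \<open>simp_all add: z(1)\<close>)
  also have "\<dots> = 1/2 * (2 * P z)"
    unfolding sum_distrib_left[symmetric] F_sq_euler[OF assms] ..
  finally have "P z > 0" using fund_tensor_pos[OF assms z(3)] by simp
  moreover have "0 \<le> F_coord A F c z"
  proof -
    have "\<forall>u \<in> tangent_bundle M A. 0 \<le> F u"
      using finsler unfolding finsler_space_def by (elim conjE)
    then show ?thesis
      using coordinates_in_slit_bundle[OF z(2,3)] unfolding slit_bundle_def z(1) F_coord_eq[OF z(2)] by blast
  qed
  ultimately show ?thesis by (cases "F_coord A F c z = 0") auto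
qed

subsection \<open>The spray and the nonlinear connection\<close>

text \<open>The Euler-Lagrange expression of \<open>F\<^sup>2/2\<close> without its acceleration term; raising the index
  gives the coefficients \<open>G\<close> of the geodesic equation \<open>d\<^sup>2x/dt\<^sup>2 + G(x, dx/dt) = 0\<close>.\<close>

definition spray_low :: "'n \<Rightarrow> (real^'n) \<times> (real^'n) \<Rightarrow> real" where
  "spray_low a z = (\<Sum>k\<in>UNIV. snd z $ k * (1/2 * pd_x k (pd_y a P) z)) - 1/2 * pd_x a P z"

definition spray :: "(real^'n) \<times> (real^'n) \<Rightarrow> real^'n" where
  "spray z = matrix_inv (fund_tensor A F c z) *v (\<chi> a. spray_low a z)"

lemma smooth_spray_low: "smooth_on (spray_low a) (slit_dom c)"
proof -
  have "smooth_on (\<lambda>z. (\<Sum>k\<in>UNIV. snd z $ k * (1/2 * pd_x k (pd_y a P) z)) - 1/2 * pd_x a P z) (slit_dom c)"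
    by (intro smooth_on_diff smooth_on_sum smooth_on_mult smooth_on_const smooth_on_fibre_coordinate
        open_slit_dom smooth_pd smooth_F_coord_sq)
  then show ?thesis unfolding spray_low_def[abs_def] .
qed

lemma smooth_spray: "smooth_on spray (slit_dom c)"
proof -
  have "smooth_on (\<lambda>z. matrix_inv (fund_tensor A F c z) *v (\<chi> a. spray_low a z)) (slit_dom c)"
    by (intro smooth_on_matrix_vector_mult smooth_on_matrix_inv smooth_on_vec_lambda
        smooth_fund_tensor smooth_spray_low open_slit_dom fund_tensor_invertible)
  then show ?thesis unfolding spray_def[abs_def] .
qed

lemma fund_tensor_cancel:
  assumes "z \<in> slit_dom c"
  shows "fund_tensor A F c z *v (matrix_inv (fund_tensor A F c z) *v v) = v"
    "matrix_inv (fund_tensor A F c z) *v (fund_tensor A F c z *v v) = v"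
  using matrix_inv_inverse[OF fund_tensor_invertible[OF assms]]
  by (simp_all add: matrix_vector_mul_assoc)

lemma fund_tensor_spray:
  assumes "z \<in> slit_dom c"
  shows "(\<Sum>i\<in>UNIV. g a i z * spray z $ i) = spray_low a z"
proof -
  have "(fund_tensor A F c z *v spray z) $ a = (\<chi> a. spray_low a z) $ a"
    unfolding spray_def fund_tensor_cancel(1)[OF assms] ..
  then show ?thesis by (simp add: matrix_vector_mult_def)
qed

context
  fixes z :: "(real^'n) \<times> (real^'n)"
  assumes z: "z \<in> slit_dom c"
begin

text \<open>The two kinds of terms in which all contractions with \<open>y\<close> are expressed: mixed derivatives of
  \<open>F\<^sup>2/2\<close>, and the derivative of \<open>g\<close> along the horizontal vector with components \<open>y\<close>.\<close>

private abbreviation (input) y where "y \<equiv> \<lambda>k. snd z $ k"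
private abbreviation (input) Q where "Q \<equiv> \<lambda>a j. 1/2 * pd_x a (pd_y j P) z"
private abbreviation (input) R where "R \<equiv> \<lambda>a j. \<Sum>k\<in>UNIV. pd_x k (g a j) z * y k"

definition low_christoffel :: "'n \<Rightarrow> 'n \<Rightarrow> 'n \<Rightarrow> real" where
  "low_christoffel a j k = 1/2 * (pd_x k (g a j) z - pd_x a (g j k) z + pd_x j (g a k) z)"

text \<open>The base derivatives of Euler's identities \<open>g\<^sub>a\<^sub>s y\<^sup>s = \<partial>\<^sub>a(F\<^sup>2/2)\<close> and \<open>y\<^sup>s \<partial>\<^sub>s F\<^sup>2 = 2F\<^sup>2\<close>.\<close>

lemma base_derivative_euler1: "(\<Sum>s\<in>UNIV. pd_x k (g a s) z * y s) = Q k a"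
proof -
  have "pd_x k (\<lambda>z. \<Sum>s\<in>UNIV. g a s z * snd z $ s) z = pd_x k (\<lambda>z. 1/2 * pd_y a P z) z"
    by (rule pd_cong(1)[OF _ fund_tensor_euler1 z])
      (intro smooth_on_sum smooth_on_mult smooth_g smooth_on_fibre_coordinate open_slit_dom)
  also have "\<dots> = 1/2 * pd_x k (pd_y a P) z"
    unfolding pd_x_def by (rule derivative_cmult[OF z smooth_pd(2)[OF smooth_F_coord_sq]])
  also have "pd_x k (\<lambda>z. \<Sum>s\<in>UNIV. g a s z * snd z $ s) z = (\<Sum>s\<in>UNIV. pd_x k (g a s) z * y s)"
    unfolding pd_x_def
    by (subst derivative_sum[OF z], intro smooth_on_mult smooth_g smooth_on_fibre_coordinate open_slit_dom)
      (simp add: derivative_mult[OF z smooth_g smooth_on_fibre_coordinate[OF open_slit_dom]] derivative_fibre_coordinate)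
  finally show ?thesis .
qed

lemma base_derivative_euler2: "(\<Sum>j\<in>UNIV. Q a j * y j) = pd_x a P z"
proof -
  have "pd_x a (\<lambda>z. \<Sum>s\<in>UNIV. snd z $ s * pd_y s P z) z = pd_x a (\<lambda>z. 2 * P z) z"
    by (rule pd_cong(1)[OF _ F_sq_euler z])
      (intro smooth_on_sum smooth_on_mult smooth_pd smooth_F_coord_sq smooth_on_fibre_coordinate open_slit_dom)
  also have "\<dots> = 2 * pd_x a P z"
    unfolding pd_x_def by (rule derivative_cmult[OF z smooth_F_coord_sq])
  also have "pd_x a (\<lambda>z. \<Sum>s\<in>UNIV. snd z $ s * pd_y s P z) z = (\<Sum>s\<in>UNIV. y s * pd_x a (pd_y s P) z)"
    unfolding pd_x_def
    by (subst derivative_sum[OF z], intro smooth_on_mult smooth_pd smooth_F_coord_sq smooth_on_fibre_coordinate open_slit_dom)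
      (simp add: derivative_mult[OF z smooth_on_fibre_coordinate[OF open_slit_dom] smooth_pd(2)[OF smooth_F_coord_sq]]
        derivative_fibre_coordinate)
  finally have e: "(\<Sum>s\<in>UNIV. y s * pd_x a (pd_y s P) z) = 2 * pd_x a P z" .
  have t: "Q a j * y j = 1/2 * (y j * pd_x a (pd_y j P) z)" for j by simp
  show ?thesis unfolding t sum_distrib_left[symmetric] e by simp
qed

lemma low_christoffel_contract:
  "(\<Sum>k\<in>UNIV. low_christoffel a j k * y k) = 1/2 * (R a j - Q a j + Q j a)"
proof -
  have "(\<Sum>k\<in>UNIV. low_christoffel a j k * y k) =
      1/2 * ((\<Sum>k\<in>UNIV. pd_x k (g a j) z * y k) - (\<Sum>k\<in>UNIV. pd_x a (g j k) z * y k)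
        + (\<Sum>k\<in>UNIV. pd_x j (g a k) z * y k))"
    unfolding sum_subtractf[symmetric] sum.distrib[symmetric] sum_distrib_left
    by (intro sum.cong refl) (simp add: low_christoffel_def algebra_simps)
  then show ?thesis unfolding base_derivative_euler1 .
qed

text \<open>Contracting twice leaves the Euler-Lagrange expression: of the three terms of the Christoffel
  symbol, the two symmetric ones agree after contraction and the third is \<open>\<partial>F\<^sup>2/\<partial>x\<^sup>a\<close>.\<close>

lemma low_christoffel_contract2:
  "(\<Sum>j\<in>UNIV. (\<Sum>k\<in>UNIV. low_christoffel a j k * y k) * y j) = spray_low a z"
proof -
  have "(\<Sum>j\<in>UNIV. R a j * y j) = (\<Sum>j\<in>UNIV. \<Sum>k\<in>UNIV. y k * (pd_x k (g a j) z * y j))"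
    unfolding sum_distrib_right by (intro sum.cong refl) (simp add: mult_ac)
  also have "\<dots> = (\<Sum>k\<in>UNIV. y k * (\<Sum>j\<in>UNIV. pd_x k (g a j) z * y j))"
    by (subst sum.swap) (simp add: sum_distrib_left)
  finally have R: "(\<Sum>j\<in>UNIV. R a j * y j) = (\<Sum>k\<in>UNIV. y k * Q k a)"
    unfolding base_derivative_euler1 .
  have "(\<Sum>j\<in>UNIV. (\<Sum>k\<in>UNIV. low_christoffel a j k * y k) * y j)
      = (\<Sum>j\<in>UNIV. 1/2 * (R a j * y j - Q a j * y j + y j * Q j a))"
    unfolding low_christoffel_contract by (intro sum.cong refl) (simp add: algebra_simps)
  also have "\<dots> = 1/2 * ((\<Sum>j\<in>UNIV. R a j * y j) - (\<Sum>j\<in>UNIV. Q a j * y j) + (\<Sum>j\<in>UNIV. y j * Q j a))"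
    unfolding sum_distrib_left[symmetric] sum.distrib sum_subtractf ..
  also have "\<dots> = spray_low a z"
    unfolding R base_derivative_euler2 spray_low_def by simp
  finally show ?thesis .
qed

lemma formal_christoffel_low:
  "formal_christoffel A F c z i j k =
    (\<Sum>s\<in>UNIV. matrix_inv (fund_tensor A F c z) $ i $ s * low_christoffel s j k)"
  unfolding formal_christoffel_def sum_distrib_left
  by (intro sum.cong refl) (simp add: low_christoffel_def)

lemma spray_christoffel:
  "(\<Sum>r\<in>UNIV. \<Sum>s\<in>UNIV. formal_christoffel A F c z k r s * y r * y s) = spray z $ k"
proof -
  let ?G = "matrix_inv (fund_tensor A F c z)"
  have "(\<Sum>r\<in>UNIV. \<Sum>s\<in>UNIV. formal_christoffel A F c z k r s * y r * y s)
      = (\<Sum>r\<in>UNIV. \<Sum>s\<in>UNIV. \<Sum>t\<in>UNIV. ?G $ k $ t * (low_christoffel t r s * y s * y r))"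
    unfolding formal_christoffel_low sum_distrib_right by (intro sum.cong refl) (simp add: mult_ac)
  also have "\<dots> = (\<Sum>r\<in>UNIV. \<Sum>t\<in>UNIV. \<Sum>s\<in>UNIV. ?G $ k $ t * (low_christoffel t r s * y s * y r))"
    by (rule sum.cong[OF refl]) (rule sum.swap)
  also have "\<dots> = (\<Sum>t\<in>UNIV. \<Sum>r\<in>UNIV. \<Sum>s\<in>UNIV. ?G $ k $ t * (low_christoffel t r s * y s * y r))"
    by (rule sum.swap)
  also have "\<dots> = (\<Sum>t\<in>UNIV. ?G $ k $ t * (\<Sum>r\<in>UNIV. (\<Sum>s\<in>UNIV. low_christoffel t r s * y s) * y r))"
    by (simp only: sum_distrib_left sum_distrib_right)
  also have "\<dots> = spray z $ k"
    unfolding low_christoffel_contract2 by (simp add: spray_def matrix_vector_mult_def)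
  finally show ?thesis .
qed

lemma nonlin_conn_low:
  "nonlin_conn A F c z $ i $ j =
    (\<Sum>s\<in>UNIV. matrix_inv (fund_tensor A F c z) $ i $ s *
       (1/2 * (R s j - Q s j + Q j s) - 1/2 * (\<Sum>k\<in>UNIV. pd_y k (g s j) z * spray z $ k)))"
proof -
  let ?G = "matrix_inv (fund_tensor A F c z)" and ?f = "F_coord A F c z"
  have f: "?f \<noteq> 0" using F_coord_pos[OF z] by simp
  have 1: "?f * (\<Sum>k\<in>UNIV. formal_christoffel A F c z i j k * (y k / ?f))
      = (\<Sum>s\<in>UNIV. ?G $ i $ s * (1/2 * (R s j - Q s j + Q j s)))"
  proof -
    have "?f * (\<Sum>k\<in>UNIV. formal_christoffel A F c z i j k * (y k / ?f))
      = (\<Sum>k\<in>UNIV. \<Sum>s\<in>UNIV. ?G $ i $ s * (low_christoffel s j k * y k))"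
      using f by (simp add: formal_christoffel_low sum_distrib_left sum_distrib_right mult_ac)
    also have "\<dots> = (\<Sum>s\<in>UNIV. ?G $ i $ s * (\<Sum>k\<in>UNIV. low_christoffel s j k * y k))"
      by (subst sum.swap) (simp only: sum_distrib_left)
    finally show ?thesis unfolding low_christoffel_contract .
  qed
  have 2: "?f * (\<Sum>k\<in>UNIV. \<Sum>r\<in>UNIV. \<Sum>s\<in>UNIV.
       cartan_up A F c z i j k * formal_christoffel A F c z k r s * (y r / ?f) * (y s / ?f))
      = (\<Sum>s\<in>UNIV. ?G $ i $ s * (1/2 * (\<Sum>k\<in>UNIV. pd_y k (g s j) z * spray z $ k)))"
  proof -
    have "?f * (\<Sum>k\<in>UNIV. \<Sum>r\<in>UNIV. \<Sum>s\<in>UNIV.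
       cartan_up A F c z i j k * formal_christoffel A F c z k r s * (y r / ?f) * (y s / ?f))
      = (\<Sum>k\<in>UNIV. (cartan_up A F c z i j k / ?f) *
          (\<Sum>r\<in>UNIV. \<Sum>s\<in>UNIV. formal_christoffel A F c z k r s * y r * y s))"
      using f by (simp add: sum_distrib_left field_simps)
    also have "\<dots> = (\<Sum>k\<in>UNIV. (\<Sum>s\<in>UNIV. ?G $ i $ s * (1/2 * pd_y k (g s j) z)) * spray z $ k)"
      unfolding spray_christoffel cartan_up_def cartan_low_def sum_divide_distrib
      using f by simp
    also have "\<dots> = (\<Sum>k\<in>UNIV. \<Sum>s\<in>UNIV. ?G $ i $ s * (1/2 * (pd_y k (g s j) z * spray z $ k)))"
      by (simp only: sum_distrib_right mult.assoc)
    also have "\<dots> = (\<Sum>s\<in>UNIV. ?G $ i $ s * (1/2 * (\<Sum>k\<in>UNIV. pd_y k (g s j) z * spray z $ k)))"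
      by (subst sum.swap) (simp only: sum_distrib_left)
    finally show ?thesis .
  qed
  have "nonlin_conn A F c z $ i $ j =
     ?f * (\<Sum>k\<in>UNIV. formal_christoffel A F c z i j k * (y k / ?f)) -
     ?f * (\<Sum>k\<in>UNIV. \<Sum>r\<in>UNIV. \<Sum>s\<in>UNIV.
       cartan_up A F c z i j k * formal_christoffel A F c z k r s * (y r / ?f) * (y s / ?f))"
    by (simp add: nonlin_conn_def Let_def right_diff_distrib)
  then show ?thesis unfolding 1 2 sum_subtractf[symmetric] right_diff_distrib[symmetric] .
qed

text \<open>Both sides are third vertical derivatives of \<open>F\<^sup>2/2\<close>.\<close>

lemma cartan_symmetric: "pd_y j (g s k) z = pd_y k (g s j) z"
proof -
  have half: "pd_y j (g s k) z = 1/2 * pd_y j (pd_y s (pd_y k P)) z" for j k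
    unfolding fund_tensor_entry unfolding pd_y_def[of j]
    by (rule derivative_cmult[OF z]) (intro smooth_pd smooth_F_coord_sq)
  have "pd_y j (pd_y s (pd_y k P)) z = pd_y s (pd_y j (pd_y k P)) z"
    by (rule pd_commute(2)[OF smooth_pd(2)[OF smooth_F_coord_sq] z])
  also have "\<dots> = pd_y s (pd_y k (pd_y j P)) z"
    by (rule pd_cong(2)[OF _ _ z]) (intro smooth_pd smooth_F_coord_sq, rule pd_commute(2)[OF smooth_F_coord_sq])
  also have "\<dots> = pd_y k (pd_y s (pd_y j P)) z"
    by (rule pd_commute(2)[OF smooth_pd(2)[OF smooth_F_coord_sq] z])
  finally show ?thesis by (simp add: half)
qed

text \<open>Differentiating the factor \<open>y\<^sup>k\<close> gives a mixed derivative of \<open>F\<^sup>2/2\<close>; in the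
  other terms the vertical derivative is moved inside the base derivatives of \<open>F\<^sup>2/2\<close> and of
  its vertical derivatives.\<close>

lemma vertical_derivative_spray_low:
  "pd_y j (spray_low a) z = R a j - Q a j + Q j a"
proof -
  have k: "pd_y j (\<lambda>z. snd z $ k * (1/2 * pd_x k (pd_y a P) z)) z =
      axis j 1 $ k * (1/2 * pd_x k (pd_y a P) z) + y k * pd_x k (g a j) z" for k
  proof -
    have sm: "smooth_on (\<lambda>z. 1/2 * pd_x k (pd_y a P) z) (slit_dom c)"
      by (intro smooth_on_mult smooth_on_const open_slit_dom smooth_pd smooth_F_coord_sq)
    have "pd_y j (\<lambda>z. 1/2 * pd_x k (pd_y a P) z) z = 1/2 * pd_y j (pd_x k (pd_y a P)) z"
      unfolding pd_y_def[of j] by (rule derivative_cmult[OF z]) (intro smooth_pd smooth_F_coord_sq)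
    also have "\<dots> = 1/2 * pd_x k (pd_y j (pd_y a P)) z"
      using pd_commute(1)[OF smooth_pd(2)[OF smooth_F_coord_sq] z] by simp
    also have "\<dots> = pd_x k (g j a) z"
      unfolding fund_tensor_entry unfolding pd_x_def[of k]
      by (rule derivative_cmult[OF z, symmetric]) (intro smooth_pd smooth_F_coord_sq)
    also have "\<dots> = pd_x k (g a j) z"
      by (rule pd_cong(1)[OF smooth_g fund_tensor_sym z])
    finally have "frechet_derivative (\<lambda>z. 1/2 * pd_x k (pd_y a P) z) (at z) (0, axis j 1) = pd_x k (g a j) z"
      unfolding pd_y_def .
    then show ?thesis
      unfolding pd_y_def[of j] derivative_mult[OF z smooth_on_fibre_coordinate[OF open_slit_dom] sm]
        derivative_fibre_coordinate by simp
  qed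
  have "pd_y j (spray_low a) z =
      pd_y j (\<lambda>z. \<Sum>k\<in>UNIV. snd z $ k * (1/2 * pd_x k (pd_y a P) z)) z - pd_y j (\<lambda>z. 1/2 * pd_x a P z) z"
    unfolding spray_low_def[abs_def] pd_y_def[of j]
    by (rule derivative_diff[OF z])
      (intro smooth_on_sum smooth_on_mult smooth_on_const smooth_on_fibre_coordinate
        open_slit_dom smooth_pd smooth_F_coord_sq)+
  also have "pd_y j (\<lambda>z. 1/2 * pd_x a P z) z = Q a j"
    using derivative_cmult[OF z smooth_pd(1)[OF smooth_F_coord_sq], of "1/2" a "(0, axis j 1)"]
      pd_commute(1)[OF smooth_F_coord_sq z, of a j] by (simp add: pd_y_def[of j])
  also have "pd_y j (\<lambda>z. \<Sum>k\<in>UNIV. snd z $ k * (1/2 * pd_x k (pd_y a P) z)) z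
      = (\<Sum>k\<in>UNIV. pd_y j (\<lambda>z. snd z $ k * (1/2 * pd_x k (pd_y a P) z)) z)"
    unfolding pd_y_def[of j]
    by (rule derivative_sum[OF z])
      (intro smooth_on_mult smooth_on_const smooth_on_fibre_coordinate open_slit_dom smooth_pd smooth_F_coord_sq)
  also have "\<dots> = Q j a + R a j"
    unfolding k sum.distrib by (simp add: axis_def if_distrib if_distribR mult_ac cong: if_cong)
  finally show ?thesis by simp
qed

text \<open>Differentiating \<open>g\<^sub>a\<^sub>i G\<^sup>i\<close> along the fibre and using the total symmetry of the Cartan tensor
  identifies the nonlinear connection with half the vertical derivative of the spray \<open>G\<close>.\<close>

lemma nonlin_conn_spray: "nonlin_conn A F c z $ i $ j = 1/2 * pd_y j (\<lambda>z. spray z $ i) z"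
proof -
  let ?G = "matrix_inv (fund_tensor A F c z)"
  let ?d = "\<lambda>i. pd_y j (\<lambda>z. spray z $ i) z"
  have smi: "smooth_on (\<lambda>z. spray z $ i) (slit_dom c)" for i
    by (rule smooth_on_nth[OF open_slit_dom smooth_spray])
  have "(\<Sum>i\<in>UNIV. g a i z * ?d i) = R a j - Q a j + Q j a - (\<Sum>k\<in>UNIV. pd_y k (g a j) z * spray z $ k)" for a
  proof -
    have "pd_y j (\<lambda>z. \<Sum>i\<in>UNIV. g a i z * spray z $ i) z = pd_y j (spray_low a) z"
      by (rule pd_cong(2)[OF _ fund_tensor_spray z])
        (intro smooth_on_sum smooth_on_mult smooth_g smi open_slit_dom)
    moreover have "pd_y j (\<lambda>z. \<Sum>i\<in>UNIV. g a i z * spray z $ i) z =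
       (\<Sum>i\<in>UNIV. pd_y j (g a i) z * spray z $ i + g a i z * ?d i)"
      unfolding pd_y_def
      by (subst derivative_sum[OF z], intro smooth_on_mult smooth_g smi open_slit_dom)
        (simp add: derivative_mult[OF z smooth_g smi])
    ultimately show ?thesis
      unfolding vertical_derivative_spray_low sum.distrib cartan_symmetric[of j] by linarith
  qed
  then have "fund_tensor A F c z *v (\<chi> i. ?d i) =
      (\<chi> a. R a j - Q a j + Q j a - (\<Sum>k\<in>UNIV. pd_y k (g a j) z * spray z $ k))"
    by (simp add: vec_eq_iff matrix_vector_mult_def)
  then have "(\<chi> i. ?d i) = ?G *v (\<chi> a. R a j - Q a j + Q j a - (\<Sum>k\<in>UNIV. pd_y k (g a j) z * spray z $ k))"
    using fund_tensor_cancel(2)[OF z] by metis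
  then have "?d i = (\<Sum>s\<in>UNIV. ?G $ i $ s * (R s j - Q s j + Q j s - (\<Sum>k\<in>UNIV. pd_y k (g s j) z * spray z $ k)))"
    by (simp add: vec_eq_iff matrix_vector_mult_def)
  then show ?thesis
    unfolding nonlin_conn_low sum_distrib_left by (simp add: algebra_simps sum_distrib_left)
qed

lemma nonlin_conn_derivative:
  "nonlin_conn A F c z *v b = (1/2) *\<^sub>R frechet_derivative spray (at z) (0, b)"
proof -
  have d: "(spray has_derivative frechet_derivative spray (at z)) (at z)"
    by (rule smooth_on_has_derivative[OF smooth_spray z])
  have comp: "frechet_derivative (\<lambda>z. spray z $ i) (at z) = (\<lambda>w. frechet_derivative spray (at z) w $ i)" for i
    by (rule frechet_derivative_eqI) (rule bounded_linear.has_derivative[OF bounded_linear_vec_nth d])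
  have "(nonlin_conn A F c z *v b) $ i = 1/2 * frechet_derivative spray (at z) (0, b) $ i" for i
  proof -
    have lin: "linear (\<lambda>w. frechet_derivative spray (at z) w $ i)"
      unfolding comp[symmetric]
      by (rule smooth_on_linear_derivative[OF smooth_on_nth[OF open_slit_dom smooth_spray] z])
    have "(nonlin_conn A F c z *v b) $ i = (\<Sum>j\<in>UNIV. 1/2 * (b $ j * frechet_derivative spray (at z) (0, axis j 1) $ i))"
      unfolding matrix_vector_mult_def by (simp add: nonlin_conn_spray pd_y_def comp mult_ac)
    also have "\<dots> = 1/2 * frechet_derivative spray (at z) (0, b) $ i"
      unfolding sum_distrib_left[symmetric] linear_on_vertical[OF lin, of b] ..
    finally show ?thesis .
  qed
  then show ?thesis by (simp add: vec_eq_iff)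
qed

text \<open>The Euler-Lagrange form of the definition of the spray, which has the same shape in all
  coordinates.\<close>

lemma spray_characterization:
  "D2 P z (0, a) (snd z, 0) - frechet_derivative P (at z) (a, 0) = D2 P z (0, a) (0, spray z)"
proof -
  have "D2 P z (0, a) (snd z, 0) = (\<Sum>i\<in>UNIV. a $ i * D2 P z (0, axis i 1) (snd z, 0))"
    by (rule linear_on_vertical[OF D2_linear_left[OF open_slit_dom smooth_F_coord_sq z]])
  also have "\<dots> = (\<Sum>i\<in>UNIV. a $ i * (\<Sum>k\<in>UNIV. y k * D2 P z (0, axis i 1) (axis k 1, 0)))"
    by (intro sum.cong refl arg_cong2[where f = "(*)"]
        linear_on_horizontal[OF D2_linear_right[OF smooth_F_coord_sq z]])
  finally have 1: "D2 P z (0, a) (snd z, 0) = (\<Sum>i\<in>UNIV. a $ i * (\<Sum>k\<in>UNIV. y k * pd_x k (pd_y i P) z))"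
    by (simp add: pd_as_derivative)
  have 2: "frechet_derivative P (at z) (a, 0) = (\<Sum>i\<in>UNIV. a $ i * pd_x i P z)"
    unfolding pd_x_def by (rule linear_on_horizontal[OF smooth_on_linear_derivative[OF smooth_F_coord_sq z]])
  have "(fund_tensor A F c z *v spray z) $ i = spray_low i z" for i
    using fund_tensor_spray[OF z] by (simp add: matrix_vector_mult_def)
  then have "D2 P z (0, a) (0, spray z) = 2 * (\<Sum>i\<in>UNIV. a $ i * spray_low i z)"
    unfolding fund_tensor_second_derivative[OF z] by (simp add: inner_vec_def)
  also have "\<dots> = (\<Sum>i\<in>UNIV. a $ i * ((\<Sum>k\<in>UNIV. y k * pd_x k (pd_y i P) z) - pd_x i P z))"
    unfolding sum_distrib_left
  proof (intro sum.cong refl)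
    fix i
    have t: "y k * (1/2 * pd_x k (pd_y i P) z) = 1/2 * (y k * pd_x k (pd_y i P) z)" for k by simp
    show "2 * (a $ i * spray_low i z) = a $ i * ((\<Sum>k\<in>UNIV. y k * pd_x k (pd_y i P) z) - pd_x i P z)"
      unfolding spray_low_def t sum_distrib_left[symmetric] by (simp add: algebra_simps)
  qed
  finally show ?thesis unfolding 1 2 by (simp add: right_diff_distrib sum_subtractf)
qed

end

end

end

subsection \<open>Coordinate changes\<close>

context
  fixes M :: "'p set" and A :: "('p, real^'n::finite) chart set" and F :: "('p, 'n) tpoint \<Rightarrow> real"
    and c d :: "('p, real^'n) chart"
  assumes finsler: "finsler_space M A F" and c: "c \<in> A" and d: "d \<in> A"
begin

private abbreviation (input) U where "U \<equiv> snd c ` (fst c \<inter> fst d)"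
private abbreviation (input) T where "T \<equiv> transition c d"
private abbreviation (input) T' where "T' \<equiv> \<lambda>x. frechet_derivative (transition c d) (at x)"
private abbreviation (input) Pc where "Pc \<equiv> \<lambda>z. (F_coord A F c z)\<^sup>2"
private abbreviation (input) Pd where "Pd \<equiv> \<lambda>z. (F_coord A F d z)\<^sup>2"

lemma open_chart_overlap: "open U"
  by (rule open_overlap[OF finsler_atlas[OF finsler] c d])

lemma smooth_chart_change: "smooth_on T U"
  by (rule smooth_transition[OF finsler_atlas[OF finsler] c d])

lemma open_slit_overlap: "open (U \<times> (- {0::real^'n}))"
  by (rule open_slit_image[OF finsler_atlas[OF finsler] c d])

context
  fixes x :: "real^'n"
  assumes x: "x \<in> U"
begin

lemma overlap_point:
  shows "chart_inv c x \<in> fst c" "chart_inv c x \<in> fst d" "snd c (chart_inv c x) = x"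
    and "c \<in> charts_at A (chart_inv c x)" "d \<in> charts_at A (chart_inv c x)"
    and "T x = snd d (chart_inv c x)" "chart_inv d (T x) = chart_inv c x" "T x \<in> snd d ` fst d"
proof -
  have x': "x \<in> snd c ` fst c" and pd: "chart_inv c x \<in> fst d"
    using x chart_image_iff[OF finsler_atlas[OF finsler] c, of x "fst d"] by blast+
  show 1: "chart_inv c x \<in> fst c" "chart_inv c x \<in> fst d" "snd c (chart_inv c x) = x"
    by (rule chart_inv_in[OF finsler_atlas[OF finsler] x'], rule pd,
        rule chart_chart_inv[OF finsler_atlas[OF finsler] x'])
  then show "c \<in> charts_at A (chart_inv c x)" "d \<in> charts_at A (chart_inv c x)"
    using c d by (auto simp: charts_at_def)
  show 2: "T x = snd d (chart_inv c x)" by (simp add: transition_def)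
  show "chart_inv d (T x) = chart_inv c x"
    unfolding 2 by (rule chart_inv_chart[OF finsler_atlas[OF finsler] d 1(2)])
  show "T x \<in> snd d ` fst d" unfolding 2 using 1(2) by blast
qed

lemma chart_change_jac: "T' x = jac c d (chart_inv c x)"
  by (simp add: overlap_point)

lemma linear_chart_change: "linear (T' x)"
  unfolding chart_change_jac by (rule linear_jac[OF finsler_atlas[OF finsler] overlap_point(4,5)])

lemma chart_change_inverse: "T' x (jac d c (chart_inv c x) v) = v" "jac d c (chart_inv c x) (T' x v) = v"
  unfolding chart_change_jac using jac_compose[OF finsler_atlas[OF finsler]] jac_self[OF finsler_atlas[OF finsler]] overlap_point(4,5)
  by metis+

lemma chart_change_nonzero: "v \<noteq> 0 \<Longrightarrow> T' x v \<noteq> 0"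
  using chart_change_inverse(2)[of v] linear_0[OF linear_jac[OF finsler_atlas[OF finsler] overlap_point(5,4)]] by metis

lemma F_coord_transition:
  "F_coord A F c (x, y) = F_coord A F d (tangent_map T (x, y))"
proof -
  let ?p = "chart_inv c x"
  have x': "x \<in> snd c ` fst c" using x by blast
  have "tvec_of A d ?p (T' x y) = tvec_of A c ?p y"
  proof -
    have v: "tvec_of A c ?p y \<in> tangent_space A ?p" by (rule tvec_of_in[OF finsler_atlas[OF finsler] overlap_point(4)])
    have "tvec_of A c ?p y d = T' x y"
      using overlap_point(5) by (simp add: tvec_of_def[OF finsler_atlas[OF finsler]] chart_change_jac)
    then show ?thesis using tvec_of_component[OF finsler_atlas[OF finsler] v overlap_point(5)] by simp
  qed
  then show ?thesis
    unfolding tangent_map_def fst_conv snd_conv F_coord_eq[OF finsler c x']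
      F_coord_eq[OF finsler d overlap_point(8)] overlap_point(7) by simp
qed

end

lemma tangent_map_in:
  assumes "z \<in> U \<times> (- {0})"
  shows "tangent_map T z \<in> snd d ` fst d \<times> (- {0})" and "z \<in> snd c ` fst c \<times> (- {0})"
proof -
  obtain x y where z: "z = (x, y)" "x \<in> U" "y \<noteq> 0" using assms by auto
  show "tangent_map T z \<in> snd d ` fst d \<times> (- {0})"
    using chart_change_nonzero[OF z(2,3)] overlap_point(8)[OF z(2)] by (simp add: tangent_map_def z(1))
  show "z \<in> snd c ` fst c \<times> (- {0})" using assms by auto
qed

context
  fixes x y :: "real^'n"
  assumes x: "x \<in> U" and y: "y \<noteq> 0"
begin

lemma overlap_point_in: "(x, y) \<in> U \<times> (- {0})"
  using x y by simp

lemma overlap_source: "(x, y) \<in> slit_dom c" and overlap_target: "tangent_map T (x, y) \<in> slit_dom d"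
  using tangent_map_in[OF overlap_point_in] by blast+

private abbreviation (input) B where "B \<equiv> D2 T x"
private abbreviation (input) d\<Theta> where "d\<Theta> \<equiv> \<lambda>w. (T' x (fst w), B y (fst w) + T' x (snd w))"

lemma overlap_derivative: "(tangent_map T has_derivative d\<Theta>) (at (x, y))"
  by (rule tangent_map_has_derivative[OF open_chart_overlap smooth_chart_change x])

lemma chart_change_D2_commute: "B u v = B v u"
  by (rule D2_commute[OF open_chart_overlap smooth_chart_change x])

lemma chart_change_D2_linear: "linear (B u)"
  by (rule D2_linear_right[OF smooth_chart_change x])

lemma first_derivative_transition:
  "frechet_derivative Pc (at (x, y)) w = frechet_derivative Pd (at (tangent_map T (x, y))) (d\<Theta> w)"
proof -
  have "((\<lambda>z. Pd (tangent_map T z)) has_derivative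
      (\<lambda>w. frechet_derivative Pd (at (tangent_map T (x, y))) (d\<Theta> w))) (at (x, y))"
    by (rule has_derivative_compose[OF overlap_derivative smooth_on_has_derivative[OF smooth_F_coord_sq[OF finsler d] overlap_target]])
  then have "(Pc has_derivative
      (\<lambda>w. frechet_derivative Pd (at (tangent_map T (x, y))) (d\<Theta> w))) (at (x, y))"
    by (rule has_derivative_transform_within_open[OF _ open_slit_overlap overlap_point_in])
      (use F_coord_transition in auto)
  from frechet_derivative_eqI[OF this] show ?thesis by simp
qed

end

context
  fixes x y :: "real^'n"
  assumes x: "x \<in> U" and y: "y \<noteq> 0"
begin

text \<open>The second term appears because the vertical direction \<open>T'(x) a\<close> depends on the base
  point.\<close>

lemma second_derivative_transition:
  "D2 Pc (x, y) (0, a) w = D2 Pd (tangent_map T (x, y)) (0, T' x a) (T' x (fst w), D2 T x y (fst w) + T' x (snd w))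
    + frechet_derivative Pd (at (tangent_map T (x, y))) (0, D2 T x a (fst w))"
proof -
  have fstd: "(fst has_derivative fst) (at (x, y))"
    by (rule bounded_linear_imp_has_derivative[OF bounded_linear_fst])
  have "((\<lambda>z. T' z a) has_derivative D2 T x a) (at (fst (x, y)))"
    using smooth_on_has_derivative[OF smooth_on_derivative[OF smooth_chart_change] x] by simp
  from has_derivative_compose[OF fstd this]
  have "((\<lambda>z. (0, T' (fst z) a)) has_derivative (\<lambda>w. (0::real^'n, D2 T x a (fst w)))) (at (x, y))"
    by (intro has_derivative_Pair has_derivative_const)
  from has_derivative_derivative_apply[OF open_slit_dom[OF finsler d] smooth_F_coord_sq[OF finsler d] overlap_target[OF x y] overlap_derivative[OF x y] this]
  have *: "((\<lambda>z. frechet_derivative Pd (at (tangent_map T z)) (0, T' (fst z) a)) has_derivative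
      (\<lambda>w. D2 Pd (tangent_map T (x, y)) (0, T' x a) (T' x (fst w), D2 T x y (fst w) + T' x (snd w))
    + frechet_derivative Pd (at (tangent_map T (x, y))) (0, D2 T x a (fst w)))) (at (x, y))" by simp
  have eq: "frechet_derivative Pd (at (tangent_map T z)) (0, T' (fst z) a) = frechet_derivative Pc (at z) (0, a)"
    if overlap_point_in: "z \<in> U \<times> (- {0})" for z
  proof -
    obtain x y where z: "z = (x, y)" "x \<in> U" "y \<noteq> 0" using overlap_point_in by auto
    show ?thesis
      using first_derivative_transition[OF z(2,3), of "(0, a)"] linear_0[OF chart_change_D2_linear[OF z(2,3)]] linear_0[OF linear_chart_change[OF z(2)]]
      by (simp add: z(1))
  qed
  from has_derivative_transform_within_open[OF * open_slit_overlap overlap_point_in[OF x y] eq]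
  have "((\<lambda>z. frechet_derivative Pc (at z) (0, a)) has_derivative
      (\<lambda>w. D2 Pd (tangent_map T (x, y)) (0, T' x a) (T' x (fst w), D2 T x y (fst w) + T' x (snd w))
    + frechet_derivative Pd (at (tangent_map T (x, y))) (0, D2 T x a (fst w)))) (at (x, y))" by simp
  from frechet_derivative_eqI[OF this] show ?thesis by simp
qed

lemma fund_tensor_transition:
  "a \<bullet> (fund_tensor A F c (x, y) *v b) = T' x a \<bullet> (fund_tensor A F d (tangent_map T (x, y)) *v T' x b)"
proof -
  have "2 * (a \<bullet> (fund_tensor A F c (x, y) *v b)) = D2 Pc (x, y) (0, a) (0, b)"
    by (rule fund_tensor_second_derivative[OF finsler c overlap_source[OF x y], symmetric])
  also have "\<dots> = D2 Pd (tangent_map T (x, y)) (0, T' x a) (0, T' x b)"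
    using second_derivative_transition[of a "(0, b)"] linear_0[OF chart_change_D2_linear[OF x y]] linear_0[OF linear_chart_change[OF x]]
      linear_0[OF smooth_on_linear_derivative[OF smooth_F_coord_sq[OF finsler d] overlap_target[OF x y]]]
    by (simp add: zero_prod_def)
  also have "\<dots> = 2 * (T' x a \<bullet> (fund_tensor A F d (tangent_map T (x, y)) *v T' x b))"
    by (rule fund_tensor_second_derivative[OF finsler d overlap_target[OF x y]])
  finally show ?thesis by simp
qed

text \<open>The image of the spray \<open>(y, -G)\<close> under the coordinate change satisfies the characterizing
  equation in the new coordinates, and that equation has only one solution.\<close>

lemma spray_transition:
  "spray A F d (tangent_map T (x, y)) = T' x (spray A F c (x, y)) - D2 T x y y"
proof -
  let ?z = "(x, y)" and ?w = "tangent_map T (x, y)"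
  let ?G = "spray A F c (x, y)" and ?G' = "T' x (spray A F c (x, y)) - D2 T x y y"
  have linc: "linear (D2 Pc ?z u)" for u
    by (rule D2_linear_right[OF smooth_F_coord_sq[OF finsler c] overlap_source[OF x y]])
  have lind: "linear (D2 Pd ?w u)" for u
    by (rule D2_linear_right[OF smooth_F_coord_sq[OF finsler d] overlap_target[OF x y]])
  have lind1: "linear (frechet_derivative Pd (at ?w))"
    by (rule smooth_on_linear_derivative[OF smooth_F_coord_sq[OF finsler d] overlap_target[OF x y]])
  have sndw: "snd ?w = T' x y" by (simp add: tangent_map_def)
  have main: "D2 Pd ?w (0, T' x a) (0, ?G') = D2 Pd ?w (0, T' x a) (0, spray A F d ?w)" for a
  proof -
    have "D2 Pc ?z (0, a) (y, - ?G) = D2 Pc ?z (0, a) (y, 0) - D2 Pc ?z (0, a) (0, ?G)"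
      using linear_diff[OF linc, of "(0, a)" "(y, 0)" "(0, ?G)"] by simp
    also have "\<dots> = frechet_derivative Pc (at ?z) (a, 0)"
      using spray_characterization[OF finsler c overlap_source[OF x y], of a] by simp
    also have "\<dots> = frechet_derivative Pd (at ?w) (T' x a, 0) + frechet_derivative Pd (at ?w) (0, D2 T x a y)"
      using first_derivative_transition[OF x y, of "(a, 0)"] linear_0[OF linear_chart_change[OF x]]
        linear_add[OF lind1, of "(T' x a, 0)" "(0, D2 T x a y)"] chart_change_D2_commute[OF x y, of a y] by simp
    finally have 1: "D2 Pc ?z (0, a) (y, - ?G)
      = frechet_derivative Pd (at ?w) (T' x a, 0) + frechet_derivative Pd (at ?w) (0, D2 T x a y)" .
    have "D2 Pc ?z (0, a) (y, - ?G) = D2 Pd ?w (0, T' x a) (T' x y, - ?G') + frechet_derivative Pd (at ?w) (0, D2 T x a y)"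
      using second_derivative_transition[of a "(y, - ?G)"] linear_neg[OF linear_chart_change[OF x]] by simp
    with 1 have "D2 Pd ?w (0, T' x a) (T' x y, - ?G') = frechet_derivative Pd (at ?w) (T' x a, 0)" by simp
    moreover have "D2 Pd ?w (0, T' x a) (T' x y, - ?G') = D2 Pd ?w (0, T' x a) (T' x y, 0) - D2 Pd ?w (0, T' x a) (0, ?G')"
      using linear_diff[OF lind, of "(0, T' x a)" "(T' x y, 0)" "(0, ?G')"] by simp
    ultimately show ?thesis
      using spray_characterization[OF finsler d overlap_target[OF x y], of "T' x a"] unfolding sndw by simp
  qed
  have "D2 Pd ?w (0, a) (0, ?G' - spray A F d ?w) = 0" for a
    using main[of "jac d c (chart_inv c x) a"] chart_change_inverse(1)[OF x]
      linear_diff[OF lind, of "(0, a)" "(0, ?G')" "(0, spray A F d ?w)"] by simp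
  then have "(?G' - spray A F d ?w) \<bullet> (fund_tensor A F d ?w *v (?G' - spray A F d ?w)) = 0"
    using fund_tensor_second_derivative[OF finsler d overlap_target[OF x y]] by simp
  then have "?G' - spray A F d ?w = 0"
    using fund_tensor_pos[OF finsler d overlap_target[OF x y]] by (metis less_irrefl)
  then show ?thesis by simp
qed

end

context
  fixes x y :: "real^'n"
  assumes x: "x \<in> U" and y: "y \<noteq> 0"
begin

text \<open>Half the vertical derivative of the transformation law of the spray.\<close>

lemma nonlin_conn_transition:
  "nonlin_conn A F d (tangent_map T (x, y)) *v T' x b = T' x (nonlin_conn A F c (x, y) *v b) - D2 T x y b"
proof -
  have inj: "((\<lambda>y. (x, y)) has_derivative (\<lambda>b. (0, b))) (at y)"
    by (auto intro!: derivative_eq_intros)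
  have inj': "((\<lambda>y. tangent_map T (x, y)) has_derivative (\<lambda>b. (0, T' x b))) (at y)"
    using has_derivative_compose[OF inj overlap_derivative[OF x y]] linear_0[OF linear_chart_change[OF x]] linear_0[OF chart_change_D2_linear[OF x y]] by simp
  have lhs: "((\<lambda>y. spray A F d (tangent_map T (x, y))) has_derivative
      (\<lambda>b. frechet_derivative (spray A F d) (at (tangent_map T (x, y))) (0, T' x b))) (at y)"
    by (rule has_derivative_compose[OF inj' smooth_on_has_derivative[OF smooth_spray[OF finsler d] overlap_target[OF x y]]])
  have Gd: "((\<lambda>y. spray A F c (x, y)) has_derivative (\<lambda>b. frechet_derivative (spray A F c) (at (x, y)) (0, b))) (at y)"
    by (rule has_derivative_compose[OF inj smooth_on_has_derivative[OF smooth_spray[OF finsler c] overlap_source[OF x y]]])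
  have T'd: "((\<lambda>y. T' x (spray A F c (x, y))) has_derivative
      (\<lambda>b. T' x (frechet_derivative (spray A F c) (at (x, y)) (0, b)))) (at y)"
    using has_derivative_compose[OF Gd linear_imp_has_derivative[OF linear_chart_change[OF x]]] .
  have bil: "bounded_bilinear (D2 T x)"
    unfolding bilinear_conv_bounded_bilinear[symmetric] bilinear_def
    using D2_linear_left[OF open_chart_overlap smooth_chart_change x] D2_linear_right[OF smooth_chart_change x] by blast
  have Bd: "((\<lambda>y. D2 T x y y) has_derivative (\<lambda>b. D2 T x y b + D2 T x b y)) (at y)"
    using bounded_bilinear.FDERIV[OF bil has_derivative_ident has_derivative_ident] .
  have rhs: "((\<lambda>y. spray A F d (tangent_map T (x, y))) has_derivative
      (\<lambda>b. T' x (frechet_derivative (spray A F c) (at (x, y)) (0, b)) - (D2 T x y b + D2 T x b y))) (at y)"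
    by (rule has_derivative_transform_within_open[OF has_derivative_diff[OF T'd Bd], of "- {0}"])
      (use y spray_transition[OF x] in auto)
  have "frechet_derivative (spray A F d) (at (tangent_map T (x, y))) (0, T' x b)
      = T' x (frechet_derivative (spray A F c) (at (x, y)) (0, b)) - (D2 T x y b + D2 T x b y)"
    using has_derivative_unique[OF lhs rhs] by meson
  then have "(1/2) *\<^sub>R frechet_derivative (spray A F d) (at (tangent_map T (x, y))) (0, T' x b)
      = (1/2) *\<^sub>R T' x (frechet_derivative (spray A F c) (at (x, y)) (0, b)) - D2 T x y b"
    unfolding chart_change_D2_commute[OF x y, of b y] by (simp add: scaleR_diff_right scaleR_add_right flip: scaleR_add_left)
  then show ?thesis
    unfolding nonlin_conn_derivative[OF finsler d overlap_target[OF x y]] nonlin_conn_derivative[OF finsler c overlap_source[OF x y]]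
    by (simp add: linear_scale[OF linear_chart_change[OF x]])
qed

end

end

subsection \<open>Horizontal vector fields\<close>

context
  fixes M :: "'p set" and A :: "('p, real^'n::finite) chart set" and F :: "('p, 'n) tpoint \<Rightarrow> real"
  assumes finsler: "finsler_space M A F"
begin

lemma smooth_nonlin_conn_mult:
  assumes "c \<in> A" "open S" "smooth_on \<phi> S" "\<phi> ` S \<subseteq> slit_dom c" "smooth_on v S"
  shows "smooth_on (\<lambda>z. nonlin_conn A F c (\<phi> z) *v v z) S"
proof (rule smooth_on_cong)
  show "smooth_on (\<lambda>z. (1/2) *\<^sub>R frechet_derivative (spray A F c) (at (\<phi> z)) (0, v z)) S"
    by (intro smooth_on_scaleR smooth_on_const assms(2)
        smooth_on_derivative_apply[OF assms(2) open_slit_dom[OF finsler assms(1)] smooth_spray[OF finsler assms(1)] assms(3,4)]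
        smooth_on_Pair assms(5))
  fix z assume "z \<in> S"
  then have "\<phi> z \<in> slit_dom c" using assms(4) by blast
  then show "(1/2) *\<^sub>R frechet_derivative (spray A F c) (at (\<phi> z)) (0, v z) = nonlin_conn A F c (\<phi> z) *v v z"
    by (rule nonlin_conn_derivative[OF finsler assms(1), symmetric])
qed (rule assms(2))

text \<open>The components that define the lift transform as a tangent vector of the slit bundle: this is
  exactly the transformation law of the nonlinear connection. A tangent vector is determined by its
  components, so the definite description is meaningful.\<close>

lemma horizontal_lift_props:
  assumes u: "u \<in> slit_bundle M A" and X: "X \<in> tangent_space A (fst u)"
  shows "horizontal_lift A F u X \<in> tangent_space (slit_atlas A) u"
    and "\<And>c. c \<in> charts_at A (fst u) \<Longrightarrow> horizontal_lift A F u X (slit_chart A c) =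
      (X c, - (nonlin_conn A F c (snd c (fst u), snd u c) *v X c))"
proof -

  let ?H = "\<lambda>c. (X c, - (nonlin_conn A F c (snd (nat_chart A c) u) *v X c))"
  let ?P = "\<lambda>\<xi>. \<xi> \<in> tangent_space (slit_atlas A) u \<and> (\<forall>c\<in>charts_at A (fst u). \<xi> (slit_chart A c) = ?H c)"
  define \<xi> where "\<xi> e = (if e \<in> slit_chart A ` charts_at A (fst u) then ?H (inv (slit_chart A) e) else 0)" for e
  have inj: "inj (slit_chart A)" by (rule injI) (simp add: slit_chart_inject)
  have \<xi>c: "\<xi> (slit_chart A c) = ?H c" if "c \<in> charts_at A (fst u)" for c
    using that inj by (simp add: \<xi>_def)
  have "\<xi> \<in> tangent_space (slit_atlas A) u"
  proof (rule tangent_spaceI[OF slit_smooth_atlas[OF finsler_atlas[OF finsler]]])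
    fix e assume "e \<notin> charts_at (slit_atlas A) u"
    then show "\<xi> e = 0" unfolding slit_charts_at[OF finsler_atlas[OF finsler] u] by (simp add: \<xi>_def)
  next
    fix e e' assume "e \<in> charts_at (slit_atlas A) u" "e' \<in> charts_at (slit_atlas A) u"
    then obtain c d where e: "e = slit_chart A c" "e' = slit_chart A d"
      and cd: "c \<in> charts_at A (fst u)" "d \<in> charts_at A (fst u)"
      unfolding slit_charts_at[OF finsler_atlas[OF finsler] u] by blast
    then have mem: "c \<in> A" "d \<in> A" "fst u \<in> fst c" "fst u \<in> fst d" by (auto simp: charts_at_def)
    let ?x = "snd c (fst u)" and ?y = "snd u c"
    have v: "snd u \<in> tangent_space A (fst u)" using u by (simp add: slit_bundle_iff[OF finsler_atlas[OF finsler]])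
    have x: "?x \<in> snd c ` (fst c \<inter> fst d)" using mem by blast
    have y: "?y \<noteq> 0" using slit_coordinates[OF finsler_atlas[OF finsler] u cd(1)] by (simp add: snd_slit_chart)
    have Xd: "X d = jac c d (fst u) (X c)" by (rule tangent_change[OF finsler_atlas[OF finsler] X cd])
    have vd: "snd u d = jac c d (fst u) ?y" by (rule tangent_change[OF finsler_atlas[OF finsler] v cd])
    have tm: "tangent_map (transition c d) (?x, ?y) = (snd d (fst u), snd u d)"
      unfolding tangent_map_def fst_conv snd_conv vd transition_chart[OF finsler_atlas[OF finsler] mem(1,3)] ..
    have lin: "linear (jac c d (fst u))" by (rule linear_jac[OF finsler_atlas[OF finsler] cd])
    show "\<xi> e' = jac e e' u (\<xi> e)"
      unfolding e \<xi>c[OF cd(1)] \<xi>c[OF cd(2)] slit_jac[OF finsler_atlas[OF finsler] u cd] snd_nat_chart fst_conv snd_conv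
      using nonlin_conn_transition[OF finsler mem(1,2) x y, of "X c"]
      unfolding tm Xd[symmetric] by (simp add: linear_neg[OF lin])
  qed
  then have P: "?P \<xi>" using \<xi>c by blast
  moreover have "\<xi>' = \<xi>" if "?P \<xi>'" for \<xi>'
  proof -
    obtain c where cc: "c \<in> charts_at A (fst u)"
      using charts_at_nonempty[OF finsler_atlas[OF finsler]] u slit_bundle_iff[OF finsler_atlas[OF finsler]] by blast
    then have "slit_chart A c \<in> charts_at (slit_atlas A) u"
      unfolding slit_charts_at[OF finsler_atlas[OF finsler] u] by blast
    then show ?thesis
      using tangent_eqI[OF slit_smooth_atlas[OF finsler_atlas[OF finsler]]] that P cc by metis
  qed
  ultimately have "?P (horizontal_lift A F u X)"
    unfolding horizontal_lift_def by (rule theI)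
  then show "horizontal_lift A F u X \<in> tangent_space (slit_atlas A) u"
    and "\<And>c. c \<in> charts_at A (fst u) \<Longrightarrow> horizontal_lift A F u X (slit_chart A c) =
      (X c, - (nonlin_conn A F c (snd c (fst u), snd u c) *v X c))"
    by (auto simp: snd_nat_chart)
qed

definition horizontal_field ::
    "('p \<Rightarrow> ('p, real^'n) tvec) \<Rightarrow> ('p, 'n) tpoint \<Rightarrow> (('p, 'n) tpoint, (real^'n) \<times> (real^'n)) tvec" where
  "horizontal_field X u = (if u \<in> slit_bundle M A then horizontal_lift A F u (X (fst u)) else (\<lambda>_. 0))"

lemma horizontal_field_vector_field:
  assumes X: "X \<in> vector_fields M A"
  shows "horizontal_field X \<in> vector_fields (slit_bundle M A) (slit_atlas A)"
proof (rule vector_fieldsI[OF slit_smooth_atlas[OF finsler_atlas[OF finsler]]])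
  fix u assume u: "u \<in> slit_bundle M A"
  then have "X (fst u) \<in> tangent_space A (fst u)"
    using vector_fields_tangent[OF finsler_atlas[OF finsler] X] by (simp add: slit_bundle_iff[OF finsler_atlas[OF finsler]])
  then show "horizontal_field X u \<in> tangent_space (slit_atlas A) u"
    using horizontal_lift_props(1)[OF u] u by (simp add: horizontal_field_def)
next
  fix u assume "u \<notin> slit_bundle M A"
  then show "horizontal_field X u = (\<lambda>_. 0)" by (simp add: horizontal_field_def)
next
  fix c' d' assume "c' \<in> slit_atlas A" "d' \<in> slit_atlas A"
  then obtain c d where cd: "c' = slit_chart A c" "d' = slit_chart A d" and c: "c \<in> A" and d: "d \<in> A"
    by (auto simp: slit_atlas_def)
  let ?U = "snd c ` (fst c \<inter> fst d)"
  let ?S = "?U \<times> (- {0::real^'n})"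
  have op: "open ?S" by (rule open_slit_overlap[OF finsler c d])
  have X': "smooth_on (\<lambda>z. X (chart_inv c (fst z)) d) ?S"
    by (rule smooth_on_fst_compose[OF finsler_atlas[OF finsler] open_chart_overlap[OF finsler c d]
      vector_fields_smooth[OF finsler_atlas[OF finsler] X c d]])
  have tm: "smooth_on (tangent_map (transition c d)) ?S"
    by (rule smooth_on_subset[OF smooth_on_tangent_map[OF open_chart_overlap[OF finsler c d] smooth_chart_change[OF finsler c d]]]) auto
  have sub: "tangent_map (transition c d) ` ?S \<subseteq> slit_dom d"
    using tangent_map_in(1)[OF finsler c d] by blast
  have "smooth_on (\<lambda>z. (X (chart_inv c (fst z)) d,
      - (nonlin_conn A F d (tangent_map (transition c d) z) *v X (chart_inv c (fst z)) d))) ?S"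
    by (intro smooth_on_Pair smooth_on_minus smooth_nonlin_conn_mult[OF d op tm sub] X' op)
  then show "smooth_on (\<lambda>z. horizontal_field X (chart_inv c' z) d') (snd c' ` (fst c' \<inter> fst d'))"
    unfolding cd slit_image_overlap[OF finsler_atlas[OF finsler] c]
  proof (rule smooth_on_cong[OF _ op])
    fix z :: "(real^'n) \<times> (real^'n)" assume "z \<in> ?S"
    then obtain x y where z: "z = (x, y)" and x: "x \<in> ?U" and y: "y \<noteq> 0" by auto
    let ?p = "chart_inv c x"
    note ov = overlap_point[OF finsler c d x]
    have x': "x \<in> snd c ` fst c" using x by blast
    have u: "(?p, tvec_of A c ?p y) \<in> slit_bundle M A" by (rule coordinates_in_slit_bundle[OF finsler c x' y])
    have Xp: "X ?p \<in> tangent_space A ?p"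
      using vector_fields_tangent[OF finsler_atlas[OF finsler] X] u by (simp add: slit_bundle_iff[OF finsler_atlas[OF finsler]])
    have tm: "tangent_map (transition c d) (x, y) = (snd d ?p, tvec_of A c ?p y d)"
      using ov by (simp add: tangent_map_def tvec_of_def[OF finsler_atlas[OF finsler]])
    show "(X (chart_inv c (fst z)) d,
      - (nonlin_conn A F d (tangent_map (transition c d) z) *v X (chart_inv c (fst z)) d)) =
        horizontal_field X (chart_inv (slit_chart A c) z) (slit_chart A d)"
      unfolding z slit_chart_inv(1)[OF finsler_atlas[OF finsler] c x' y] horizontal_field_def
      using horizontal_lift_props(2)[OF u, of "X ?p" d] u Xp ov(5) by (simp add: tm)
  qed
qed

end

section \<open>Integration in polar coordinates\<close>

subsection \<open>Change of variables for an arbitrary finite index type\<close>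

text \<open>A copy of an arbitrary finite type that inherits the order of the natural numbers. The change of
  variables formula for well-ordered index types is transported along a bijection with this copy.\<close>

typedef ('n::finite) ordered_index = "{..<CARD('n)}"
  by (rule exI[of _ 0]) (simp add: card_gt_0_iff)

instance ordered_index :: (finite) finite
proof
  have "(UNIV :: 'a ordered_index set) = Abs_ordered_index ` {..<CARD('a)}"
    using type_definition.Abs_image[OF type_definition_ordered_index] by metis
  then show "finite (UNIV :: 'a ordered_index set)" by (metis finite_imageI finite_lessThan)
qed

instantiation ordered_index :: (finite) wellorder
begin

definition less_eq_ordered_index :: "'a ordered_index \<Rightarrow> 'a ordered_index \<Rightarrow> bool" where
  "i \<le> j \<longleftrightarrow> Rep_ordered_index i \<le> Rep_ordered_index j"

definition less_ordered_index :: "'a ordered_index \<Rightarrow> 'a ordered_index \<Rightarrow> bool" where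
  "i < j \<longleftrightarrow> Rep_ordered_index i < Rep_ordered_index j"

instance
proof
  fix P :: "'a ordered_index \<Rightarrow> bool" and a
  assume step: "\<And>x. (\<And>y. y < x \<Longrightarrow> P y) \<Longrightarrow> P x"
  show "P a"
  proof (induction a rule: measure_induct_rule[of Rep_ordered_index])
    case (less x)
    show ?case by (rule step, rule less, simp add: less_ordered_index_def)
  qed
qed (auto simp: less_eq_ordered_index_def less_ordered_index_def Rep_ordered_index_inject)

end

lemma ordered_index_bij: "\<exists>e :: 'n::finite ordered_index \<Rightarrow> 'n. bij e"
proof (rule finite_same_card_bij)
  have "CARD('n ordered_index) = card {..<CARD('n)}"
    by (rule type_definition.card[OF type_definition_ordered_index])
  then show "CARD('n ordered_index) = CARD('n)" by simp
qed auto

text \<open>Conjugation with the bijection is a sign-preserving bijection between the permutations of the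
  two index types.\<close>

lemma det_reindex:
  fixes P :: "real^'n^'n" and e :: "'m::finite \<Rightarrow> 'n::finite"
  assumes "bij e"
  shows "det (\<chi> i j. P $ e i $ e j) = det P"
proof -
  have inj: "inj e" and surj: "range e = UNIV" using assms by (auto simp: bij_def)
  let ?m = "map_permutation UNIV e"
  have app: "?m p (e i) = e (p i)" for p i
    using map_permutation_apply[OF inj, of i p] by simp
  have bij: "bij_betw ?m {p. p permutes UNIV} {q. q permutes UNIV}"
  proof -
    have "?m = (\<lambda>\<pi> x. e (\<pi> (inv e x)))"
      by (simp add: fun_eq_iff map_permutation_def restrict_id_def surj)
    then show ?thesis using bij_betw_permutations[of e UNIV UNIV] assms by simp
  qed
  have "det P = (\<Sum>p | p permutes UNIV. of_int (sign (?m p)) * (\<Prod>i\<in>UNIV. P $ i $ ?m p i))"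
    unfolding det_def by (rule sum.reindex_bij_betw[OF bij, symmetric])
  also have "\<dots> = (\<Sum>p | p permutes UNIV. of_int (sign p) * (\<Prod>i\<in>UNIV. P $ e i $ e (p i)))"
  proof (intro sum.cong refl arg_cong2[where f = "(*)"])
    fix p :: "'m \<Rightarrow> 'm" assume "p \<in> {p. p permutes UNIV}"
    then show "of_int (sign (?m p)) = (of_int (sign p) :: real)"
      using sign_map_permutation[OF inj, of p] by simp
    show "(\<Prod>i\<in>UNIV. P $ i $ ?m p i) = (\<Prod>i\<in>UNIV. P $ e i $ e (p i))"
      using prod.reindex_bij_betw[of e UNIV UNIV "\<lambda>i. P $ i $ ?m p i"] assms by (simp add: app)
  qed
  finally show ?thesis unfolding det_def by simp
qed

lemma prod_Basis_vec:
  fixes f :: "real^'n::finite \<Rightarrow> real"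
  shows "(\<Prod>b\<in>Basis. f b) = (\<Prod>i\<in>UNIV. f (axis i 1))"
proof -
  have "(Basis :: (real^'n) set) = (\<lambda>i. axis i 1) ` UNIV" by (auto simp: Basis_vec_def)
  moreover have "inj (\<lambda>i::'n. axis i (1::real))" by (simp add: inj_on_def axis_eq_axis)
  ultimately show ?thesis using prod.reindex[of "\<lambda>i. axis i 1" UNIV f] by (simp add: comp_def)
qed

lemma lborel_reindex:
  fixes e :: "'m::finite \<Rightarrow> 'n::finite"
  assumes "bij e"
  shows "(lborel :: (real^'m) measure) = distr lborel borel (\<lambda>v::real^'n. \<chi> i. v $ e i)"
proof (rule lborel_eqI)
  let ?\<pi> = "\<lambda>v::real^'n. \<chi> i. v $ e i"
  have inj: "inj e" and surj: "range e = UNIV" using assms by (auto simp: bij_def)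
  have inv: "e (inv e j) = j" "inv e (e i) = i" for i j
    using inj surj by (auto simp: surj_f_inv_f)
  have meas: "?\<pi> \<in> borel_measurable borel"
    by (intro borel_measurable_continuous_onI continuous_intros)
  fix l u :: "real^'m" assume lu: "\<And>b. b \<in> Basis \<Longrightarrow> l \<bullet> b \<le> u \<bullet> b"
  let ?l = "\<chi> j. l $ inv e j" and ?u = "\<chi> j. u $ inv e j"
  have lu': "l $ i \<le> u $ i" for i
    using lu[of "axis i 1"] by (simp add: inner_axis)
  have "emeasure (distr lborel borel ?\<pi>) (box l u) = emeasure lborel (?\<pi> -` box l u)"
    using meas by (simp add: emeasure_distr)
  also have "?\<pi> -` box l u = box ?l ?u"
    by (auto simp: mem_box_cart) (metis inv(1), metis inv(1), metis inv(2), metis inv(2))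
  also have "emeasure lborel (box ?l ?u) = ennreal (\<Prod>b\<in>Basis. (?u - ?l) \<bullet> b)"
    by (rule emeasure_lborel_box) (auto simp: Basis_vec_def inner_axis lu')
  also have "(\<Prod>b\<in>Basis. (?u - ?l) \<bullet> b) = (\<Prod>j\<in>UNIV. u $ inv e j - l $ inv e j)"
    by (simp add: prod_Basis_vec inner_axis)
  also have "\<dots> = (\<Prod>i\<in>UNIV. u $ i - l $ i)"
    using prod.reindex_bij_betw[of "inv e" UNIV UNIV "\<lambda>i. u $ i - l $ i"] bij_imp_bij_inv[OF assms] by simp
  also have "\<dots> = (\<Prod>b\<in>Basis. (u - l) \<bullet> b)"
    by (simp add: prod_Basis_vec inner_axis)
  finally show "emeasure (distr lborel borel ?\<pi>) (box l u) = ennreal (\<Prod>b\<in>Basis. (u - l) \<bullet> b)" .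
qed simp

lemma nn_integral_substitution_wellorder:
  fixes g :: "real^'m::{finite,wellorder} \<Rightarrow> real^'m::{finite,wellorder}" and f :: "real^'m::{finite,wellorder} \<Rightarrow> real"
  assumes S: "S \<in> sets borel" and der: "\<And>x. x \<in> S \<Longrightarrow> (g has_derivative g' x) (at x)" and inj: "inj_on g S"
    and nonneg: "\<And>y. y \<in> g ` S \<Longrightarrow> 0 \<le> f y"
    and meas: "(\<lambda>y. indicator (g ` S) y * f y) \<in> borel_measurable borel"
    and fin: "(\<integral>\<^sup>+y. ennreal (indicator (g ` S) y * f y) \<partial>lborel) < \<infinity>"
  shows "(\<integral>\<^sup>+y. ennreal (indicator (g ` S) y * f y) \<partial>lborel) =
    (\<integral>\<^sup>+x. ennreal (indicator S x * (\<bar>det (matrix (g' x))\<bar> * f (g x))) \<partial>lborel)"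
proof -
  let ?D = "\<lambda>x. \<bar>det (matrix (g' x))\<bar> * f (g x)"
  have "(\<lambda>y. indicator (g ` S) y * f y) integrable_on UNIV"
    by (rule nn_integral_integrable_on[OF meas _ fin]) (use nonneg in \<open>auto simp: indicator_def\<close>)
  moreover have "(\<lambda>y. indicator (g ` S) y * f y) = (\<lambda>y. if y \<in> g ` S then f y else 0)"
    by (auto simp: indicator_def)
  ultimately have int: "f integrable_on (g ` S)" by (simp add: integrable_restrict_UNIV)
  then have abs: "f absolutely_integrable_on (g ` S)"
    by (rule nonnegative_absolutely_integrable_1) (use nonneg in auto)
  have "(\<lambda>y. vec (f y) :: real^1) absolutely_integrable_on (g ` S) \<and>
      integral (g ` S) (\<lambda>y. vec (f y)) = (vec (integral (g ` S) f) :: real^1)"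
    using abs int by (simp add: absolutely_integrable_on_1_iff integral_on_1_eq)
  then have "(\<lambda>x. \<bar>det (matrix (g' x))\<bar> *\<^sub>R (vec (f (g x)) :: real^1)) absolutely_integrable_on S \<and>
      integral S (\<lambda>x. \<bar>det (matrix (g' x))\<bar> *\<^sub>R (vec (f (g x)) :: real^1)) = vec (integral (g ` S) f)"
    by (subst has_absolute_integral_change_of_variables[OF _ has_derivative_at_withinI[OF der] inj])
      (use S in auto)
  then have D: "?D absolutely_integrable_on S \<and> integral S ?D = integral (g ` S) f"
    by (simp add: absolutely_integrable_on_1_iff integral_on_1_eq)
  then have hD: "(?D has_integral integral (g ` S) f) S"
    using set_lebesgue_integral_eq_integral(1) integrable_integral by metis
  have "(\<integral>\<^sup>+y. ennreal (indicator (g ` S) y * f y) \<partial>lborel) = ennreal (integral (g ` S) f)"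
    by (rule nn_integral_has_integral_lebesgue[OF nonneg integrable_integral[OF int]])
  also have "\<dots> = (\<integral>\<^sup>+x. ennreal (indicator S x * ?D x) \<partial>lborel)"
    by (rule nn_integral_has_integral_lebesgue[OF _ hD, symmetric]) (use nonneg in auto)
  finally show ?thesis .
qed

text \<open>Relabelling the coordinates preserves Lebesgue measure and determinants.\<close>

lemma nn_integral_substitution:
  fixes g :: "real^'n::finite \<Rightarrow> real^'n" and f :: "real^'n \<Rightarrow> real"
  assumes S: "S \<in> sets borel" and der: "\<And>x. x \<in> S \<Longrightarrow> (g has_derivative g' x) (at x)" and inj: "inj_on g S"
    and nonneg: "\<And>y. y \<in> g ` S \<Longrightarrow> 0 \<le> f y"
    and meas: "(\<lambda>y. indicator (g ` S) y * f y) \<in> borel_measurable borel"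
    and meas': "(\<lambda>x. indicator S x * (\<bar>det (matrix (g' x))\<bar> * f (g x))) \<in> borel_measurable borel"
    and fin: "(\<integral>\<^sup>+y. ennreal (indicator (g ` S) y * f y) \<partial>lborel) < \<infinity>"
  shows "(\<integral>\<^sup>+y. ennreal (indicator (g ` S) y * f y) \<partial>lborel) =
    (\<integral>\<^sup>+x. ennreal (indicator S x * (\<bar>det (matrix (g' x))\<bar> * f (g x))) \<partial>lborel)"
proof -
  obtain e :: "'n ordered_index \<Rightarrow> 'n" where e: "bij e" using ordered_index_bij by blast
  have e': "bij (inv e)" by (rule bij_imp_bij_inv[OF e])
  have inv: "e (inv e j) = j" "inv e (e i) = i" for i j
    using e by (simp_all add: bij_is_surj surj_f_inv_f bij_is_inj)
  let ?\<pi> = "\<lambda>v::real^'n. \<chi> i. v $ e i" and ?\<kappa> = "\<lambda>v::real^('n ordered_index). \<chi> j. v $ inv e j"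
  have \<pi>\<kappa>: "?\<pi> (?\<kappa> v) = v" "?\<kappa> (?\<pi> w) = w" for v w by (simp_all add: vec_eq_iff inv)
  have lin: "linear ?\<pi>" "linear ?\<kappa>" by (auto intro!: linearI simp: vec_eq_iff)
  have meas_\<pi>: "?\<pi> \<in> borel_measurable borel" and meas_\<kappa>: "?\<kappa> \<in> borel_measurable borel"
    by (intro borel_measurable_continuous_onI continuous_intros)+
  let ?S = "?\<kappa> -` S" and ?g = "\<lambda>v. ?\<pi> (g (?\<kappa> v))" and ?g' = "\<lambda>v h. ?\<pi> (g' (?\<kappa> v) (?\<kappa> h))" and ?f = "\<lambda>v. f (?\<kappa> v)"
  have img: "?g ` ?S = ?\<kappa> -` (g ` S)"
  proof (intro equalityI subsetI)
    fix w assume "w \<in> ?\<kappa> -` (g ` S)"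
    then obtain s where s: "s \<in> S" "?\<kappa> w = g s" by auto
    have "w = ?g (?\<pi> s)" by (simp only: \<pi>\<kappa>(2) s(2)[symmetric] \<pi>\<kappa>(1))
    moreover have "?\<pi> s \<in> ?S" using s(1) by (simp only: vimage_eq \<pi>\<kappa>(2))
    ultimately show "w \<in> ?g ` ?S" by (rule image_eqI)
  qed (use \<pi>\<kappa>(2) in auto)
  have transfer: "(\<integral>\<^sup>+v. ennreal (h (?\<kappa> v)) \<partial>lborel) = (\<integral>\<^sup>+v. ennreal (h v) \<partial>lborel)"
    if "h \<in> borel_measurable borel" for h
    using that meas_\<kappa> by (simp add: lborel_reindex[OF e'] nn_integral_distr)
  have 1: "(\<integral>\<^sup>+y. ennreal (indicator (?g ` ?S) y * ?f y) \<partial>lborel) = (\<integral>\<^sup>+y. ennreal (indicator (g ` S) y * f y) \<partial>lborel)"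
    unfolding img using transfer[OF meas] by (simp add: indicator_def)
  have "(\<integral>\<^sup>+y. ennreal (indicator (?g ` ?S) y * ?f y) \<partial>lborel) =
    (\<integral>\<^sup>+x. ennreal (indicator ?S x * (\<bar>det (matrix (?g' x))\<bar> * ?f (?g x))) \<partial>lborel)"
  proof (rule nn_integral_substitution_wellorder)
    show "?S \<in> sets borel" using measurable_sets[OF meas_\<kappa> S] by simp
    show "(?g has_derivative ?g' v) (at v)" if "v \<in> ?S" for v
    proof -
      have "(?\<kappa> has_derivative ?\<kappa>) (at v)" by (rule linear_imp_has_derivative[OF lin(2)])
      moreover have "(g has_derivative g' (?\<kappa> v)) (at (?\<kappa> v))" using der that by simp
      ultimately have "((\<lambda>v. g (?\<kappa> v)) has_derivative (\<lambda>h. g' (?\<kappa> v) (?\<kappa> h))) (at v)"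
        by (rule has_derivative_compose)
      then show ?thesis by (rule has_derivative_compose[OF _ linear_imp_has_derivative[OF lin(1)]])
    qed
    show "inj_on ?g ?S"
    proof (rule inj_onI)
      fix v w assume "v \<in> ?S" "w \<in> ?S" and eq: "?g v = ?g w"
      from eq have "?\<kappa> (?g v) = ?\<kappa> (?g w)" by (rule arg_cong[of _ _ ?\<kappa>])
      then have "g (?\<kappa> v) = g (?\<kappa> w)" by (simp only: \<pi>\<kappa>(2))
      then have "?\<kappa> v = ?\<kappa> w"
        by (rule inj_onD[OF inj]) (use \<open>v \<in> ?S\<close> \<open>w \<in> ?S\<close> in auto)
      then have "?\<pi> (?\<kappa> v) = ?\<pi> (?\<kappa> w)" by (rule arg_cong[of _ _ ?\<pi>])
      then show "v = w" by (simp only: \<pi>\<kappa>(1))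
    qed
    show "0 \<le> ?f y" if "y \<in> ?g ` ?S" for y using that nonneg unfolding img by auto
    show "(\<lambda>y. indicator (?g ` ?S) y * ?f y) \<in> borel_measurable borel"
      unfolding img using measurable_compose[OF meas_\<kappa> meas] by (simp add: indicator_def)
    show "(\<integral>\<^sup>+y. ennreal (indicator (?g ` ?S) y * ?f y) \<partial>lborel) < \<infinity>" unfolding 1 by (rule fin)
  qed
  also have "\<dots> = (\<integral>\<^sup>+x. ennreal (indicator S (?\<kappa> x) * (\<bar>det (matrix (g' (?\<kappa> x)))\<bar> * f (g (?\<kappa> x)))) \<partial>lborel)"
  proof (rule nn_integral_cong)
    fix v
    have "det (matrix (?g' v)) = det (matrix (g' (?\<kappa> v)))"
    proof -
      have ax: "?\<kappa> (axis i 1) = axis (e i) 1" for i by (auto simp: vec_eq_iff axis_def inv)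
      have "matrix (?g' v) = (\<chi> i j. matrix (g' (?\<kappa> v)) $ e i $ e j)"
        by (simp add: vec_eq_iff matrix_def ax)
      then show ?thesis by (simp add: det_reindex[OF e])
    qed
    then show "ennreal (indicator ?S v * (\<bar>det (matrix (?g' v))\<bar> * ?f (?g v))) =
       ennreal (indicator S (?\<kappa> v) * (\<bar>det (matrix (g' (?\<kappa> v)))\<bar> * f (g (?\<kappa> v))))"
      using \<pi>\<kappa>(2) by (simp add: indicator_def)
  qed
  also have "\<dots> = (\<integral>\<^sup>+x. ennreal (indicator S x * (\<bar>det (matrix (g' x))\<bar> * f (g x))) \<partial>lborel)"
    by (rule transfer[OF meas'])
  finally show ?thesis unfolding 1 .
qed

subsection \<open>Integration over a coordinate axis and its complement\<close>

lemma measurable_vec_of_fun: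
  fixes h :: "'a \<Rightarrow> 'n::finite \<Rightarrow> real"
  assumes "\<And>i. (\<lambda>f. h f i) \<in> borel_measurable N"
  shows "(\<lambda>f. \<chi> i. h f i) \<in> measurable N borel"
proof (rule borel_measurable_euclidean_space[THEN iffD2], rule ballI)
  fix b :: "real^'n" assume "b \<in> Basis"
  then obtain i where "b = axis i 1" by (auto simp: Basis_vec_def)
  then show "(\<lambda>f. (\<chi> i. h f i) \<bullet> b) \<in> borel_measurable N"
    using assms by (simp add: inner_axis)
qed

lemma lborel_vec:
  "(lborel :: (real^'n::finite) measure) = distr (Pi\<^sub>M UNIV (\<lambda>_. lborel)) borel (\<lambda>f. \<chi> i. f i)"
proof (rule lborel_eqI)
  let ?P = "Pi\<^sub>M (UNIV :: 'n set) (\<lambda>_. lborel :: real measure)"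
  interpret product_sigma_finite "\<lambda>_ :: 'n. lborel :: real measure"
    by (simp add: product_sigma_finite_def lborel.sigma_finite_measure_axioms)
  have meas: "(\<lambda>f. \<chi> i. f i) \<in> measurable ?P borel"
    by (rule measurable_vec_of_fun) measurable
  fix l u :: "real^'n" assume lu: "\<And>b. b \<in> Basis \<Longrightarrow> l \<bullet> b \<le> u \<bullet> b"
  have lu': "l $ i \<le> u $ i" for i using lu[of "axis i 1"] by (simp add: inner_axis)
  have "(\<lambda>f. \<chi> i. f i) -` box l u \<inter> space ?P = Pi\<^sub>E UNIV (\<lambda>i. {l $ i <..< u $ i})"
    by (auto simp: mem_box_cart space_PiM PiE_def Pi_iff)
  then have "emeasure (distr ?P borel (\<lambda>f. \<chi> i. f i)) (box l u) = emeasure ?P (Pi\<^sub>E UNIV (\<lambda>i. {l $ i <..< u $ i}))"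
    using meas by (simp add: emeasure_distr)
  also have "\<dots> = (\<Prod>i\<in>UNIV. emeasure lborel {l $ i <..< u $ i})"
    by (rule emeasure_PiM) auto
  also have "\<dots> = ennreal (\<Prod>i\<in>UNIV. u $ i - l $ i)"
    using lu' by (simp add: prod_ennreal)
  finally show "emeasure (distr ?P borel (\<lambda>f. \<chi> i. f i)) (box l u) = ennreal (\<Prod>b\<in>Basis. (u - l) \<bullet> b)"
    by (simp add: prod_Basis_vec inner_axis)
qed simp

lemma hyperplane_embedding_measurable:
  "(\<lambda>f. \<chi> i. if i = k then 0::real else f i) \<in> measurable (Pi\<^sub>M (- {k}) (\<lambda>_. lborel)) borel"
proof (rule measurable_vec_of_fun[of "\<lambda>f i. if i = k then 0 else f i"])
  fix i
  show "(\<lambda>f. if i = k then 0 else f i) \<in> borel_measurable (Pi\<^sub>M (- {k}) (\<lambda>_. lborel))"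
    by (cases "i = k") auto
qed

lemma sets_hyperplane_measure [measurable_cong]: "sets (hyperplane_measure k) = sets borel"
  by (simp add: hyperplane_measure_def)

lemma AE_hyperplane_measure: "AE t in hyperplane_measure k. t $ k = 0"
  unfolding hyperplane_measure_def
  by (subst AE_distr_iff[OF hyperplane_embedding_measurable]) auto

lemma nn_integral_hyperplane_Fubini:
  fixes h :: "real^'n::finite \<Rightarrow> ennreal"
  assumes h[measurable]: "h \<in> borel_measurable borel"
  shows "(\<integral>\<^sup>+s. h s \<partial>lborel) = (\<integral>\<^sup>+t. (\<integral>\<^sup>+r. h (t + r *\<^sub>R axis k 1) \<partial>lborel) \<partial>hyperplane_measure k)"
proof -
  interpret product_sigma_finite "\<lambda>_ :: 'n. lborel :: real measure"
    by (simp add: product_sigma_finite_def lborel.sigma_finite_measure_axioms)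
  have meas: "(\<lambda>f. \<chi> i. f i) \<in> measurable (Pi\<^sub>M (UNIV :: 'n set) (\<lambda>_. lborel :: real measure)) borel"
    by (rule measurable_vec_of_fun) measurable
  have ins: "insert k (- {k}) = (UNIV :: 'n set)" by auto
  have "(\<integral>\<^sup>+s. h s \<partial>lborel) = (\<integral>\<^sup>+f. h (\<chi> i. f i) \<partial>Pi\<^sub>M (UNIV :: 'n set) (\<lambda>_. lborel))"
    by (subst lborel_vec) (rule nn_integral_distr[OF meas], simp)
  also have "\<dots> = (\<integral>\<^sup>+f. (\<integral>\<^sup>+r. h (\<chi> i. (f(k := r)) i) \<partial>lborel) \<partial>Pi\<^sub>M (- {k}) (\<lambda>_. lborel))"
    using product_nn_integral_insert[of "- {k}" k "\<lambda>f. h (\<chi> i. f i)"] measurable_compose[OF meas h]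
    unfolding ins by simp
  also have "\<dots> = (\<integral>\<^sup>+f. (\<integral>\<^sup>+r. h ((\<chi> i. if i = k then 0 else f i) + r *\<^sub>R axis k 1) \<partial>lborel) \<partial>Pi\<^sub>M (- {k}) (\<lambda>_. lborel))"
  proof -
    have "(\<chi> i. (f(k := r)) i) = (\<chi> i. if i = k then 0 else f i) + r *\<^sub>R axis k 1" for f :: "'n \<Rightarrow> real" and r
      by (simp add: vec_eq_iff axis_def)
    then show ?thesis by (simp only:)
  qed
  also have "\<dots> = (\<integral>\<^sup>+t. (\<integral>\<^sup>+r. h (t + r *\<^sub>R axis k 1) \<partial>lborel) \<partial>hyperplane_measure k)"
  proof -
    have m: "(\<lambda>t. \<integral>\<^sup>+r. h (t + r *\<^sub>R axis k 1) \<partial>lborel) \<in> borel_measurable borel" by measurable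
    show ?thesis
      unfolding hyperplane_measure_def
      by (rule nn_integral_distr[OF hyperplane_embedding_measurable, symmetric]) (use m in simp)
  qed
  finally show ?thesis .
qed

subsection \<open>The polar formula\<close>

text \<open>Integrals over a star-shaped hypersurface are computed over this compact shell, which does not
  depend on the hypersurface and avoids the origin, where homogeneous functions are singular. The
  constant is the reciprocal of \<open>\<integral>\<^sub>1\<^sup>2 r\<^sup>n\<^sup>-\<^sup>1 dr\<close>.\<close>

definition shell :: "(real^'n::finite) set" where
  "shell = {y. 1 \<le> norm y \<and> norm y \<le> 2}"

definition shell_const :: "'n::finite itself \<Rightarrow> real" where
  "shell_const _ = real CARD('n) / (2 ^ CARD('n) - 1)"

lemma shell_nonzero: "y \<in> shell \<Longrightarrow> y \<noteq> 0"
  by (auto simp: shell_def)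

lemma compact_shell: "compact (shell :: (real^'n::finite) set)"
proof -
  have eq: "shell = cball 0 2 - ball (0 :: real^'n) 1" by (auto simp: shell_def dist_norm)
  show ?thesis unfolding eq by (intro compact_diff compact_cball open_ball)
qed

lemma shell_borel [measurable]: "shell \<in> sets borel"
  by (rule borel_compact[OF compact_shell])

lemma card_pos: "0 < CARD('n::finite)"
  by (simp add: card_gt_0_iff)

lemma shell_const_pos: "shell_const TYPE('n::finite) > 0"
proof -
  have "(1::real) < 2 ^ CARD('n)" using card_pos[where 'n = 'n] by (simp add: one_less_power)
  then show ?thesis using card_pos[where 'n = 'n] by (simp add: shell_const_def)
qed

lemma borel_continuous_preimage:
  fixes h :: "'a::topological_space \<Rightarrow> 'b::topological_space"
  assumes "continuous_on U h" "open U" "E \<in> sets borel"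
  shows "{y \<in> U. h y \<in> E} \<in> sets borel"
proof -
  have "h \<in> measurable (restrict_space borel U) borel"
    by (rule borel_measurable_continuous_on_restrict[OF assms(1)])
  then have "h -` E \<inter> space (restrict_space borel U) \<in> sets (restrict_space borel U)"
    using assms(3) by (rule measurable_sets)
  moreover have "h -` E \<inter> space (restrict_space borel U) = {y \<in> U. h y \<in> E}"
    by (auto simp: space_restrict_space)
  ultimately show ?thesis using assms(2) by (simp add: sets_restrict_space_iff)
qed

text \<open>The shell cuts the interval from \<open>1/|u|\<close> to \<open>2/|u|\<close> out of the ray through \<open>u\<close>; the
  factor \<open>|u|\<^sup>n\<close> removes the dependence on \<open>|u|\<close>.\<close>

lemma radial_integral:
  fixes u :: "real^'n::finite"
  assumes "u \<noteq> 0" "0 \<le> m"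
  shows "(\<integral>\<^sup>+r. ennreal (indicator {r. 0 < r \<and> r *\<^sub>R u \<in> shell} r * (r ^ (CARD('n) - 1) * (m * norm u ^ CARD('n)))) \<partial>lborel)
    = ennreal (m / shell_const TYPE('n))"
proof -
  let ?n = "CARD('n)" and ?a = "norm u"
  let ?c = "m * ?a ^ ?n"
  have a: "?a > 0" using assms by simp
  have c: "?c \<ge> 0" using assms by simp
  have "(\<integral>\<^sup>+r. ennreal (indicator {r. 0 < r \<and> r *\<^sub>R u \<in> shell} r * (r ^ (?n - 1) * ?c)) \<partial>lborel)
    = (\<integral>\<^sup>+r. ennreal (r ^ (?n - 1) * ?c) * indicator {1 / ?a .. 2 / ?a} r \<partial>lborel)"
  proof (rule nn_integral_cong)
    fix r :: real
    have "0 < r \<and> r *\<^sub>R u \<in> shell \<longleftrightarrow> r \<in> {1 / ?a .. 2 / ?a}"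
    proof
      assume "0 < r \<and> r *\<^sub>R u \<in> shell"
      then show "r \<in> {1 / ?a .. 2 / ?a}" using a by (auto simp: shell_def field_simps)
    next
      assume r: "r \<in> {1 / ?a .. 2 / ?a}"
      have "0 < 1 / ?a" using a by simp
      also have "\<dots> \<le> r" using r by simp
      finally show "0 < r \<and> r *\<^sub>R u \<in> shell" using r a by (auto simp: shell_def field_simps)
    qed
    then show "ennreal (indicator {r. 0 < r \<and> r *\<^sub>R u \<in> shell} r * (r ^ (?n - 1) * ?c))
      = ennreal (r ^ (?n - 1) * ?c) * indicator {1 / ?a .. 2 / ?a} r"
      by (simp add: indicator_def)
  qed
  also have "\<dots> = ennreal ((2 / ?a) ^ ?n * ?c / ?n - (1 / ?a) ^ ?n * ?c / ?n)"
  proof (rule nn_integral_FTC_Icc)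
    show "1 / ?a \<le> 2 / ?a" using a by (simp add: divide_right_mono)
    fix r assume r: "r \<in> {1 / ?a .. 2 / ?a}"
    have "0 < 1 / ?a" using a by simp
    with r have "0 \<le> r" by (meson atLeastAtMost_iff less_imp_le order_trans)
    then show "0 \<le> r ^ (?n - 1) * ?c" using c by simp
    have "((\<lambda>r. r ^ ?n * ?c / ?n) has_real_derivative (real ?n * r ^ (?n - 1)) * ?c / ?n) (at r)"
      by (intro DERIV_cdivide DERIV_cmult_right) (use DERIV_pow[of ?n r UNIV] in simp)
    then show "((\<lambda>r. r ^ ?n * ?c / ?n) has_real_derivative r ^ (?n - 1) * ?c) (at r)"
      using card_pos[where 'n = 'n] by simp
  qed simp
  also have "(2 / ?a) ^ ?n * ?c / ?n - (1 / ?a) ^ ?n * ?c / ?n = m / shell_const TYPE('n)"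
    using a by (simp add: shell_const_def power_divide field_simps)
  finally show ?thesis .
qed

lemma det_scale_columns:
  fixes P :: "real^'n^'n"
  shows "det (\<chi> i j. if j = k then P $ i $ j else r * P $ i $ j) = r ^ (CARD('n) - 1) * det P"
proof -
  have "det (\<chi> i j. if j = k then P $ i $ j else r * P $ i $ j)
      = det (transpose (\<chi> i j. if j = k then P $ i $ j else r * P $ i $ j))"
    by (rule det_transpose[symmetric])
  also have "transpose (\<chi> i j. if j = k then P $ i $ j else r * P $ i $ j)
      = (\<chi> j. (if j = k then 1 else r) *s (transpose P) $ j)"
    by (simp add: vec_eq_iff transpose_def)
  also have "det \<dots> = (\<Prod>j\<in>UNIV. if j = k then 1 else r) * det (\<chi> j. transpose P $ j)"
    by (rule det_rows_mul)
  also have "(\<Prod>j\<in>UNIV. if j = k then 1 else r) = r ^ (CARD('n) - 1)"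
  proof -
    have "(\<Prod>j\<in>UNIV. if j = k then 1 else r) = (\<Prod>j\<in>UNIV - {k}. if j = k then 1 else r)"
      using prod.remove[of UNIV k "\<lambda>j. if j = k then 1 else r"] by simp
    also have "\<dots> = (\<Prod>j\<in>UNIV - {k}. r)" by (rule prod.cong) auto
    finally show ?thesis by (simp add: card_Diff_singleton)
  qed
  also have "det (\<chi> j. transpose P $ j) = det P" by (simp add: det_transpose)
  finally show ?thesis .
qed

context
  fixes f \<rho> :: "real^'n::finite \<Rightarrow> real"
  assumes f_pos: "\<And>y. y \<noteq> 0 \<Longrightarrow> 0 < f y"
    and f_cont: "continuous_on (- {0}) f"
    and f_hom: "\<And>y r. y \<noteq> 0 \<Longrightarrow> 0 < r \<Longrightarrow> f (r *\<^sub>R y) = r * f y"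
    and \<rho>_pos: "\<And>y. y \<noteq> 0 \<Longrightarrow> 0 < \<rho> y"
    and \<rho>_cont: "continuous_on (- {0}) \<rho>"
    and \<rho>_hom: "\<And>y r. y \<noteq> 0 \<Longrightarrow> 0 < r \<Longrightarrow> \<rho> (r *\<^sub>R y) = \<rho> y"
begin

text \<open>The density on the shell whose image under the radial projection \<open>y \<mapsto> y/f(y)\<close> is the
  hypersurface measure with density \<open>\<rho>\<close>. The quotient of the two norms compensates for the shell
  being bounded by Euclidean spheres instead of level sets of \<open>f\<close>.\<close>

definition polar_weight :: "real^'n \<Rightarrow> real" where
  "polar_weight y = shell_const TYPE('n) * \<rho> y * (norm y / f y) ^ CARD('n)"

lemma polar_weight_pos: "y \<noteq> 0 \<Longrightarrow> 0 < polar_weight y"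
  using f_pos \<rho>_pos shell_const_pos[where 'n = 'n] by (simp add: polar_weight_def)

lemma polar_weight_cont: "continuous_on (- {0}) polar_weight"
  unfolding polar_weight_def[abs_def]
  by (intro continuous_intros \<rho>_cont f_cont) (use f_pos in \<open>auto simp: less_imp_neq[symmetric]\<close>)

lemma polar_weight_ray:
  assumes "u \<noteq> 0" "f u = 1" "0 < r"
  shows "polar_weight (r *\<^sub>R u) = shell_const TYPE('n) * \<rho> u * norm u ^ CARD('n)"
  using assms by (simp add: polar_weight_def f_hom \<rho>_hom)

lemma polar_weight_integrable: "integrable lborel (\<lambda>y. indicator shell y * polar_weight y)"
proof -
  have "continuous_on shell polar_weight"
    using polar_weight_cont by (rule continuous_on_subset) (use shell_nonzero in auto)
  from borel_integrable_compact[OF compact_shell this] show ?thesis by simp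
qed

text \<open>With \<open>\<Psi> (t + r e\<^sub>k) = r \<phi>(t)\<close>, the Jacobian is \<open>r\<^sup>n\<^sup>-\<^sup>1\<close> times the determinant of the position
  vector and the tangent vectors of the hypersurface, so the radial integral splits off.\<close>

lemma polar_formula:
  assumes param: "hypersurface_param k W \<phi> S" and S: "\<And>y. y \<in> S \<Longrightarrow> y \<noteq> 0 \<and> f y = 1"
    and E: "E \<in> sets borel" "E \<subseteq> \<phi> ` (W \<inter> coord_hyperplane k)"
  shows "(\<integral>\<^sup>+y. ennreal (indicator {y. y \<in> shell \<and> y /\<^sub>R f y \<in> E} y * polar_weight y) \<partial>lborel) =
    (\<integral>\<^sup>+ t \<in> {t \<in> W \<inter> coord_hyperplane k. \<phi> t \<in> E}.
      ennreal (\<rho> (\<phi> t) * \<bar>det (\<chi> i j. (if j = k then \<phi> t else frechet_derivative \<phi> (at t) (axis j 1)) $ i)\<bar>) \<partial>hyperplane_measure k)"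
proof -
  let ?n = "CARD('n)"
  have W: "open W" and smooth: "smooth_on \<phi> W" and into: "\<phi> ` (W \<inter> coord_hyperplane k) \<subseteq> S"
    and inj: "inj_on \<phi> (W \<inter> coord_hyperplane k)"
    using param unfolding hypersurface_param_def by auto
  \<comment> \<open>\<open>pr\<close> projects to the parameter hyperplane; the coordinate \<open>k\<close> of the parameter space becomes the radius\<close>
  define pr where "pr s = s - (s $ k) *\<^sub>R axis k 1" for s :: "real^'n"
  define \<Psi> where "\<Psi> s = (s $ k) *\<^sub>R \<phi> (pr s)" for s
  define J where "J t = (\<chi> i j. (if j = k then \<phi> t else frechet_derivative \<phi> (at t) (axis j 1)) $ i)" for t
  define \<Psi>' where "\<Psi>' s h = (s $ k) *\<^sub>R frechet_derivative \<phi> (at (pr s)) (pr h) + (h $ k) *\<^sub>R \<phi> (pr s)" for s h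
  define D0 where "D0 = {s. 0 < s $ k \<and> pr s \<in> W}"
  define D where "D = {s \<in> D0. \<phi> (pr s) \<in> E}"
  define w where "w y = indicator shell y * polar_weight y" for y
  have pr_hyp: "pr s \<in> coord_hyperplane k" for s by (simp add: pr_def coord_hyperplane_def)
  have pr_lin: "linear pr" unfolding pr_def[abs_def] by (auto intro!: linearI simp: algebra_simps)
  have pr_cont: "continuous_on UNIV pr" using linear_continuous_on[OF linear_conv_bounded_linear[THEN iffD1, OF pr_lin]] .
  have pr_axis: "pr (axis j 1) = (if j = k then 0 else axis j 1)" for j
    by (simp add: pr_def axis_def vec_eq_iff)
  have pr_plus: "pr (t + r *\<^sub>R axis k 1) = t" "(t + r *\<^sub>R axis k 1) $ k = r" if "t $ k = 0" for t r
    using that by (simp_all add: pr_def)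
  have \<phi>S: "\<phi> t \<noteq> 0" "f (\<phi> t) = 1" if "t \<in> W" "t \<in> coord_hyperplane k" for t
    using S[of "\<phi> t"] into that by auto
  have openD0: "open D0"
  proof -
    have "open {s::real^'n. 0 < s $ k}" by (intro open_Collect_less continuous_intros)
    moreover have "open (pr -` W)" by (rule open_vimage[OF W pr_cont])
    moreover have "D0 = {s. 0 < s $ k} \<inter> pr -` W" by (auto simp: D0_def)
    ultimately show ?thesis by auto
  qed
  have comp_cont: "continuous_on D0 (\<lambda>s. h (pr s))" if "continuous_on W h" for h :: "real^'n \<Rightarrow> 'x::topological_space"
    by (rule continuous_on_compose2[OF that continuous_on_subset[OF pr_cont]]) (auto simp: D0_def)
  have \<phi>_cont: "continuous_on D0 (\<lambda>s. \<phi> (pr s))" by (rule comp_cont[OF smooth_on_continuous_on[OF smooth]])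
  have \<Psi>_cont: "continuous_on D0 \<Psi>" unfolding \<Psi>_def by (intro continuous_intros \<phi>_cont)
  have \<Psi>_nz: "\<Psi> s \<noteq> 0" "f (\<Psi> s) = s $ k" if "s \<in> D0" for s
    using \<phi>S[OF _ pr_hyp, of s] that by (auto simp: \<Psi>_def D0_def f_hom)
  have D_borel: "D \<in> sets borel"
    unfolding D_def by (rule borel_continuous_preimage[OF \<phi>_cont openD0 E(1)])
  have DD0: "D \<subseteq> D0" by (auto simp: D_def)
  have der: "(\<Psi> has_derivative \<Psi>' s) (at s)" if "s \<in> D0" for s
  proof -
    have "(\<phi> has_derivative frechet_derivative \<phi> (at (pr s))) (at (pr s))"
      using smooth_on_has_derivative[OF smooth] that by (simp add: D0_def)
    from has_derivative_compose[OF linear_imp_has_derivative[OF pr_lin] this]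
    have "((\<lambda>s. \<phi> (pr s)) has_derivative (\<lambda>h. frechet_derivative \<phi> (at (pr s)) (pr h))) (at s)" .
    moreover have "((\<lambda>s. s $ k) has_derivative (\<lambda>h. h $ k)) (at s)"
      by (rule bounded_linear_imp_has_derivative[OF bounded_linear_vec_nth])
    ultimately show ?thesis unfolding \<Psi>_def[abs_def] \<Psi>'_def[abs_def] by (rule has_derivative_scaleR[rotated])
  qed
  have detJ: "det (matrix (\<Psi>' s)) = (s $ k) ^ (?n - 1) * det (J (pr s))" if "s \<in> D0" for s
  proof -
    have "linear (frechet_derivative \<phi> (at (pr s)))"
      using smooth_on_linear_derivative[OF smooth] that by (simp add: D0_def)
    moreover have "axis j (1::real) $ k = (if j = k then 1 else 0)" for j by (simp add: axis_def)
    ultimately have "matrix (\<Psi>' s) = (\<chi> i j. if j = k then J (pr s) $ i $ j else s $ k * J (pr s) $ i $ j)"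
      by (simp add: vec_eq_iff matrix_def \<Psi>'_def J_def pr_axis linear_0)
    then show ?thesis by (simp add: det_scale_columns)
  qed
  have img: "\<Psi> ` D = {y \<in> - {0}. y /\<^sub>R f y \<in> E}"
  proof (intro equalityI subsetI)
    fix y assume "y \<in> \<Psi> ` D"
    then obtain s where s: "s \<in> D" "y = \<Psi> s" by auto
    then have s0: "s \<in> D0" using DD0 by blast
    then have "y /\<^sub>R f y = \<phi> (pr s)" unfolding s(2) \<Psi>_nz(2)[OF s0] by (simp add: \<Psi>_def D0_def)
    then show "y \<in> {y \<in> - {0}. y /\<^sub>R f y \<in> E}" using s \<Psi>_nz(1)[OF s0] by (simp add: D_def)
  next
    fix y assume "y \<in> {y \<in> - {0}. y /\<^sub>R f y \<in> E}"
    then have y: "y \<noteq> 0" "y /\<^sub>R f y \<in> E" by auto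
    then obtain t where t: "t \<in> W" "t \<in> coord_hyperplane k" "y /\<^sub>R f y = \<phi> t" using E(2) by blast
    let ?s = "t + f y *\<^sub>R axis k 1"
    have tk: "t $ k = 0" using t(2) by (simp add: coord_hyperplane_def)
    note s = pr_plus[OF tk, of "f y"]
    have "?s \<in> D" unfolding D_def D0_def mem_Collect_eq s using t y f_pos[OF y(1)] by simp
    moreover have "y = \<Psi> ?s" unfolding \<Psi>_def s t(3)[symmetric] using f_pos[OF y(1)] by simp
    ultimately show "y \<in> \<Psi> ` D" by blast
  qed
  have injD: "inj_on \<Psi> D"
  proof (rule inj_onI)
    fix s s' assume "s \<in> D" "s' \<in> D" and eq: "\<Psi> s = \<Psi> s'"
    then have s: "s \<in> D0" "s' \<in> D0" using DD0 by auto
    then have k: "s $ k = s' $ k" using \<Psi>_nz(2) eq by metis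
    then have "\<phi> (pr s) = \<phi> (pr s')" using eq s by (simp add: \<Psi>_def D0_def)
    then have "pr s = pr s'" using inj_onD[OF inj] s pr_hyp by (simp add: D0_def)
    then show "s = s'" using k by (simp add: pr_def)
  qed
  have cone: "{y \<in> - {0}. y /\<^sub>R f y \<in> E} \<in> sets borel"
  proof (rule borel_continuous_preimage[OF _ _ E(1)])
    show "continuous_on (- {0}) (\<lambda>y. y /\<^sub>R f y)"
      by (intro continuous_intros f_cont) (use f_pos in \<open>auto simp: less_imp_neq[symmetric]\<close>)
  qed (rule open_Compl[OF closed_singleton])
  have eq1: "indicator (\<Psi> ` D) y * w y = indicator {y. y \<in> shell \<and> y /\<^sub>R f y \<in> E} y * polar_weight y" for y
    unfolding img w_def using shell_nonzero[of y] by (auto simp: indicator_def)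
  have meas1: "(\<lambda>y. indicator (\<Psi> ` D) y * w y) \<in> borel_measurable borel"
  proof -
    have b: "\<Psi> ` D \<inter> shell \<in> sets borel" using cone img by auto
    have "continuous_on (\<Psi> ` D \<inter> shell) polar_weight"
      by (rule continuous_on_subset[OF polar_weight_cont]) (use shell_nonzero in auto)
    from borel_measurable_continuous_on_indicator[OF b this] show ?thesis
      by (simp add: w_def indicator_inter_arith mult.assoc)
  qed
  have fin: "(\<integral>\<^sup>+y. ennreal (indicator (\<Psi> ` D) y * w y) \<partial>lborel) < \<infinity>"
  proof -
    have "(\<integral>\<^sup>+y. ennreal (indicator (\<Psi> ` D) y * w y) \<partial>lborel) \<le> (\<integral>\<^sup>+y. ennreal (norm (indicator shell y * polar_weight y)) \<partial>lborel)"
      by (rule nn_integral_mono) (auto simp: indicator_def w_def intro!: ennreal_leI)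
    also have "\<dots> < \<infinity>" using polar_weight_integrable unfolding integrable_iff_bounded by blast
    finally show ?thesis .
  qed
  have w_nonneg: "0 \<le> w y" for y
    using polar_weight_pos[OF shell_nonzero, of y] by (auto simp: w_def indicator_def)
  define H where "H s = indicator D s * (((s $ k) ^ (?n - 1) * \<bar>det (J (pr s))\<bar>) * w (\<Psi> s))" for s
  have eq2: "indicator D s * (\<bar>det (matrix (\<Psi>' s))\<bar> * w (\<Psi> s)) = H s" for s
  proof (cases "s \<in> D")
    case True
    then have "s \<in> D0" using DD0 by blast
    then show ?thesis using detJ[of s] by (simp add: H_def abs_mult D0_def)
  qed (simp add: H_def)
  have measH: "H \<in> borel_measurable borel"
  proof -
    have "{s \<in> D0. \<Psi> s \<in> shell} \<in> sets borel"
      by (rule borel_continuous_preimage[OF \<Psi>_cont openD0 shell_borel])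
    then have b: "D \<inter> {s \<in> D0. \<Psi> s \<in> shell} \<in> sets borel" using D_borel by blast
    have J_cont: "continuous_on D0 (\<lambda>s. J (pr s))"
    proof (rule comp_cont)
      have "continuous_on W (\<lambda>t. (if j = k then \<phi> t else frechet_derivative \<phi> (at t) (axis j 1)) $ i)" for i j
        using smooth_on_continuous_on[OF smooth] smooth_on_continuous_on[OF smooth_on_derivative[OF smooth]]
        by (cases "j = k") (auto intro: continuous_intros)
      then show "continuous_on W J" unfolding J_def by (intro continuous_on_vec_lambda)
    qed
    have "continuous_on D0 (\<lambda>s. ((s $ k) ^ (?n - 1) * \<bar>det (J (pr s))\<bar>) * polar_weight (\<Psi> s))"
      by (intro continuous_intros continuous_on_compose2[OF polar_weight_cont \<Psi>_cont] J_cont)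
        (use \<Psi>_nz in \<open>auto simp: det_def intro!: continuous_intros J_cont\<close>)
    then have "continuous_on (D \<inter> {s \<in> D0. \<Psi> s \<in> shell}) (\<lambda>s. ((s $ k) ^ (?n - 1) * \<bar>det (J (pr s))\<bar>) * polar_weight (\<Psi> s))"
      by (rule continuous_on_subset) auto
    from borel_measurable_continuous_on_indicator[OF b this]
    have "(\<lambda>s. indicator (D \<inter> {s \<in> D0. \<Psi> s \<in> shell}) s * (((s $ k) ^ (?n - 1) * \<bar>det (J (pr s))\<bar>) * polar_weight (\<Psi> s)))
      \<in> borel_measurable borel" by simp
    moreover have "(\<lambda>s. indicator (D \<inter> {s \<in> D0. \<Psi> s \<in> shell}) s * (((s $ k) ^ (?n - 1) * \<bar>det (J (pr s))\<bar>) * polar_weight (\<Psi> s))) = H"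
      using DD0 by (auto simp: fun_eq_iff H_def w_def indicator_def)
    ultimately show ?thesis by simp
  qed
  have "(\<integral>\<^sup>+y. ennreal (indicator {y. y \<in> shell \<and> y /\<^sub>R f y \<in> E} y * polar_weight y) \<partial>lborel)
      = (\<integral>\<^sup>+y. ennreal (indicator (\<Psi> ` D) y * w y) \<partial>lborel)"
    unfolding eq1 ..
  also have "\<dots> = (\<integral>\<^sup>+s. ennreal (indicator D s * (\<bar>det (matrix (\<Psi>' s))\<bar> * w (\<Psi> s))) \<partial>lborel)"
    by (rule nn_integral_substitution[OF D_borel der injD w_nonneg meas1 _ fin]) (use DD0 measH eq2 in auto)
  also have "\<dots> = (\<integral>\<^sup>+s. ennreal (H s) \<partial>lborel)" unfolding eq2 ..
  also have "\<dots> = (\<integral>\<^sup>+t. (\<integral>\<^sup>+r. ennreal (H (t + r *\<^sub>R axis k 1)) \<partial>lborel) \<partial>hyperplane_measure k)"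
    by (rule nn_integral_hyperplane_Fubini) (use measH in measurable)
  also have "\<dots> = (\<integral>\<^sup>+ t \<in> {t \<in> W \<inter> coord_hyperplane k. \<phi> t \<in> E}. ennreal (\<rho> (\<phi> t) * \<bar>det (J t)\<bar>) \<partial>hyperplane_measure k)"
  proof (rule nn_integral_cong_AE, use AE_hyperplane_measure[of k] in eventually_elim)
    fix t :: "real^'n" assume t: "t $ k = 0"
    have th: "t \<in> coord_hyperplane k" using t by (simp add: coord_hyperplane_def)
    show "(\<integral>\<^sup>+r. ennreal (H (t + r *\<^sub>R axis k 1)) \<partial>lborel) =
      ennreal (\<rho> (\<phi> t) * \<bar>det (J t)\<bar>) * indicator {t \<in> W \<inter> coord_hyperplane k. \<phi> t \<in> E} t"
    proof (cases "t \<in> W \<and> \<phi> t \<in> E")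
      case True
      have nz: "\<phi> t \<noteq> 0" "f (\<phi> t) = 1" using \<phi>S[OF _ th] True by auto
      let ?m = "shell_const TYPE('n) * (\<rho> (\<phi> t) * \<bar>det (J t)\<bar>)"
      have m: "0 \<le> ?m" using \<rho>_pos[OF nz(1)] shell_const_pos[where 'n = 'n] by simp
      have "H (t + r *\<^sub>R axis k 1) =
          indicator {r. 0 < r \<and> r *\<^sub>R \<phi> t \<in> shell} r * (r ^ (?n - 1) * (?m * norm (\<phi> t) ^ ?n))" for r
        using True polar_weight_ray[OF nz, of r]
        by (auto simp: H_def D_def D0_def pr_plus[OF t] t \<Psi>_def w_def indicator_def)
      then show ?thesis
        using True th radial_integral[OF nz(1) m] shell_const_pos[where 'n = 'n] by simp
    next
      case False
      then have "H (t + r *\<^sub>R axis k 1) = 0" for r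
        by (auto simp: H_def D_def D0_def pr_plus[OF t] t)
      then show ?thesis using False by auto
    qed
  qed
  finally show ?thesis unfolding J_def .
qed

end

subsection \<open>Smooth dependence of integrals on parameters\<close>

lemma compact_set_integrable:
  fixes f :: "'b::euclidean_space \<Rightarrow> 'c::euclidean_space"
  assumes "compact K" "continuous_on K f"
  shows "set_integrable lborel K f"
  unfolding set_integrable_def using borel_integrable_compact[OF assms] by simp

lemma compact_integral_bound:
  fixes f :: "'b::euclidean_space \<Rightarrow> 'c::euclidean_space"
  assumes "compact K" "continuous_on K f" "\<And>y. y \<in> K \<Longrightarrow> norm (f y) \<le> e"
  shows "norm (LINT y:K|lborel. f y) \<le> e * measure lborel K"
proof -
  have "norm (LINT y:K|lborel. f y) \<le> (LINT y:K|lborel. norm (f y))"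
    by (rule set_integral_norm_bound[OF compact_set_integrable[OF assms(1,2)]])
  also have "\<dots> \<le> (LINT y:K|lborel. e)"
    by (rule set_integral_mono)
      (use assms in \<open>auto intro!: compact_set_integrable continuous_intros\<close>)
  also have "\<dots> = e * measure lborel K"
    by (simp add: set_lebesgue_integral_def)
  finally show ?thesis .
qed

lemma uniform_near_compact:
  fixes H :: "'a::euclidean_space \<times> 'b::euclidean_space \<Rightarrow> 'c::metric_space"
  assumes "open U" "continuous_on (U \<times> V) H" "compact K" "K \<subseteq> V" "x0 \<in> U" "0 < e"
  obtains d where "0 < d" "ball x0 d \<subseteq> U" "\<And>x y. x \<in> ball x0 d \<Longrightarrow> y \<in> K \<Longrightarrow> dist (H (x, y)) (H (x0, y)) < e"
proof -
  obtain r where r: "0 < r" "cball x0 r \<subseteq> U" using assms(1,5) open_contains_cball by blast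
  have "compact (cball x0 r \<times> K)" using assms(3) by (intro compact_Times) auto
  moreover have "continuous_on (cball x0 r \<times> K) H"
    by (rule continuous_on_subset[OF assms(2)]) (use r assms(4) in auto)
  ultimately have "uniformly_continuous_on (cball x0 r \<times> K) H" by (rule compact_uniformly_continuous[rotated])
  then obtain d where d: "0 < d"
    "\<And>p q. p \<in> cball x0 r \<times> K \<Longrightarrow> q \<in> cball x0 r \<times> K \<Longrightarrow> dist q p < d \<Longrightarrow> dist (H q) (H p) < e"
    using assms(6) unfolding uniformly_continuous_on_def by metis
  show ?thesis
  proof (rule that[of "min d r"])
    show "0 < min d r" using d r by simp
    show "ball x0 (min d r) \<subseteq> U" using r(2) by auto
    fix x y assume "x \<in> ball x0 (min d r)" "y \<in> K"
    then show "dist (H (x, y)) (H (x0, y)) < e"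
      using d(2)[of "(x0, y)" "(x, y)"] r(1) by (auto simp: dist_Pair_Pair dist_commute)
  qed
qed

context
  fixes U :: "'a::euclidean_space set" and V K :: "'b::euclidean_space set"
  assumes U: "open U" and V: "open V" and K: "compact K" "K \<subseteq> V"
begin

lemma slice_continuous:
  fixes G :: "'a \<times> 'b \<Rightarrow> 'c::topological_space"
  assumes "continuous_on (U \<times> V) G" "x \<in> U"
  shows "continuous_on K (\<lambda>y. G (x, y))"
  by (rule continuous_on_compose2[OF assms(1)]) (use assms(2) K in \<open>auto intro!: continuous_intros\<close>)

lemma parametric_integral_continuous:
  fixes G :: "'a \<times> 'b \<Rightarrow> 'c::euclidean_space"
  assumes "continuous_on (U \<times> V) G"
  shows "continuous_on U (\<lambda>x. LINT y:K|lborel. G (x, y))"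
proof (rule continuous_at_imp_continuous_on, rule ballI)
  fix x0 assume x0: "x0 \<in> U"
  show "isCont (\<lambda>x. LINT y:K|lborel. G (x, y)) x0"
    unfolding continuous_at_eps_delta
  proof (intro allI impI)
    fix e :: real assume e: "0 < e"
    \<comment> \<open>the summand \<open>1\<close> makes \<open>m\<close> positive even if \<open>K\<close> is a null set\<close>
    define m where "m = measure lborel K + 1"
    have m: "m > 0" by (simp add: m_def add_nonneg_pos)
    obtain d where d: "0 < d" "ball x0 d \<subseteq> U"
      "\<And>x y. x \<in> ball x0 d \<Longrightarrow> y \<in> K \<Longrightarrow> dist (G (x, y)) (G (x0, y)) < e / m"
      using uniform_near_compact[OF U assms K x0, of "e / m"] e m by auto
    show "\<exists>d>0. \<forall>x'. dist x' x0 < d \<longrightarrow> dist (LINT y:K|lborel. G (x', y)) (LINT y:K|lborel. G (x0, y)) < e"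
    proof (intro exI conjI allI impI)
      fix x assume "dist x x0 < d"
      then have x: "x \<in> ball x0 d" "x \<in> U" using d(2) by (auto simp: dist_commute)
      have c: "continuous_on K (\<lambda>y. G (x, y))" "continuous_on K (\<lambda>y. G (x0, y))"
        by (rule slice_continuous[OF assms x(2)], rule slice_continuous[OF assms x0])
      have "dist (LINT y:K|lborel. G (x, y)) (LINT y:K|lborel. G (x0, y)) = norm (LINT y:K|lborel. G (x, y) - G (x0, y))"
        unfolding dist_norm by (subst set_integral_diff) (use c K in \<open>auto intro: compact_set_integrable\<close>)
      also have "\<dots> \<le> e / m * measure lborel K"
        by (rule compact_integral_bound[OF K(1)])
          (use c d(3)[OF x(1)] in \<open>auto intro!: continuous_intros simp: dist_norm less_imp_le\<close>)
      also have "\<dots> < e / m * m" using e m by (intro mult_strict_left_mono) (auto simp: m_def)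
      finally show "dist (LINT y:K|lborel. G (x, y)) (LINT y:K|lborel. G (x0, y)) < e" using m by simp
    qed (rule d(1))
  qed
qed

text \<open>By the mean value inequality, the remainder of the linear approximation is bounded by the
  oscillation of the partial derivatives, which is small uniformly over the compact set.\<close>

lemma parametric_integral_derivative:
  fixes G :: "'a \<times> 'b \<Rightarrow> 'c::euclidean_space"
  assumes der: "\<And>z. z \<in> U \<times> V \<Longrightarrow> (G has_derivative G' z) (at z)"
    and cont: "\<And>w. continuous_on (U \<times> V) (\<lambda>z. G' z w)" and x0: "x0 \<in> U"
  shows "((\<lambda>x. LINT y:K|lborel. G (x, y)) has_derivative (\<lambda>v. LINT y:K|lborel. G' (x0, y) (v, 0))) (at x0)"
proof -
  let ?L = "\<lambda>v. LINT y:K|lborel. G' (x0, y) (v, 0)"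
  have lin: "linear (G' z)" if "z \<in> U \<times> V" for z
    using der[OF that] has_derivative_linear by blast
  have G_cont: "continuous_on (U \<times> V) G"
    using der by (auto intro!: continuous_at_imp_continuous_on has_derivative_continuous)
  have sl: "continuous_on K (\<lambda>y. G' (x, y) w)" if "x \<in> U" for x w
    by (rule slice_continuous[OF cont that])
  have int: "set_integrable lborel K (\<lambda>y. G' (x0, y) w)" for w
    by (rule compact_set_integrable[OF K(1) sl[OF x0]])
  have KV: "(x, y) \<in> U \<times> V" if "x \<in> U" "y \<in> K" for x y using that K by auto
  have linL: "linear ?L"
  proof (rule linearI)
    fix v w
    have "?L (v + w) = (LINT y:K|lborel. G' (x0, y) (v, 0) + G' (x0, y) (w, 0))"
    proof (rule set_lebesgue_integral_cong)
      show "K \<in> sets lborel" using K by (simp add: borel_compact)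
      show "\<forall>y. y \<in> K \<longrightarrow> G' (x0, y) (v + w, 0) = G' (x0, y) (v, 0) + G' (x0, y) (w, 0)"
        using linear_add[OF lin[OF KV[OF x0]], of _ "(v, 0)" "(w, 0)"] by simp
    qed
    then show "?L (v + w) = ?L v + ?L w" using set_integral_add[OF int int] by simp
  next
    fix r v
    have "?L (r *\<^sub>R v) = (LINT y:K|lborel. r *\<^sub>R G' (x0, y) (v, 0))"
    proof (rule set_lebesgue_integral_cong)
      show "K \<in> sets lborel" using K by (simp add: borel_compact)
      show "\<forall>y. y \<in> K \<longrightarrow> G' (x0, y) (r *\<^sub>R v, 0) = r *\<^sub>R G' (x0, y) (v, 0)"
        using linear_scale[OF lin[OF KV[OF x0]], of _ r "(v, 0)"] by simp
    qed
    then show "?L (r *\<^sub>R v) = r *\<^sub>R ?L v" by simp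
  qed
  show ?thesis
    unfolding has_derivative_at_alt
  proof (intro conjI allI impI)
    show "bounded_linear ?L" using linL by (simp add: linear_conv_bounded_linear)
    fix e :: real assume e: "0 < e"
    \<comment> \<open>the summand \<open>1\<close> makes \<open>m\<close> positive even if \<open>K\<close> is a null set\<close>
    define m where "m = measure lborel K + 1"
    define n where "n = real DIM('a) + 1"
    have m: "m > 0" and n: "n > 0" by (simp_all add: m_def n_def add_nonneg_pos)
    have "\<forall>b. \<exists>d>0. ball x0 d \<subseteq> U \<and>
      (\<forall>x\<in>ball x0 d. \<forall>y\<in>K. dist (G' (x, y) (b, 0)) (G' (x0, y) (b, 0)) < e / m / n)"
    proof
      fix b
      obtain d where "0 < d" "ball x0 d \<subseteq> U"
        "\<And>x y. x \<in> ball x0 d \<Longrightarrow> y \<in> K \<Longrightarrow> dist (G' (x, y) (b, 0)) (G' (x0, y) (b, 0)) < e / m / n"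
        by (rule uniform_near_compact[OF U cont[of "(b, 0)"] K x0, of "e / m / n"]) (use e m n in auto)
      then show "\<exists>d>0. ball x0 d \<subseteq> U \<and>
        (\<forall>x\<in>ball x0 d. \<forall>y\<in>K. dist (G' (x, y) (b, 0)) (G' (x0, y) (b, 0)) < e / m / n)" by blast
    qed
    then obtain \<delta> where \<delta>: "\<And>b. \<delta> b > 0" "\<And>b. ball x0 (\<delta> b) \<subseteq> U"
      "\<And>b x y. x \<in> ball x0 (\<delta> b) \<Longrightarrow> y \<in> K \<Longrightarrow> dist (G' (x, y) (b, 0)) (G' (x0, y) (b, 0)) < e / m / n"
      by metis
    define d where "d = Min (\<delta> ` Basis)"
    have d: "d > 0" "\<And>b. b \<in> Basis \<Longrightarrow> d \<le> \<delta> b" unfolding d_def using \<delta>(1) by auto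
    have dU: "ball x0 d \<subseteq> U" using d(2)[OF SOME_Basis] \<delta>(2)[of "SOME b. b \<in> Basis"] by auto
    have rem: "norm (G (x, y) - G (x0, y) - G' (x0, y) (x - x0, 0)) \<le> e / m * norm (x - x0)"
      if x: "x \<in> ball x0 d" and y: "y \<in> K" for x y
    proof -
      let ?q = "\<lambda>x. G (x, y) - G' (x0, y) (x - x0, 0)"
      let ?q' = "\<lambda>x v. G' (x, y) (v, 0) - G' (x0, y) (v, 0)"
      have lin0: "linear (\<lambda>v. G' (x, y) (v, 0))" if "x \<in> U" for x
      proof -
        have "linear (\<lambda>v::'a. (v, 0::'b))" by (auto intro!: linearI)
        from linear_compose[OF this lin[OF KV[OF that y]]] show ?thesis by (simp add: comp_def)
      qed
      have qd: "(?q has_derivative ?q' x) (at x within ball x0 d)" if "x \<in> ball x0 d" for x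
      proof -
        have xU: "x \<in> U" using that dU by blast
        have 1: "((\<lambda>x. (x, y)) has_derivative (\<lambda>v. (v, 0))) (at x)" by (auto intro!: derivative_eq_intros)
        have 2: "((\<lambda>x. G (x, y)) has_derivative (\<lambda>v. G' (x, y) (v, 0))) (at x)"
          using has_derivative_compose[OF 1 der[OF KV[OF xU y]]] .
        have 3: "((\<lambda>x. x - x0) has_derivative (\<lambda>v. v)) (at x)" by (auto intro!: derivative_eq_intros)
        have 4: "((\<lambda>x. G' (x0, y) (x - x0, 0)) has_derivative (\<lambda>v. G' (x0, y) (v, 0))) (at x)"
          using has_derivative_compose[OF 3 linear_imp_has_derivative[OF lin0[OF x0]]] .
        show ?thesis by (rule has_derivative_at_withinI[OF has_derivative_diff[OF 2 4]])
      qed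
      have "norm (?q x - ?q x0) \<le> e / m * norm (x - x0)"
      proof (rule differentiable_bound[OF convex_ball qd _ x])
        show "x0 \<in> ball x0 d" using d(1) by simp
        fix x assume x: "x \<in> ball x0 d"
        then have xU: "x \<in> U" using dU by blast
        have linq: "linear (?q' x)" by (rule linear_compose_sub[OF lin0[OF xU] lin0[OF x0]])
        show "onorm (?q' x) \<le> e / m"
        proof (rule onorm_le)
          fix v
          have "norm (?q' x v) = norm (\<Sum>b\<in>Basis. (v \<bullet> b) *\<^sub>R ?q' x b)"
            by (subst linear_basis_expansion[OF linq]) simp
          also have "\<dots> \<le> (\<Sum>b\<in>(Basis::'a set). norm v * (e / m / n))"
          proof (rule order_trans[OF norm_sum], rule sum_mono)
            fix b :: 'a assume b: "b \<in> Basis"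
            have "norm (?q' x b) \<le> e / m / n"
              using \<delta>(3)[of x b y] x y d(2)[OF b] by (simp add: dist_norm less_imp_le)
            then show "norm ((v \<bullet> b) *\<^sub>R ?q' x b) \<le> norm v * (e / m / n)"
              unfolding norm_scaleR real_norm_def by (intro mult_mono Basis_le_norm b) simp_all
          qed
          also have "\<dots> = (real DIM('a) / n) * (e / m * norm v)" by (simp add: mult_ac)
          also have "\<dots> \<le> 1 * (e / m * norm v)"
            using e m n by (intro mult_right_mono) (auto simp: n_def)
          finally show "norm (?q' x v) \<le> e / m * norm v" by simp
        qed
      qed
      then show ?thesis using linear_0[OF lin0[OF x0]] by (simp add: algebra_simps)
    qed
    show "\<exists>d>0. \<forall>x. norm (x - x0) < d \<longrightarrow>
      norm ((LINT y:K|lborel. G (x, y)) - (LINT y:K|lborel. G (x0, y)) - ?L (x - x0)) \<le> e * norm (x - x0)"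
    proof (intro exI conjI allI impI)
      show "d > 0" by (rule d(1))
      fix x assume "norm (x - x0) < d"
      then have x: "x \<in> ball x0 d" "x \<in> U" using dU by (auto simp: dist_norm norm_minus_commute)
      have c: "continuous_on K (\<lambda>y. G (x, y))" "continuous_on K (\<lambda>y. G (x0, y))"
        by (rule slice_continuous[OF G_cont x(2)], rule slice_continuous[OF G_cont x0])
      note i = compact_set_integrable[OF K(1) c(1)] compact_set_integrable[OF K(1) c(2)]
      have "(LINT y:K|lborel. G (x, y)) - (LINT y:K|lborel. G (x0, y)) - ?L (x - x0)
        = (LINT y:K|lborel. G (x, y) - G (x0, y) - G' (x0, y) (x - x0, 0))"
        using set_integral_diff[OF set_integral_diff(1)[OF i] int] set_integral_diff(2)[OF i] by simp
      also have "norm \<dots> \<le> (e / m * norm (x - x0)) * measure lborel K"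
        by (rule compact_integral_bound[OF K(1) _ rem[OF x(1)]]) (intro continuous_on_diff c sl x0)
      also have "\<dots> \<le> (e / m * norm (x - x0)) * m"
        using e m by (intro mult_left_mono) (auto simp: m_def)
      finally show "norm ((LINT y:K|lborel. G (x, y)) - (LINT y:K|lborel. G (x0, y)) - ?L (x - x0)) \<le> e * norm (x - x0)"
        using m by simp
    qed
  qed
qed

text \<open>Differentiation under the integral sign, iterated.\<close>

lemma smooth_on_parametric_integral:
  fixes G :: "'a \<times> 'b \<Rightarrow> 'c::euclidean_space"
  assumes "smooth_on G (U \<times> V)"
  shows "smooth_on (\<lambda>x. LINT y:K|lborel. G (x, y)) U"
proof -
  have "Ck_on k (\<lambda>x. LINT y:K|lborel. G (x, y)) U" if "smooth_on G (U \<times> V)" for k and G :: "'a \<times> 'b \<Rightarrow> 'c"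
    using that
  proof (induction k arbitrary: G)
    case 0
    then show ?case using parametric_integral_continuous[OF smooth_on_continuous_on[OF 0]] by simp
  next
    case (Suc k)
    show ?case
    proof (rule Ck_on_SucI[OF U])
      show "((\<lambda>x. LINT y:K|lborel. G (x, y)) has_derivative
          (\<lambda>v. LINT y:K|lborel. frechet_derivative G (at (x, y)) (v, 0))) (at x)" if "x \<in> U" for x
        by (rule parametric_integral_derivative[OF smooth_on_has_derivative[OF Suc.prems] _ that])
          (auto intro: smooth_on_continuous_on smooth_on_derivative Suc.prems)
      show "Ck_on k (\<lambda>x. LINT y:K|lborel. frechet_derivative G (at (x, y)) (v, 0)) U" for v
        by (rule Suc.IH[OF smooth_on_derivative[OF Suc.prems]])
    qed
  qed
  then show ?thesis using assms by (simp add: smooth_on_def)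
qed

end

section \<open>The measure on the indicatrix\<close>

text \<open>The segment from the identity to a positive definite matrix contains no singular matrix.\<close>

lemma det_positive_definite:
  fixes P :: "real^'n^'n"
  assumes "\<And>w. w \<noteq> 0 \<Longrightarrow> 0 < w \<bullet> (P *v w)"
  shows "0 < det P"
proof (rule ccontr)
  assume neg: "\<not> 0 < det P"
  define Q where "Q t = (\<chi> i j. (1 - t) * mat 1 $ i $ j + t * P $ i $ j)" for t :: real
  have Qv: "Q t *v w = (1 - t) *\<^sub>R w + t *\<^sub>R (P *v w)" for t w
  proof -
    have "Q t = (1 - t) *\<^sub>R mat 1 + t *\<^sub>R P" by (simp add: Q_def vec_eq_iff)
    then show ?thesis by (simp add: matrix_vector_mult_add_rdistrib scaleR_matrix_vector_assoc[symmetric])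
  qed
  have nz: "det (Q t) \<noteq> 0" if t: "0 \<le> t" "t \<le> 1" for t
  proof -
    have "w = 0" if w: "Q t *v w = 0" for w
    proof (rule ccontr)
      assume w0: "w \<noteq> 0"
      have "0 = w \<bullet> (Q t *v w)" using w by simp
      also have "\<dots> = (1 - t) * (w \<bullet> w) + t * (w \<bullet> (P *v w))" by (simp add: Qv inner_add_right)
      also have "\<dots> > 0"
      proof (cases "t = 0")
        case False
        then have "0 < t * (w \<bullet> (P *v w))" using assms[OF w0] t by simp
        moreover have "0 \<le> (1 - t) * (w \<bullet> w)" using t by simp
        ultimately show ?thesis by simp
      qed (use w0 in simp)
      finally show False by simp
    qed
    then have "invertible (Q t)" using matrix_left_invertible_ker invertible_left_inverse by blast
    then show ?thesis using invertible_det_nz by blast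
  qed
  have "continuous_on {0..1} (\<lambda>t. det (Q t))"
    unfolding det_def Q_def by (intro continuous_intros)
  moreover have "Q 0 = mat 1" "Q 1 = P" by (simp_all add: Q_def vec_eq_iff)
  ultimately obtain t where "0 \<le> t" "t \<le> 1" "det (Q t) = 0"
    using IVT2'[of "\<lambda>t. det (Q t)" 1 0 0] neg by auto
  then show False using nz by blast
qed

text \<open>A measurable set is cut along the members of the cover, one at a time.\<close>

lemma measure_eqI_finite_cover:
  assumes sets: "sets \<mu> = sets \<nu>" and J: "finite J" and B: "\<And>j. j \<in> J \<Longrightarrow> B j \<in> sets \<mu>"
    and cover: "space \<mu> \<subseteq> (\<Union>j\<in>J. B j)"
    and eq: "\<And>j X. j \<in> J \<Longrightarrow> X \<in> sets \<mu> \<Longrightarrow> X \<subseteq> B j \<Longrightarrow> emeasure \<mu> X = emeasure \<nu> X"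
  shows "\<mu> = \<nu>"
proof (rule measure_eqI[OF sets])
  have *: "emeasure \<mu> X = emeasure \<nu> X" if "I \<subseteq> J" "X \<in> sets \<mu>" "X \<subseteq> (\<Union>j\<in>I. B j)" for I X
    using finite_subset[OF that(1) J] that
  proof (induction I arbitrary: X rule: finite_induct)
    case (insert i I)
    have Bi: "B i \<in> sets \<mu>" using B insert.prems by auto
    have 1: "emeasure \<mu> (X \<inter> B i) = emeasure \<nu> (X \<inter> B i)"
      by (rule eq[of i]) (use insert.prems Bi in auto)
    have 2: "emeasure \<mu> (X - B i) = emeasure \<nu> (X - B i)"
      by (rule insert.IH) (use insert.prems Bi in auto)
    have "emeasure \<mu> (X \<inter> B i) + emeasure \<mu> (X - B i) = emeasure \<mu> X"
      using plus_emeasure[of "X \<inter> B i" \<mu> "X - B i"] insert.prems Bi by (auto simp: Int_Diff_Un)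
    moreover have "emeasure \<nu> (X \<inter> B i) + emeasure \<nu> (X - B i) = emeasure \<nu> X"
      using plus_emeasure[of "X \<inter> B i" \<nu> "X - B i"] insert.prems Bi sets by (auto simp: Int_Diff_Un)
    ultimately show ?case using 1 2 by simp
  qed simp
  fix X assume "X \<in> sets \<mu>"
  then show "emeasure \<mu> X = emeasure \<nu> X"
    using *[OF order_refl] cover sets.sets_into_space by blast
qed

context
  fixes M :: "'p set" and A :: "('p, real^'n::finite) chart set" and F :: "('p, 'n) tpoint \<Rightarrow> real"
  assumes finsler: "finsler_space M A F"
begin

definition fibre_norm :: "('p, real^'n) chart \<Rightarrow> 'p \<Rightarrow> real^'n \<Rightarrow> real" where
  "fibre_norm c p y = F_coord A F c (snd c p, y)"

definition fibre_density :: "('p, real^'n) chart \<Rightarrow> 'p \<Rightarrow> real^'n \<Rightarrow> real" where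
  "fibre_density c p y = sqrt (det (fund_tensor A F c (snd c p, y)))"

definition indicatrix_weight :: "('p, real^'n) chart \<Rightarrow> 'p \<Rightarrow> real^'n \<Rightarrow> real" where
  "indicatrix_weight c p = polar_weight (fibre_norm c p) (fibre_density c p)"

text \<open>The image of a density on the shell under the radial projection. Up to the normalization, the
  measure of a part of the indicatrix is the weighted Lebesgue measure of the cone over it.\<close>

definition polar_measure :: "('p, real^'n) chart \<Rightarrow> 'p \<Rightarrow> ('p, real^'n) tvec measure" where
  "polar_measure c p = distr (density (restrict_space lborel shell) (\<lambda>y. ennreal (indicatrix_weight c p y)))
     (vimage_algebra (indicatrix A F p) (\<lambda>v. v c) borel) (\<lambda>y. tvec_of A c p (y /\<^sub>R fibre_norm c p y))"

lemma det_fund_tensor_pos: "c \<in> A \<Longrightarrow> z \<in> slit_dom c \<Longrightarrow> 0 < det (fund_tensor A F c z)"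
  by (rule det_positive_definite[OF fund_tensor_pos[OF finsler]])

context
  fixes c :: "('p, real^'n) chart" and p :: 'p
  assumes c: "c \<in> charts_at A p"
begin

lemma charts_at_atlas: "c \<in> A" and charts_at_domain: "p \<in> fst c" and charts_at_point: "p \<in> M"
  using c chart_domain_subset[OF finsler_atlas[OF finsler]] unfolding charts_at_def by blast+

lemma fibre_in: "y \<noteq> 0 \<Longrightarrow> (snd c p, y) \<in> slit_dom c"
  using charts_at_domain by auto

lemma fibre_continuous:
  fixes h :: "_ \<Rightarrow> 'b::topological_space"
  assumes "continuous_on (slit_dom c) h"
  shows "continuous_on (- {0}) (\<lambda>y. h (snd c p, y))"
  by (rule continuous_on_compose2[OF assms]) (use fibre_in in \<open>auto intro!: continuous_intros\<close>)

lemma fibre_props: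
  shows "\<And>y. y \<noteq> 0 \<Longrightarrow> 0 < fibre_norm c p y"
    and "continuous_on (- {0}) (fibre_norm c p)"
    and "\<And>y r. y \<noteq> 0 \<Longrightarrow> 0 < r \<Longrightarrow> fibre_norm c p (r *\<^sub>R y) = r * fibre_norm c p y"
    and "\<And>y. y \<noteq> 0 \<Longrightarrow> 0 < fibre_density c p y"
    and "continuous_on (- {0}) (fibre_density c p)"
    and "\<And>y r. y \<noteq> 0 \<Longrightarrow> 0 < r \<Longrightarrow> fibre_density c p (r *\<^sub>R y) = fibre_density c p y"
proof -
  show "0 < fibre_norm c p y" if "y \<noteq> 0" for y
    unfolding fibre_norm_def by (rule F_coord_pos[OF finsler charts_at_atlas fibre_in[OF that]])
  show "continuous_on (- {0}) (fibre_norm c p)"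
    unfolding fibre_norm_def[abs_def]
    by (rule fibre_continuous[OF smooth_on_continuous_on[OF smooth_F_coord[OF finsler charts_at_atlas]]])
  show "fibre_norm c p (r *\<^sub>R y) = r * fibre_norm c p y" if "y \<noteq> 0" "0 < r" for y r
    using F_coord_homogeneous[OF finsler charts_at_atlas] fibre_in[OF that(1)] that(2)
    unfolding homogeneous_on_def fibre_norm_def by force
  show "0 < fibre_density c p y" if "y \<noteq> 0" for y
    unfolding fibre_density_def using det_fund_tensor_pos[OF charts_at_atlas fibre_in[OF that]] by simp
  have "continuous_on (slit_dom c) (\<lambda>z. sqrt (det (fund_tensor A F c z)))"
    by (rule continuous_on_real_sqrt, rule smooth_on_continuous_on)
      (intro smooth_on_det open_slit_dom[OF finsler charts_at_atlas] smooth_fund_tensor[OF finsler charts_at_atlas])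
  then show "continuous_on (- {0}) (fibre_density c p)"
    unfolding fibre_density_def[abs_def] by (rule fibre_continuous)
  show "fibre_density c p (r *\<^sub>R y) = fibre_density c p y" if "y \<noteq> 0" "0 < r" for y r
  proof -
    have "fund_tensor A F c (snd c p, r *\<^sub>R y) $ i $ j = fund_tensor A F c (snd c p, y) $ i $ j" for i j
      using fund_tensor_homogeneous[OF finsler charts_at_atlas, of i j] fibre_in[OF that(1)] that(2)
      unfolding homogeneous_on_def by force
    then have "fund_tensor A F c (snd c p, r *\<^sub>R y) = fund_tensor A F c (snd c p, y)" by (simp add: vec_eq_iff)
    then show ?thesis by (simp add: fibre_density_def)
  qed
qed

lemma indicatrix_weight_pos: "y \<noteq> 0 \<Longrightarrow> 0 < indicatrix_weight c p y"
  unfolding indicatrix_weight_def by (rule polar_weight_pos[OF fibre_props])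

lemma indicatrix_weight_cont: "continuous_on (- {0}) (indicatrix_weight c p)"
  unfolding indicatrix_weight_def by (rule polar_weight_cont[OF fibre_props])

lemma fibre_norm_F: "fibre_norm c p y = F (p, tvec_of A c p y)"
  unfolding fibre_norm_def
  using F_coord_eq[OF finsler charts_at_atlas, of "snd c p" y] charts_at_domain chart_inv_chart[OF finsler_atlas[OF finsler] charts_at_atlas charts_at_domain] by simp

lemma indicatrix_coordinate:
  assumes "v \<in> indicatrix A F p"
  shows "v c \<noteq> 0" "fibre_norm c p (v c) = 1" "tvec_of A c p (v c) = v"
proof -
  have v: "v \<in> tangent_space A p" "F (p, v) = 1" using assms by (auto simp: indicatrix_def)
  show 1: "tvec_of A c p (v c) = v" by (rule tvec_of_component[OF finsler_atlas[OF finsler] v(1) c])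
  show "fibre_norm c p (v c) = 1" unfolding fibre_norm_F 1 by (rule v(2))
  have hom: "\<forall>(x, v) \<in> tangent_bundle M A. \<forall>r\<ge>0. F (x, \<lambda>c. r *\<^sub>R v c) = r * F (x, v)"
    using finsler unfolding finsler_space_def by (elim conjE)
  have "(p, v) \<in> tangent_bundle M A" using v charts_at_point by (simp add: tangent_bundle_def)
  from bspec[OF hom this] have "F (p, \<lambda>c. 0 *\<^sub>R v c) = 0 * F (p, v)" by blast
  then have "F (p, \<lambda>_. 0) = 0" by simp
  then have "v \<noteq> (\<lambda>_. 0)" using v(2) by auto
  then show "v c \<noteq> 0" using tangent_nonzero[OF finsler_atlas[OF finsler] v(1) c] by blast
qed

lemma indicatrix_slit: "v \<in> indicatrix A F p \<Longrightarrow> (p, v) \<in> slit_bundle M A"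
  using indicatrix_coordinate(1)[of v] charts_at_point unfolding slit_bundle_iff[OF finsler_atlas[OF finsler]] by (auto simp: indicatrix_def)

lemma radial_projection:
  assumes "y \<noteq> 0"
  shows "tvec_of A c p (y /\<^sub>R fibre_norm c p y) \<in> indicatrix A F p"
    and "tvec_of A c p (y /\<^sub>R fibre_norm c p y) c = y /\<^sub>R fibre_norm c p y"
proof -
  show "tvec_of A c p (y /\<^sub>R fibre_norm c p y) c = y /\<^sub>R fibre_norm c p y"
    by (rule tvec_of_self[OF finsler_atlas[OF finsler] c])
  have "fibre_norm c p (y /\<^sub>R fibre_norm c p y) = 1"
    using fibre_props(3)[OF assms, of "inverse (fibre_norm c p y)"] fibre_props(1)[OF assms] by simp
  then show "tvec_of A c p (y /\<^sub>R fibre_norm c p y) \<in> indicatrix A F p"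
    unfolding indicatrix_def fibre_norm_F using tvec_of_in[OF finsler_atlas[OF finsler] c] by simp
qed

lemma radial_continuous: "continuous_on (- {0}) (\<lambda>y. y /\<^sub>R fibre_norm c p y)"
  by (intro continuous_intros fibre_props(2)) (use fibre_props(1) in \<open>auto simp: less_imp_neq[symmetric]\<close>)

lemma indicatrix_image: "(\<lambda>v. v c) ` indicatrix A F p = {y. y \<noteq> 0 \<and> fibre_norm c p y = 1}"
proof (intro equalityI subsetI)
  fix y assume y: "y \<in> {y. y \<noteq> 0 \<and> fibre_norm c p y = 1}"
  then have "y = tvec_of A c p (y /\<^sub>R fibre_norm c p y) c" "tvec_of A c p (y /\<^sub>R fibre_norm c p y) \<in> indicatrix A F p"
    using radial_projection[of y] by auto
  then show "y \<in> (\<lambda>v. v c) ` indicatrix A F p" by blast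
qed (use indicatrix_coordinate in auto)

lemma indicatrix_density_eq:
  assumes "\<phi> t \<noteq> 0" "fibre_norm c p (\<phi> t) = 1"
  shows "indicatrix_density A F c (snd c p) k \<phi> t = fibre_density c p (\<phi> t) *
    \<bar>det (\<chi> i j. (if j = k then \<phi> t else frechet_derivative \<phi> (at t) (axis j 1)) $ i)\<bar>"
proof -
  have f: "F_coord A F c (snd c p, \<phi> t) = 1" using assms(2) by (simp add: fibre_norm_def)
  have dy: "delta_y A F c z (if b then (0, u) else (0, v)) = (if b then u else v)" for z b u v
    by (simp add: delta_y_def)
  then show ?thesis
    unfolding indicatrix_density_def Let_def vol_form_def f fibre_density_def inverse_1 scaleR_one
    using det_fund_tensor_pos[OF charts_at_atlas fibre_in[OF assms(1)]]
    by (simp add: abs_mult dy)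
qed

lemma sets_chart_algebra:
  "X \<in> sets (vimage_algebra (indicatrix A F p) (\<lambda>v. v c) borel) \<longleftrightarrow>
     (\<exists>E\<in>sets borel. X = {v \<in> indicatrix A F p. v c \<in> E})"
proof -
  have "sets (vimage_algebra (indicatrix A F p) (\<lambda>v. v c) borel) = {(\<lambda>v. v c) -` E \<inter> indicatrix A F p | E. E \<in> sets borel}"
    by (rule sets_vimage_algebra2) simp
  moreover have "(\<lambda>v. v c) -` E \<inter> indicatrix A F p = {v \<in> indicatrix A F p. v c \<in> E}" for E by auto
  ultimately show ?thesis by auto
qed

lemma radial_measurable:
  "(\<lambda>y. tvec_of A c p (y /\<^sub>R fibre_norm c p y)) \<in>
    measurable (restrict_space lborel shell) (vimage_algebra (indicatrix A F p) (\<lambda>v. v c) borel)"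
proof (rule measurable_vimage_algebra2)
  show "(\<lambda>y. tvec_of A c p (y /\<^sub>R fibre_norm c p y)) \<in> space (restrict_space lborel shell) \<rightarrow> indicatrix A F p"
    using radial_projection(1)[OF shell_nonzero] by (auto simp: space_restrict_space)
  have "continuous_on shell (\<lambda>y. y /\<^sub>R fibre_norm c p y)"
    by (rule continuous_on_subset[OF radial_continuous]) (use shell_nonzero in auto)
  then have "(\<lambda>y. y /\<^sub>R fibre_norm c p y) \<in> measurable (restrict_space borel shell) borel"
    by (rule borel_measurable_continuous_on_restrict)
  moreover have "sets (restrict_space borel shell) = sets (restrict_space lborel (shell :: (real^'n) set))"
    by (rule sets_restrict_space_cong) simp
  ultimately have m: "(\<lambda>y. y /\<^sub>R fibre_norm c p y) \<in> measurable (restrict_space lborel shell) borel"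
    by (metis measurable_cong_sets)
  show "(\<lambda>y. tvec_of A c p (y /\<^sub>R fibre_norm c p y) c) \<in> measurable (restrict_space lborel shell) borel"
    unfolding tvec_of_self[OF finsler_atlas[OF finsler] c] by (rule m)
qed

lemma weight_measurable: "(\<lambda>y. indicatrix_weight c p y) \<in> borel_measurable (restrict_space lborel shell)"
proof -
  have "continuous_on shell (indicatrix_weight c p)"
    by (rule continuous_on_subset[OF indicatrix_weight_cont]) (use shell_nonzero in auto)
  then have "indicatrix_weight c p \<in> measurable (restrict_space borel shell) borel"
    by (rule borel_measurable_continuous_on_restrict)
  moreover have "sets (restrict_space borel shell) = sets (restrict_space lborel (shell :: (real^'n) set))"
    by (rule sets_restrict_space_cong) simp
  ultimately show ?thesis by (metis measurable_cong_sets)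
qed

lemma emeasure_polar_measure:
  assumes E: "E \<in> sets borel"
  shows "emeasure (polar_measure c p) {v \<in> indicatrix A F p. v c \<in> E} =
    (\<integral>\<^sup>+y. ennreal (indicator {y. y \<in> shell \<and> y /\<^sub>R fibre_norm c p y \<in> E} y * indicatrix_weight c p y) \<partial>lborel)"
proof -
  let ?T = "\<lambda>y. tvec_of A c p (y /\<^sub>R fibre_norm c p y)" and ?L = "restrict_space lborel (shell :: (real^'n) set)"
  let ?X = "{v \<in> indicatrix A F p. v c \<in> E}"
  have X: "?X \<in> sets (vimage_algebra (indicatrix A F p) (\<lambda>v. v c) borel)"
    using sets_chart_algebra E by blast
  have pre: "?T -` ?X \<inter> space ?L = {y. y \<in> shell \<and> y /\<^sub>R fibre_norm c p y \<in> E}"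
    using radial_projection[OF shell_nonzero] by (auto simp: space_restrict_space)
  have preS: "{y. y \<in> shell \<and> y /\<^sub>R fibre_norm c p y \<in> E} \<in> sets ?L"
    using measurable_sets[OF radial_measurable X] unfolding pre .
  have "emeasure (polar_measure c p) ?X = emeasure (density ?L (\<lambda>y. ennreal (indicatrix_weight c p y))) {y. y \<in> shell \<and> y /\<^sub>R fibre_norm c p y \<in> E}"
    unfolding polar_measure_def pre[symmetric]
    by (subst emeasure_distr) (use radial_measurable X in auto)
  also have "\<dots> = (\<integral>\<^sup>+y. ennreal (indicatrix_weight c p y) * indicator {y. y \<in> shell \<and> y /\<^sub>R fibre_norm c p y \<in> E} y \<partial>?L)"
    by (rule emeasure_density[OF _ preS]) (use weight_measurable in measurable)
  also have "\<dots> = (\<integral>\<^sup>+y. ennreal (indicatrix_weight c p y) * indicator {y. y \<in> shell \<and> y /\<^sub>R fibre_norm c p y \<in> E} y * indicator shell y \<partial>lborel)"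
    by (rule nn_integral_restrict_space) simp
  also have "\<dots> = (\<integral>\<^sup>+y. ennreal (indicator {y. y \<in> shell \<and> y /\<^sub>R fibre_norm c p y \<in> E} y * indicatrix_weight c p y) \<partial>lborel)"
    by (rule nn_integral_cong) (auto simp: indicator_def)
  finally show ?thesis .
qed

lemma polar_measure_param:
  assumes "hypersurface_param k W \<phi> ((\<lambda>v. v c) ` indicatrix A F p)"
    and E: "E \<in> sets borel" "E \<subseteq> \<phi> ` (W \<inter> coord_hyperplane k)"
  shows "emeasure (polar_measure c p) {v \<in> indicatrix A F p. v c \<in> E} =
    (\<integral>\<^sup>+ t \<in> {t \<in> W \<inter> coord_hyperplane k. \<phi> t \<in> E}.
       ennreal (indicatrix_density A F c (snd c p) k \<phi> t) \<partial>hyperplane_measure k)"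
proof -
  have "\<phi> t \<noteq> 0 \<and> fibre_norm c p (\<phi> t) = 1" if "t \<in> W \<inter> coord_hyperplane k" for t
    using assms(1) that indicatrix_image unfolding hypersurface_param_def by blast
  then have dens: "indicatrix_density A F c (snd c p) k \<phi> t = fibre_density c p (\<phi> t) *
    \<bar>det (\<chi> i j. (if j = k then \<phi> t else frechet_derivative \<phi> (at t) (axis j 1)) $ i)\<bar>"
    if "t \<in> W \<inter> coord_hyperplane k" for t using indicatrix_density_eq that by blast
  have S: "y \<noteq> 0 \<and> fibre_norm c p y = 1" if "y \<in> (\<lambda>v. v c) ` indicatrix A F p" for y
    using that unfolding indicatrix_image by simp
  show ?thesis
    unfolding emeasure_polar_measure[OF E(1)] indicatrix_weight_def
    by (rule trans[OF polar_formula[OF fibre_props assms(1) S E]])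
      (auto intro!: nn_integral_cong simp: indicator_def dens)
qed

end

end

context
  fixes M :: "'p set" and A :: "('p, real^'n::finite) chart set" and F :: "('p, 'n) tpoint \<Rightarrow> real"
  assumes finsler: "finsler_space M A F"
begin

subsection \<open>Independence of the chart\<close>

context
  fixes c d :: "('p, real^'n) chart" and p :: 'p
  assumes c: "c \<in> charts_at A p" and d: "d \<in> charts_at A p"
begin

lemma jac_inverse: "jac c d p (jac d c p v) = v" "jac d c p (jac c d p v) = v"
  using jac_compose[OF finsler_atlas[OF finsler] d c d] jac_self[OF finsler_atlas[OF finsler] d]
    jac_compose[OF finsler_atlas[OF finsler] c d c] jac_self[OF finsler_atlas[OF finsler] c] by simp_all

lemma jac_linear: "linear (jac c d p)" "linear (jac d c p)"
  using linear_jac[OF finsler_atlas[OF finsler]] c d by blast+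

lemma indicatrix_change: "v \<in> indicatrix A F p \<Longrightarrow> v d = jac c d p (v c)"
  using tangent_change[OF finsler_atlas[OF finsler] _ c d] by (simp add: indicatrix_def)

lemma det_jac_inverse: "\<bar>det (matrix (jac c d p))\<bar> * \<bar>det (matrix (jac d c p))\<bar> = 1"
proof -
  have "matrix (jac c d p) ** matrix (jac d c p) = matrix (\<lambda>v. v)"
    using matrix_compose[OF jac_linear(2,1)] jac_inverse(1) by (simp add: comp_def)
  then have "matrix (jac c d p) ** matrix (jac d c p) = mat 1" by (simp add: matrix_id_mat_1[unfolded id_def])
  then have "det (matrix (jac c d p)) * det (matrix (jac d c p)) = 1" by (metis det_I det_mul)
  then show ?thesis by (metis abs_mult abs_one)
qed

lemma borel_jac_preimage: "E \<in> sets borel \<Longrightarrow> jac c d p -` E \<in> sets borel"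
proof -
  assume E: "E \<in> sets borel"
  have "jac c d p \<in> borel_measurable borel"
    by (rule borel_measurable_continuous_onI,
        rule linear_continuous_on[OF linear_conv_bounded_linear[THEN iffD1, OF jac_linear(1)]])
  from measurable_sets[OF this E] show ?thesis by simp
qed

lemma chart_algebra_subset:
  "sets (vimage_algebra (indicatrix A F p) (\<lambda>v. v d) borel) \<subseteq> sets (vimage_algebra (indicatrix A F p) (\<lambda>v. v c) borel)"
proof
  fix X assume "X \<in> sets (vimage_algebra (indicatrix A F p) (\<lambda>v. v d) borel)"
  then obtain E where E: "E \<in> sets borel" "X = {v \<in> indicatrix A F p. v d \<in> E}"
    unfolding sets_chart_algebra[OF finsler d] by blast
  have "X = {v \<in> indicatrix A F p. v c \<in> jac c d p -` E}" unfolding E(2) using indicatrix_change by auto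
  then show "X \<in> sets (vimage_algebra (indicatrix A F p) (\<lambda>v. v c) borel)"
    unfolding sets_chart_algebra[OF finsler c] using borel_jac_preimage[OF E(1)] by blast
qed

text \<open>In matrix form, the transformation law of the fundamental tensor is a congruence by the
  Jacobian.\<close>

lemma fibre_density_change:
  assumes "y \<noteq> 0"
  shows "fibre_density A F c p y = \<bar>det (matrix (jac c d p))\<bar> * fibre_density A F d p (jac c d p y)"
proof -
  let ?L = "matrix (jac c d p)" and ?g = "fund_tensor A F c (snd c p, y)" and ?h = "fund_tensor A F d (snd d p, jac c d p y)"
  have mem: "c \<in> A" "d \<in> A" "p \<in> fst c" "p \<in> fst d" using c d by (auto simp: charts_at_def)
  have x: "snd c p \<in> snd c ` (fst c \<inter> fst d)" using mem by blast
  have tm: "tangent_map (transition c d) (snd c p, y) = (snd d p, jac c d p y)"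
    by (simp add: tangent_map_def transition_chart[OF finsler_atlas[OF finsler] mem(1,3)])
  have L: "jac c d p v = ?L *v v" for v by (rule fun_cong[OF matrix_vector_mul(2)[OF jac_linear(1)], symmetric])
  have "?g = transpose ?L ** ?h ** ?L"
  proof (rule matrix_eq[THEN iffD2], rule allI)
    fix b
    have "a \<bullet> (?g *v b) = a \<bullet> ((transpose ?L ** ?h ** ?L) *v b)" for a
    proof -
      have "a \<bullet> (?g *v b) = (?L *v a) \<bullet> (?h *v (?L *v b))"
        using fund_tensor_transition[OF finsler mem(1,2) x assms, of a b] unfolding tm by (simp add: L)
      also have "\<dots> = a \<bullet> (transpose ?L *v (?h *v (?L *v b)))"
        using dot_lmul_matrix[of "?h *v (?L *v b)" ?L a] by (simp only: transpose_matrix_vector inner_commute)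
      finally show ?thesis by (simp add: matrix_vector_mul_assoc matrix_mul_assoc)
    qed
    then show "?g *v b = (transpose ?L ** ?h ** ?L) *v b" using vector_eq_ldot by blast
  qed
  then have "det ?g = (det ?L)\<^sup>2 * det ?h" by (simp add: det_mul det_transpose power2_eq_square)
  then show ?thesis unfolding fibre_density_def[OF finsler] by (simp add: real_sqrt_mult)
qed

text \<open>Composition with the Jacobian turns a parametrization in the coordinates of \<open>d\<close> into one in
  the coordinates of \<open>c\<close>; the determinant that this produces cancels against the one in the
  transformation of the density.\<close>

lemma polar_measure_param_change:
  assumes param: "hypersurface_param k W \<phi> ((\<lambda>v. v d) ` indicatrix A F p)"
    and E: "E \<in> sets borel" "E \<subseteq> \<phi> ` (W \<inter> coord_hyperplane k)"
  shows "emeasure (polar_measure A F c p) {v \<in> indicatrix A F p. v d \<in> E} =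
    (\<integral>\<^sup>+ t \<in> {t \<in> W \<inter> coord_hyperplane k. \<phi> t \<in> E}.
       ennreal (indicatrix_density A F d (snd d p) k \<phi> t) \<partial>hyperplane_measure k)"
proof -
  let ?L = "jac c d p" and ?L' = "jac d c p"
  let ?H = "coord_hyperplane k :: (real^'n) set"
  define \<phi>' where "\<phi>' t = ?L' (\<phi> t)" for t
  have W: "open W" and sm: "smooth_on \<phi> W" and into: "\<phi> ` (W \<inter> ?H) \<subseteq> (\<lambda>v. v d) ` indicatrix A F p"
    and inj: "inj_on \<phi> (W \<inter> ?H)"
    and imm: "\<And>t w. t \<in> W \<inter> ?H \<Longrightarrow> w \<in> ?H \<Longrightarrow> frechet_derivative \<phi> (at t) w = 0 \<Longrightarrow> w = 0"
    using param unfolding hypersurface_param_def by auto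
  have fd: "frechet_derivative \<phi>' (at t) w = ?L' (frechet_derivative \<phi> (at t) w)" if "t \<in> W" for t w
  proof -
    have "(\<phi>' has_derivative (\<lambda>w. ?L' (frechet_derivative \<phi> (at t) w))) (at t)"
      unfolding \<phi>'_def
      by (rule has_derivative_compose[OF smooth_on_has_derivative[OF sm that] linear_imp_has_derivative[OF jac_linear(2)]])
    from frechet_derivative_eqI[OF this] show ?thesis by simp
  qed
  have param': "hypersurface_param k W \<phi>' ((\<lambda>v. v c) ` indicatrix A F p)"
    unfolding hypersurface_param_def
  proof (intro conjI ballI impI)
    show "open W" by (rule W)
    show "smooth_on \<phi>' W" unfolding \<phi>'_def by (rule smooth_on_linear_compose[OF jac_linear(2) W sm])
    show "\<phi>' ` (W \<inter> ?H) \<subseteq> (\<lambda>v. v c) ` indicatrix A F p"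
    proof (rule image_subsetI)
      fix t assume "t \<in> W \<inter> ?H"
      then obtain v where "v \<in> indicatrix A F p" "\<phi> t = v d" using into by blast
      then have "\<phi>' t = v c" "v \<in> indicatrix A F p"
        unfolding \<phi>'_def using indicatrix_change[of v] jac_inverse(2)[of "v c"] by simp_all
      then show "\<phi>' t \<in> (\<lambda>v. v c) ` indicatrix A F p" by blast
    qed
    show "inj_on \<phi>' (W \<inter> ?H)"
    proof (rule inj_onI)
      fix s t assume st: "s \<in> W \<inter> ?H" "t \<in> W \<inter> ?H" and "\<phi>' s = \<phi>' t"
      then have "?L (\<phi>' s) = ?L (\<phi>' t)" by simp
      then have "\<phi> s = \<phi> t" unfolding \<phi>'_def jac_inverse(1) .
      then show "s = t" using inj_onD[OF inj] st by blast
    qed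
    fix t w assume t: "t \<in> W \<inter> ?H" and w: "w \<in> ?H" and "frechet_derivative \<phi>' (at t) w = 0"
    then have "?L (?L' (frechet_derivative \<phi> (at t) w)) = ?L 0" using fd by auto
    then have "frechet_derivative \<phi> (at t) w = 0" unfolding jac_inverse(1) linear_0[OF jac_linear(1)] .
    then show "w = 0" by (rule imm[OF t w])
  qed
  have mem: "t \<in> W \<inter> ?H \<Longrightarrow> ?L (\<phi>' t) = \<phi> t" for t unfolding \<phi>'_def by (rule jac_inverse(1))
  have sub: "?L -` E \<subseteq> \<phi>' ` (W \<inter> ?H)"
  proof
    fix y assume "y \<in> ?L -` E"
    then obtain t where "t \<in> W \<inter> ?H" "?L y = \<phi> t" using E(2) by blast
    moreover from this have "y = \<phi>' t" unfolding \<phi>'_def using jac_inverse(2)[of y] by simp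
    ultimately show "y \<in> \<phi>' ` (W \<inter> ?H)" by blast
  qed
  have dens: "indicatrix_density A F c (snd c p) k \<phi>' t = indicatrix_density A F d (snd d p) k \<phi> t"
    if t: "t \<in> W \<inter> ?H" for t
  proof -
    have d0: "\<phi> t \<noteq> 0" "fibre_norm A F d p (\<phi> t) = 1"
      using into t indicatrix_image[OF finsler d] by blast+
    have c0: "\<phi>' t \<noteq> 0" "fibre_norm A F c p (\<phi>' t) = 1"
      using param' t indicatrix_image[OF finsler c] unfolding hypersurface_param_def by blast+
    let ?J = "\<chi> i j. (if j = k then \<phi> t else frechet_derivative \<phi> (at t) (axis j 1)) $ i"
    have "(\<chi> i j. (if j = k then \<phi>' t else frechet_derivative \<phi>' (at t) (axis j 1)) $ i) = matrix ?L' ** ?J"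
    proof -
      have L': "?L' v = matrix ?L' *v v" for v by (rule fun_cong[OF matrix_vector_mul(2)[OF jac_linear(2)], symmetric])
      have "(if j = k then \<phi>' t else frechet_derivative \<phi>' (at t) (axis j 1)) $ i = (matrix ?L' ** ?J) $ i $ j" for i j
      proof -
        have "(if j = k then \<phi>' t else frechet_derivative \<phi>' (at t) (axis j 1))
          = matrix ?L' *v (if j = k then \<phi> t else frechet_derivative \<phi> (at t) (axis j 1))"
        proof (cases "j = k")
          case True
          then show ?thesis using L'[of "\<phi> t"] by (simp only: simp_thms if_True \<phi>'_def[of t])
        next
          case False
          have "t \<in> W" using t by blast
          from fd[OF this, of "axis j 1"] False show ?thesis
            using L'[of "frechet_derivative \<phi> (at t) (axis j 1)"] by (simp only: simp_thms if_False)
        qed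
        then show ?thesis by (simp only: matrix_matrix_mult_def matrix_vector_mult_def vec_lambda_beta)
      qed
      then show ?thesis by (simp add: vec_eq_iff)
    qed
    then show ?thesis
      unfolding indicatrix_density_eq[OF finsler c, where \<phi> = \<phi>' and t = t, OF c0]
        indicatrix_density_eq[OF finsler d, where \<phi> = \<phi> and t = t, OF d0]
        fibre_density_change[OF c0(1)] mem[OF t]
      using det_jac_inverse by (simp add: det_mul abs_mult algebra_simps)
  qed
  have "{v \<in> indicatrix A F p. v d \<in> E} = {v \<in> indicatrix A F p. v c \<in> ?L -` E}"
    using indicatrix_change by auto
  then have "emeasure (polar_measure A F c p) {v \<in> indicatrix A F p. v d \<in> E} =
    (\<integral>\<^sup>+ t \<in> {t \<in> W \<inter> ?H. \<phi>' t \<in> ?L -` E}. ennreal (indicatrix_density A F c (snd c p) k \<phi>' t) \<partial>hyperplane_measure k)"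
    using polar_measure_param[OF finsler c param' borel_jac_preimage[OF E(1)] sub] by simp
  also have "\<dots> = (\<integral>\<^sup>+ t \<in> {t \<in> W \<inter> ?H. \<phi> t \<in> E}. ennreal (indicatrix_density A F d (snd d p) k \<phi> t) \<partial>hyperplane_measure k)"
    by (rule nn_integral_cong) (auto simp: indicator_def dens mem)
  finally show ?thesis .
qed

end

lemma polar_is_indicatrix_measure:
  assumes c: "c \<in> charts_at A p"
  shows "is_indicatrix_measure A F p (polar_measure A F c p)"
  unfolding is_indicatrix_measure_def
proof (intro conjI ballI allI impI)
  show "space (polar_measure A F c p) = indicatrix A F p" by (simp add: polar_measure_def[OF finsler])
  fix d assume d: "d \<in> charts_at A p"
  show "sets (polar_measure A F c p) = sets (vimage_algebra (indicatrix A F p) (\<lambda>v. v d) borel)"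
    using chart_algebra_subset[OF c d] chart_algebra_subset[OF d c] by (simp add: polar_measure_def[OF finsler])
qed (rule polar_measure_param_change[OF c])

subsection \<open>Uniqueness\<close>

lemma fibre_norm_fun: "fibre_norm A F c p = (\<lambda>y. F_coord A F c (snd c p, y))"
  by (rule ext) (rule fibre_norm_def[OF finsler])

text \<open>The indicatrix is covered by the radial projections of the \<open>2n\<close> affine hyperplanes
  \<open>y\<^sup>k = \<plusminus>1\<close>.\<close>

lemma hemisphere_param:
  fixes k :: 'n and \<sigma> :: real
  assumes c: "c \<in> charts_at A p" and \<sigma>: "\<sigma> = 1 \<or> \<sigma> = - 1"
  defines "\<phi> \<equiv> \<lambda>t. (t + \<sigma> *\<^sub>R axis k 1) /\<^sub>R fibre_norm A F c p (t + \<sigma> *\<^sub>R axis k 1)"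
    and "W \<equiv> {t. - 1 < \<sigma> * t $ k}"
  shows "hypersurface_param k W \<phi> ((\<lambda>v. v c) ` indicatrix A F p)"
    and "{y \<in> (\<lambda>v. v c) ` indicatrix A F p. 0 < \<sigma> * y $ k} \<subseteq> \<phi> ` (W \<inter> coord_hyperplane k)"
proof -
  let ?f = "fibre_norm A F c p" and ?q = "\<lambda>t. t + \<sigma> *\<^sub>R axis k (1::real)"
  let ?H = "coord_hyperplane k :: (real^'n) set"
  note f = fibre_props[OF finsler c]
  have \<sigma>2: "\<sigma> * \<sigma> = 1" "\<sigma> \<noteq> 0" using \<sigma> by auto
  have qk: "?q t $ k = t $ k + \<sigma>" for t by simp
  have nz: "?q t \<noteq> 0" if "t \<in> W" for t
  proof
    assume "?q t = 0"
    then have "?q t $ k = 0" by simp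
    then have "t $ k = - \<sigma>" unfolding qk by simp
    then show False using that \<sigma>2 by (simp add: W_def)
  qed
  have W: "open W" unfolding W_def by (intro open_Collect_less continuous_intros)
  have smf: "smooth_on ?f (- {0})"
  proof -
    have "smooth_on (\<lambda>y. (snd c p, y)) (- {0::real^'n})"
      by (intro smooth_on_Pair smooth_on_const smooth_on_id) auto
    moreover have "(\<lambda>y. (snd c p, y)) ` (- {0::real^'n}) \<subseteq> slit_dom c" using fibre_in[OF finsler c] by blast
    ultimately show ?thesis
      unfolding fibre_norm_fun
      by (intro smooth_on_compose[OF smooth_F_coord[OF finsler charts_at_atlas[OF finsler c]]] open_slit_dom[OF finsler charts_at_atlas[OF finsler c]])
        auto
  qed
  have smq: "smooth_on ?q W" by (intro smooth_on_add smooth_on_id smooth_on_const W)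
  have smb: "smooth_on (\<lambda>t. inverse (?f (?q t))) W"
  proof (rule smooth_on_inverse[OF W])
    show "?f (?q t) \<noteq> 0" if "t \<in> W" for t using f(1)[OF nz[OF that]] by simp
    show "smooth_on (\<lambda>t. ?f (?q t)) W"
      by (rule smooth_on_compose[OF smf smq W]) (use nz in auto)
  qed
  have on: "\<phi> t \<noteq> 0" "?f (\<phi> t) = 1" if "t \<in> W" for t
    using f(1)[OF nz[OF that]] f(3)[OF nz[OF that], of "inverse (?f (?q t))"] nz[OF that] unfolding \<phi>_def by auto
  show "hypersurface_param k W \<phi> ((\<lambda>v. v c) ` indicatrix A F p)"
    unfolding hypersurface_param_def
  proof (intro conjI ballI impI)
    show "open W" by (rule W)
    show "smooth_on \<phi> W" unfolding \<phi>_def by (rule smooth_on_scaleR[OF W smb smq])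
    show "\<phi> ` (W \<inter> ?H) \<subseteq> (\<lambda>v. v c) ` indicatrix A F p"
      unfolding indicatrix_image[OF finsler c] using on by auto
    show "inj_on \<phi> (W \<inter> ?H)"
    proof (rule inj_onI)
      fix s t assume s: "s \<in> W \<inter> ?H" and t: "t \<in> W \<inter> ?H" and eq: "\<phi> s = \<phi> t"
      have "\<phi> s $ k = \<phi> t $ k" using eq by simp
      then have "inverse (?f (?q s)) = inverse (?f (?q t))"
        using s t \<sigma>2 by (simp add: \<phi>_def coord_hyperplane_def)
      moreover have "?f (?q s) \<noteq> 0" using f(1)[OF nz[of s]] s by auto
      ultimately have "?q s = ?q t" using eq unfolding \<phi>_def by simp
      then show "s = t" by simp
    qed
    fix t w assume t: "t \<in> W \<inter> ?H" and w: "w \<in> ?H" and zero: "frechet_derivative \<phi> (at t) w = 0"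
    let ?b = "inverse (?f (?q t))" and ?b' = "frechet_derivative (\<lambda>t. inverse (?f (?q t))) (at t)"
    have tW: "t \<in> W" using t by blast
    have "(?q has_derivative (\<lambda>w. w)) (at t)" by (auto intro!: derivative_eq_intros)
    from has_derivative_scaleR[OF smooth_on_has_derivative[OF smb tW] this]
    have "(\<phi> has_derivative (\<lambda>w. ?b *\<^sub>R w + ?b' w *\<^sub>R ?q t)) (at t)" unfolding \<phi>_def .
    from fun_cong[OF frechet_derivative_eqI[OF this], of w] zero
    have eq: "?b *\<^sub>R w + ?b' w *\<^sub>R ?q t = 0" by (simp only:)
    then have "(?b *\<^sub>R w + ?b' w *\<^sub>R ?q t) $ k = 0" by simp
    then have "?b' w = 0" using t w \<sigma>2 by (simp add: coord_hyperplane_def)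
    then show "w = 0" using eq f(1)[OF nz[OF tW]] by auto
  qed
  show "{y \<in> (\<lambda>v. v c) ` indicatrix A F p. 0 < \<sigma> * y $ k} \<subseteq> \<phi> ` (W \<inter> ?H)"
  proof
    fix y assume "y \<in> {y \<in> (\<lambda>v. v c) ` indicatrix A F p. 0 < \<sigma> * y $ k}"
    then have y: "y \<noteq> 0" "?f y = 1" "0 < \<sigma> * y $ k" unfolding indicatrix_image[OF finsler c] by auto
    define a where "a = \<sigma> * y $ k"
    have a: "a > 0" using y by (simp add: a_def)
    let ?t = "y /\<^sub>R a - \<sigma> *\<^sub>R axis k 1"
    have "y $ k = \<sigma> * a" using \<sigma>2 by (simp add: a_def mult.assoc[symmetric])
    then have tk: "?t $ k = 0" using a by simp
    then have t: "?t \<in> W \<inter> ?H" by (simp only: W_def coord_hyperplane_def Int_iff mem_Collect_eq) simp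
    have "?q ?t = y /\<^sub>R a" by simp
    then have "\<phi> ?t = y" unfolding \<phi>_def using f(3)[OF y(1), of "inverse a"] a y(2) by simp
    then show "y \<in> \<phi> ` (W \<inter> ?H)" using t by (metis imageI)
  qed
qed

text \<open>Each of the \<open>2n\<close> open hemispheres lies in the image of one parametrization, on which the
  measure is prescribed, and together they cover the indicatrix.\<close>

lemma indicatrix_measure_unique:
  assumes c: "c \<in> charts_at A p" and \<mu>: "is_indicatrix_measure A F p \<mu>" and \<nu>: "is_indicatrix_measure A F p \<nu>"
  shows "\<mu> = \<nu>"
proof (rule measure_eqI_finite_cover)
  let ?I = "indicatrix A F p"
  let ?J = "(UNIV :: 'n set) \<times> {1, - 1 :: real}"
  let ?B = "\<lambda>(k, \<sigma>). {v \<in> ?I. v c \<in> {y. 0 < \<sigma> * y $ k}}"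
  have sets: "sets \<mu> = sets (vimage_algebra ?I (\<lambda>v. v c) borel)" "sets \<nu> = sets (vimage_algebra ?I (\<lambda>v. v c) borel)"
    and space: "space \<mu> = ?I"
    using \<mu> \<nu> c unfolding is_indicatrix_measure_def by auto
  have half: "{y :: real^'n. 0 < \<sigma> * y $ k} \<in> sets borel" for \<sigma> :: real and k :: 'n
  proof -
    have "open {y :: real^'n. 0 < \<sigma> * y $ k}" by (intro open_Collect_less continuous_intros)
    then show ?thesis by (rule borel_open)
  qed
  show "sets \<mu> = sets \<nu>" by (simp add: sets)
  show "finite ?J" by simp
  show "?B j \<in> sets \<mu>" if "j \<in> ?J" for j
    unfolding sets sets_chart_algebra[OF finsler c] using half by (cases j) auto
  show "space \<mu> \<subseteq> (\<Union>j\<in>?J. ?B j)"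
  proof
    fix v assume "v \<in> space \<mu>"
    then have v: "v \<in> ?I" by (simp add: space)
    then obtain k where "v c $ k \<noteq> 0" using indicatrix_coordinate(1)[OF finsler c v] by (auto simp: vec_eq_iff)
    then have "v \<in> ?B (k, 1) \<or> v \<in> ?B (k, - 1)" using v by auto
    then show "v \<in> (\<Union>j\<in>?J. ?B j)" by blast
  qed
  fix j X assume j: "j \<in> ?J" and X: "X \<in> sets \<mu>" "X \<subseteq> ?B j"
  obtain k \<sigma> where ks: "j = (k, \<sigma>)" "\<sigma> = 1 \<or> \<sigma> = - 1" using j by auto
  obtain E where E: "E \<in> sets borel" "X = {v \<in> ?I. v c \<in> E}"
    using X(1) unfolding sets sets_chart_algebra[OF finsler c] by blast
  let ?E = "E \<inter> {y. 0 < \<sigma> * y $ k} \<inter> (\<lambda>v. v c) ` ?I"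
  have "{y \<in> - {0}. fibre_norm A F c p y \<in> {1}} \<in> sets borel"
    by (rule borel_continuous_preimage[OF fibre_props(2)[OF finsler c]]) auto
  moreover have "{y \<in> - {0}. fibre_norm A F c p y \<in> {1}} = (\<lambda>v. v c) ` ?I"
    unfolding indicatrix_image[OF finsler c] by auto
  ultimately have Eb: "?E \<in> sets borel" using E(1) half[of \<sigma> k] by auto
  have XE: "X = {v \<in> ?I. v c \<in> ?E}" using X(2) E(2) unfolding ks(1) by auto
  note hp = hemisphere_param[OF c ks(2), of k]
  have sub: "?E \<subseteq> (\<lambda>t. (t + \<sigma> *\<^sub>R axis k 1) /\<^sub>R fibre_norm A F c p (t + \<sigma> *\<^sub>R axis k 1)) `
     ({t. - 1 < \<sigma> * t $ k} \<inter> coord_hyperplane k)"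
    using hp(2) by blast
  show "emeasure \<mu> X = emeasure \<nu> X"
    unfolding XE
    by (rule trans[OF bspec[OF conjunct2[OF \<mu>[unfolded is_indicatrix_measure_def]] c, THEN conjunct2, rule_format, OF hp(1) Eb sub]
        bspec[OF conjunct2[OF \<nu>[unfolded is_indicatrix_measure_def]] c, THEN conjunct2, rule_format, OF hp(1) Eb sub, symmetric]])
qed

lemma dvol_polar_measure:
  assumes "c \<in> charts_at A p"
  shows "dvol A F p = polar_measure A F c p"
  unfolding dvol_def
proof (rule the_equality)
  show "is_indicatrix_measure A F p (polar_measure A F c p)" by (rule polar_is_indicatrix_measure[OF assms])
  then show "\<mu> = polar_measure A F c p" if "is_indicatrix_measure A F p \<mu>" for \<mu>
    using indicatrix_measure_unique[OF assms that] by blast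
qed

subsection \<open>Integrals over the indicatrix\<close>

lemma shell_integrable:
  fixes h :: "real^'n \<Rightarrow> 'b::euclidean_space"
  assumes "continuous_on (- {0}) h"
  shows "set_integrable lborel shell h"
  by (rule compact_set_integrable[OF compact_shell continuous_on_subset[OF assms]]) (use shell_nonzero in auto)

text \<open>The domain of integration on the right is the same for all points of the base, and the
  integrand depends smoothly on the point; this is what makes averages smooth.\<close>

lemma integral_dvol:
  fixes h :: "('p, real^'n) tvec \<Rightarrow> 'b::euclidean_space"
  assumes c: "c \<in> charts_at A p" and g: "continuous_on (- {0}) g"
    and hg: "\<And>v. v \<in> indicatrix A F p \<Longrightarrow> h v = g (v c)"
  shows "integrable (dvol A F p) h" (is ?i)
    and "(LINT v|dvol A F p. h v) =
      (LINT y:shell|lborel. indicatrix_weight A F c p y *\<^sub>R g (y /\<^sub>R fibre_norm A F c p y))" (is ?e)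
proof -
  let ?I = "indicatrix A F p" and ?w = "indicatrix_weight A F c p" and ?r = "\<lambda>y. y /\<^sub>R fibre_norm A F c p y"
  let ?T = "\<lambda>y. tvec_of A c p (?r y)" and ?L = "restrict_space lborel (shell :: (real^'n) set)"
  let ?V = "vimage_algebra ?I (\<lambda>v. v c) borel"
  have meas_h: "h \<in> borel_measurable ?V"
  proof -
    have "(\<lambda>y. indicator (- {0}) y *\<^sub>R g y) \<in> borel_measurable borel"
      by (rule borel_measurable_continuous_on_indicator[OF _ g]) auto
    moreover have "(\<lambda>v. v c) \<in> measurable ?V borel" by (rule measurable_vimage_algebra1) simp
    ultimately have "(\<lambda>v. indicator (- {0}) (v c) *\<^sub>R g (v c)) \<in> borel_measurable ?V"
      by (rule measurable_compose[rotated])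
    then show ?thesis
    proof (rule measurable_cong[THEN iffD1, rotated])
      fix v assume "v \<in> space ?V"
      then have "v \<in> ?I" by simp
      then show "indicator (- {0}) (v c) *\<^sub>R g (v c) = h v"
        using indicatrix_coordinate(1)[OF finsler c] hg by simp
    qed
  qed
  have T: "?T \<in> measurable (density ?L (\<lambda>y. ennreal (?w y))) ?V"
    using radial_measurable[OF finsler c] by simp
  have rc: "continuous_on (- {0}) (\<lambda>y. g (?r y))"
  proof (rule continuous_on_compose2[OF g radial_continuous[OF finsler c]])
    show "?r ` (- {0}) \<subseteq> - {0}"
    proof (rule image_subsetI)
      fix y :: "real^'n" assume "y \<in> - {0}"
      then have "y \<noteq> 0" "fibre_norm A F c p y \<noteq> 0" using fibre_props(1)[OF finsler c, of y] by auto
      then show "?r y \<in> - {0}" by simp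
    qed
  qed
  have hT: "h (?T y) = g (?r y)" if "y \<in> shell" for y
    using hg[OF radial_projection(1)[OF finsler c shell_nonzero[OF that]]]
      radial_projection(2)[OF finsler c shell_nonzero[OF that]] by simp
  have hT_meas: "(\<lambda>y. h (?T y)) \<in> borel_measurable ?L"
    using measurable_compose[OF radial_measurable[OF finsler c] meas_h] .
  have w_nn: "AE y in ?L. 0 \<le> ?w y"
    using indicatrix_weight_pos[OF finsler c shell_nonzero]
    by (intro AE_I2) (auto simp: space_restrict_space less_imp_le)
  have cont: "continuous_on (- {0}) (\<lambda>y. ?w y *\<^sub>R g (?r y))"
    by (intro continuous_intros rc indicatrix_weight_cont[OF finsler c])
  have shellL: "shell \<inter> space lborel \<in> sets (lborel :: (real^'n) measure)" by simp
  have int: "integrable ?L (\<lambda>y. ?w y *\<^sub>R h (?T y))"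
  proof -
    have "integrable lborel (\<lambda>y. indicator shell y *\<^sub>R (?w y *\<^sub>R g (?r y)))"
      using shell_integrable[OF cont] by (simp add: set_integrable_def)
    moreover have "(\<lambda>y. indicator shell y *\<^sub>R (?w y *\<^sub>R g (?r y))) = (\<lambda>y. indicator shell y *\<^sub>R (?w y *\<^sub>R h (?T y)))"
      using hT by (auto simp: indicator_def)
    ultimately show ?thesis by (simp add: integrable_restrict_space[OF shellL])
  qed
  then have "integrable (density ?L (\<lambda>y. ennreal (?w y))) (\<lambda>y. h (?T y))"
    by (subst integrable_density[OF hT_meas weight_measurable[OF finsler c] w_nn])
  then show ?i
    unfolding dvol_polar_measure[OF c] polar_measure_def[OF finsler]
    by (subst integrable_distr_eq[OF T meas_h])
  have "(LINT v|dvol A F p. h v) = (LINT y|density ?L (\<lambda>y. ennreal (?w y)). h (?T y))"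
    unfolding dvol_polar_measure[OF c] polar_measure_def[OF finsler] by (rule integral_distr[OF T meas_h])
  also have "\<dots> = (LINT y|?L. ?w y *\<^sub>R h (?T y))"
    by (rule integral_density[OF hT_meas weight_measurable[OF finsler c] w_nn])
  also have "\<dots> = (LINT y:shell|lborel. ?w y *\<^sub>R h (?T y))"
    unfolding set_lebesgue_integral_def by (rule integral_restrict_space[OF shellL])
  also have "\<dots> = (LINT y:shell|lborel. ?w y *\<^sub>R g (?r y))"
    by (rule set_lebesgue_integral_cong) (use hT in auto)
  finally show ?e .
qed

lemma space_dvol: "c \<in> charts_at A p \<Longrightarrow> space (dvol A F p) = indicatrix A F p"
  by (simp add: dvol_polar_measure polar_measure_def[OF finsler])

lemma vol_indicatrix_integral:
  assumes c: "c \<in> charts_at A p"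
  shows "vol_indicatrix A F p = (LINT y:shell|lborel. indicatrix_weight A F c p y)"
proof -
  have "vol_indicatrix A F p = (LINT v|dvol A F p. (1::real))"
    by (simp add: vol_indicatrix_def space_dvol[OF c])
  also have "\<dots> = (LINT y:shell|lborel. indicatrix_weight A F c p y *\<^sub>R (1::real))"
    by (rule integral_dvol(2)[OF c, of "\<lambda>_. 1"]) auto
  finally show ?thesis by simp
qed

lemma measure_shell_pos: "0 < measure lborel (shell :: (real^'n) set)"
proof -
  obtain b :: "real^'n" where b: "b \<in> Basis" using nonempty_Basis by blast
  let ?a = "(3/2) *\<^sub>R b"
  have "ball ?a (1/2) \<subseteq> shell"
  proof
    fix y assume "y \<in> ball ?a (1/2)"
    then have "norm (?a - y) < 1/2" by (simp add: dist_norm)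
    moreover have "norm ?a = 3/2" using b by simp
    ultimately show "y \<in> shell"
      using norm_triangle_ineq2[of ?a y] norm_triangle_ineq3[of ?a y] unfolding shell_def by auto
  qed
  then have "measure lborel (ball ?a (1/2)) \<le> measure lborel (shell :: (real^'n) set)"
    by (intro measure_mono_fmeasurable fmeasurable_compact[OF compact_shell]) auto
  moreover have "0 < measure lborel (ball ?a (1/2))" by (rule content_ball_pos) simp
  ultimately show ?thesis by linarith
qed

lemma vol_indicatrix_pos:
  assumes c: "c \<in> charts_at A p"
  shows "0 < vol_indicatrix A F p"
proof -
  let ?w = "indicatrix_weight A F c p"
  have ws: "continuous_on shell ?w"
    by (rule continuous_on_subset[OF indicatrix_weight_cont[OF finsler c]]) (use shell_nonzero in auto)
  have "(shell :: (real^'n) set) \<noteq> {}" using measure_shell_pos by auto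
  then obtain y0 where y0: "y0 \<in> shell" "\<And>y. y \<in> shell \<Longrightarrow> ?w y0 \<le> ?w y"
    using continuous_attains_inf[OF compact_shell _ ws] by blast
  have "0 < ?w y0 * measure lborel (shell :: (real^'n) set)"
    using indicatrix_weight_pos[OF finsler c shell_nonzero[OF y0(1)]] measure_shell_pos by simp
  also have "\<dots> = (LINT y:(shell :: (real^'n) set)|lborel. ?w y0)" by (simp add: set_lebesgue_integral_def)
  also have "\<dots> \<le> (LINT y:shell|lborel. ?w y)"
    by (rule set_integral_mono) (use y0 in \<open>auto intro!: compact_set_integrable compact_shell ws\<close>)
  finally show ?thesis unfolding vol_indicatrix_integral[OF c] .
qed

end

section \<open>Averaging sections over the indicatrices\<close>

context
  fixes M :: "'p set" and A :: "('p, real^'n::finite) chart set" and F :: "('p, 'n) tpoint \<Rightarrow> real"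
  assumes finsler: "finsler_space M A F"
begin

private abbreviation (input) sections where
  "sections \<equiv> pullback_sections (slit_bundle M A) (slit_atlas A) fst A"

definition fibre_average ::
    "(('p, 'n) tpoint \<Rightarrow> ('p, real^'n) tvec) \<Rightarrow> 'p \<Rightarrow> ('p, real^'n) tvec" where
  "fibre_average \<tau> x = (\<lambda>c. if c \<in> charts_at A x
     then (1 / vol_indicatrix A F x) *\<^sub>R (LINT v|dvol A F x. \<tau> (x, v) c) else 0)"

context
  fixes \<tau> :: "('p, 'n) tpoint \<Rightarrow> ('p, real^'n) tvec"
  assumes \<tau>: "\<tau> \<in> sections"
begin

lemma section_tangent: "u \<in> slit_bundle M A \<Longrightarrow> \<tau> u \<in> tangent_space A (fst u)"
  using \<tau> unfolding pullback_sections_def by blast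

lemma section_smooth:
  assumes "d \<in> A" "c \<in> A"
  shows "smooth_on (\<lambda>z. \<tau> (chart_inv (slit_chart A d) z) c) (snd d ` (fst d \<inter> fst c) \<times> (- {0}))"
proof -
  have "slit_chart A d \<in> slit_atlas A" using assms(1) by (simp add: slit_atlas_def)
  then have "smooth_on (\<lambda>z. \<tau> (chart_inv (slit_chart A d) z) c)
      (snd (slit_chart A d) ` (fst (slit_chart A d) \<inter> fst -` fst c))"
    using \<tau> assms(2) unfolding pullback_sections_def by blast
  then show ?thesis unfolding slit_image[OF finsler_atlas[OF finsler] assms(1)] .
qed

lemma section_integral:
  assumes d: "d \<in> charts_at A x" and c: "c \<in> charts_at A x"
  shows "integrable (dvol A F x) (\<lambda>v. \<tau> (x, v) c)"
    and "(LINT v|dvol A F x. \<tau> (x, v) c) = (LINT y:shell|lborel. indicatrix_weight A F d x y *\<^sub>R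
      \<tau> (chart_inv (slit_chart A d) (snd d x, y /\<^sub>R fibre_norm A F d x y)) c)"
proof -
  have mem: "d \<in> A" "c \<in> A" "x \<in> fst d" "x \<in> fst c" using c d by (auto simp: charts_at_def)
  let ?g = "\<lambda>y. \<tau> (chart_inv (slit_chart A d) (snd d x, y)) c"
  have g: "continuous_on (- {0}) ?g"
    by (rule continuous_on_compose2[OF smooth_on_continuous_on[OF section_smooth[OF mem(1,2)]]])
      (use mem in \<open>auto intro!: continuous_intros\<close>)
  have h: "\<tau> (x, v) c = ?g (v d)" if v: "v \<in> indicatrix A F x" for v
    using slit_chart_inv(1)[OF finsler_atlas[OF finsler] mem(1) imageI[OF mem(3)] indicatrix_coordinate(1)[OF finsler d v]]
      indicatrix_coordinate(3)[OF finsler d v] chart_inv_chart[OF finsler_atlas[OF finsler] mem(1,3)] by simp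
  show "integrable (dvol A F x) (\<lambda>v. \<tau> (x, v) c)"
    by (rule integral_dvol(1)[OF finsler d g]) (rule h)
  show "(LINT v|dvol A F x. \<tau> (x, v) c) = (LINT y:shell|lborel. indicatrix_weight A F d x y *\<^sub>R
      \<tau> (chart_inv (slit_chart A d) (snd d x, y /\<^sub>R fibre_norm A F d x y)) c)"
    by (rule integral_dvol(2)[OF finsler d g]) (rule h)
qed

text \<open>The components of a section over a fibre transform by a linear map that is constant along the
  fibre, so it can be taken out of the integral.\<close>

lemma fibre_average_tangent: "fibre_average \<tau> x \<in> tangent_space A x"
proof (rule tangent_spaceI[OF finsler_atlas[OF finsler]])
  fix c d assume c: "c \<in> charts_at A x" and d: "d \<in> charts_at A x"
  have lin: "linear (jac c d x)" by (rule linear_jac[OF finsler_atlas[OF finsler] c d])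
  have "(LINT v|dvol A F x. \<tau> (x, v) d) = (LINT v|dvol A F x. jac c d x (\<tau> (x, v) c))"
  proof (rule Bochner_Integration.integral_cong[OF refl])
    fix v assume "v \<in> space (dvol A F x)"
    then have "(x, v) \<in> slit_bundle M A"
      using indicatrix_slit[OF finsler c] space_dvol[OF finsler c] by blast
    from section_tangent[OF this] show "\<tau> (x, v) d = jac c d x (\<tau> (x, v) c)"
      using tangent_change[OF finsler_atlas[OF finsler] _ c d] by simp
  qed
  also have "\<dots> = jac c d x (LINT v|dvol A F x. \<tau> (x, v) c)"
    by (rule integral_bounded_linear[OF linear_conv_bounded_linear[THEN iffD1, OF lin] section_integral(1)[OF c c]])
  finally show "fibre_average \<tau> x d = jac c d x (fibre_average \<tau> x c)"
    using c d by (simp add: fibre_average_def linear_scale[OF lin])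
qed (simp add: fibre_average_def)

text \<open>In a chart, numerator and denominator of the average are integrals over the fixed shell of
  smooth functions of the base point and the fibre coordinate.\<close>

lemma fibre_average_vector_field: "fibre_average \<tau> \<in> vector_fields M A"
proof (rule vector_fieldsI[OF finsler_atlas[OF finsler]])
  show "fibre_average \<tau> x = (\<lambda>_. 0)" if "x \<notin> M" for x
    using charts_at_outside[OF finsler_atlas[OF finsler] that] by (simp add: fibre_average_def)
next
  fix d c assume d: "d \<in> A" and c: "c \<in> A"
  let ?U = "snd d ` (fst d \<inter> fst c)" and ?V = "- {0::real^'n}"
  let ?S = "?U \<times> ?V"
  let ?F = "F_coord A F d"
  have opU: "open ?U" by (rule open_overlap[OF finsler_atlas[OF finsler] d c])
  have opV: "open ?V" by auto
  have op: "open ?S" using opU opV by (rule open_Times)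
  have sub: "?S \<subseteq> slit_dom d" by auto
  have smF: "smooth_on ?F ?S" by (rule smooth_on_subset[OF smooth_F_coord[OF finsler d] sub])
  have Fpos: "0 < ?F z" if "z \<in> ?S" for z using F_coord_pos[OF finsler d] that sub by blast
  define W where "W z = shell_const TYPE('n) * sqrt (det (fund_tensor A F d z)) * (norm (snd z) / ?F z) ^ CARD('n)" for z
  define G where "G z = W z *\<^sub>R \<tau> (chart_inv (slit_chart A d) (fst z, inverse (?F z) *\<^sub>R snd z)) c" for z
  have smW: "smooth_on W ?S"
  proof -
    have "smooth_on (\<lambda>z. norm (snd z)) ?S"
      unfolding norm_eq_sqrt_inner
      by (intro smooth_on_sqrt smooth_on_inner smooth_on_snd op) auto
    moreover have "smooth_on (\<lambda>z. sqrt (det (fund_tensor A F d z))) ?S"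
    proof (intro smooth_on_sqrt smooth_on_det op)
      show "smooth_on (fund_tensor A F d) ?S" by (rule smooth_on_subset[OF smooth_fund_tensor[OF finsler d] sub])
      show "0 < det (fund_tensor A F d z)" if "z \<in> ?S" for z
        using det_fund_tensor_pos[OF finsler d] that sub by blast
    qed
    moreover have "?F z \<noteq> 0" if "z \<in> ?S" for z using Fpos[OF that] by simp
    ultimately show ?thesis
      unfolding W_def[abs_def]
      by (intro smooth_on_mult smooth_on_const smooth_on_power smooth_on_divide smF op)
  qed
  have smG: "smooth_on G ?S"
  proof -
    have nz: "?F z \<noteq> 0" if "z \<in> ?S" for z using Fpos[OF that] by simp
    have 1: "smooth_on (\<lambda>z. (fst z, inverse (?F z) *\<^sub>R snd z)) ?S"
      by (intro smooth_on_Pair smooth_on_fst smooth_on_scaleR smooth_on_snd smooth_on_inverse smF op nz)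
    have 2: "(\<lambda>z. (fst z, inverse (?F z) *\<^sub>R snd z)) ` ?S \<subseteq> ?S"
    proof (rule image_subsetI)
      fix z assume z: "z \<in> ?S"
      then show "(fst z, inverse (?F z) *\<^sub>R snd z) \<in> ?S" using nz[OF z] by (cases z) simp
    qed
    have "smooth_on (\<lambda>z. \<tau> (chart_inv (slit_chart A d) (fst z, inverse (?F z) *\<^sub>R snd z)) c) ?S"
      by (rule smooth_on_compose[OF section_smooth[OF d c] 1 op op 2])
    then show ?thesis unfolding G_def[abs_def] by (rule smooth_on_scaleR[OF op smW])
  qed
  have shellV: "shell \<subseteq> ?V" using shell_nonzero by blast
  have smVol: "smooth_on (\<lambda>z. LINT y:shell|lborel. W (z, y)) ?U"
    by (rule smooth_on_parametric_integral[OF opU opV compact_shell shellV smW])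
  have smInt: "smooth_on (\<lambda>z. LINT y:shell|lborel. G (z, y)) ?U"
    by (rule smooth_on_parametric_integral[OF opU opV compact_shell shellV smG])
  have at: "chart_inv d z \<in> fst d \<inter> fst c" "snd d (chart_inv d z) = z" "d \<in> charts_at A (chart_inv d z)"
      "c \<in> charts_at A (chart_inv d z)" if "z \<in> ?U" for z
  proof -
    have z: "z \<in> snd d ` fst d" "chart_inv d z \<in> fst c"
      using that chart_image_iff[OF finsler_atlas[OF finsler] d] by blast+
    show 1: "chart_inv d z \<in> fst d \<inter> fst c" using z chart_inv_in[OF finsler_atlas[OF finsler] z(1)] by blast
    show "snd d (chart_inv d z) = z" by (rule chart_chart_inv[OF finsler_atlas[OF finsler] z(1)])
    show "d \<in> charts_at A (chart_inv d z)" "c \<in> charts_at A (chart_inv d z)"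
      using 1 c d by (auto simp: charts_at_def)
  qed
  have w: "indicatrix_weight A F d (chart_inv d z) y = W (z, y)" if z: "z \<in> ?U" for z y
  proof -
    have "indicatrix_weight A F d (chart_inv d z) y = shell_const TYPE('n) *
        fibre_density A F d (chart_inv d z) y * (norm y / fibre_norm A F d (chart_inv d z) y) ^ CARD('n)"
      unfolding indicatrix_weight_def[OF finsler]
      by (rule polar_weight_def[OF fibre_props[OF finsler at(3)[OF z]]])
    then show ?thesis
      by (simp add: fibre_norm_def[OF finsler] fibre_density_def[OF finsler] at(2)[OF z] W_def)
  qed
  have vol: "vol_indicatrix A F (chart_inv d z) = (LINT y:shell|lborel. W (z, y))" if z: "z \<in> ?U" for z
    unfolding vol_indicatrix_integral[OF finsler at(3)[OF z]] w[OF z] ..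
  have int: "(LINT v|dvol A F (chart_inv d z). \<tau> (chart_inv d z, v) c) = (LINT y:shell|lborel. G (z, y))"
    if z: "z \<in> ?U" for z
    unfolding section_integral(2)[OF at(3,4)[OF z]] w[OF z] fibre_norm_def[OF finsler] at(2)[OF z] G_def by simp
  show "smooth_on (\<lambda>z. fibre_average \<tau> (chart_inv d z) c) ?U"
  proof (rule smooth_on_cong[OF _ opU])
    show "smooth_on (\<lambda>z. (1 / (LINT y:shell|lborel. W (z, y))) *\<^sub>R (LINT y:shell|lborel. G (z, y))) ?U"
    proof (intro smooth_on_scaleR smooth_on_divide smooth_on_const opU smVol smInt)
      fix z assume z: "z \<in> ?U"
      show "(LINT y:shell|lborel. W (z, y)) \<noteq> 0"
        using vol_indicatrix_pos[OF finsler at(3)[OF z]] unfolding vol[OF z] by simp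
    qed
    fix z assume z: "z \<in> ?U"
    show "(1 / (LINT y:shell|lborel. W (z, y))) *\<^sub>R (LINT y:shell|lborel. G (z, y)) = fibre_average \<tau> (chart_inv d z) c"
      using at(4)[OF z] by (simp add: fibre_average_def vol[OF z] int[OF z])
  qed
qed (rule fibre_average_tangent)

lemma fibre_average_combination:
  assumes "\<sigma> \<in> sections"
    and "\<And>v. (x, v) \<in> slit_bundle M A \<Longrightarrow> \<rho> (x, v) = (\<lambda>c. a *\<^sub>R \<sigma> (x, v) c + b *\<^sub>R \<tau> (x, v) c)"
    and \<sigma>_int: "\<And>c. c \<in> charts_at A x \<Longrightarrow> integrable (dvol A F x) (\<lambda>v. \<sigma> (x, v) c)"
  shows "fibre_average \<rho> x = (\<lambda>c. a *\<^sub>R fibre_average \<sigma> x c + b *\<^sub>R fibre_average \<tau> x c)"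
proof (rule ext)
  fix c
  show "fibre_average \<rho> x c = a *\<^sub>R fibre_average \<sigma> x c + b *\<^sub>R fibre_average \<tau> x c"
  proof (cases "c \<in> charts_at A x")
    case True
    have "(LINT v|dvol A F x. \<rho> (x, v) c) = (LINT v|dvol A F x. a *\<^sub>R \<sigma> (x, v) c + b *\<^sub>R \<tau> (x, v) c)"
    proof (rule Bochner_Integration.integral_cong[OF refl])
      fix v assume "v \<in> space (dvol A F x)"
      then have "(x, v) \<in> slit_bundle M A"
        using indicatrix_slit[OF finsler True] space_dvol[OF finsler True] by blast
      then show "\<rho> (x, v) c = a *\<^sub>R \<sigma> (x, v) c + b *\<^sub>R \<tau> (x, v) c" using assms(2) by simp
    qed
    also have "\<dots> = a *\<^sub>R (LINT v|dvol A F x. \<sigma> (x, v) c) + b *\<^sub>R (LINT v|dvol A F x. \<tau> (x, v) c)"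
      using \<sigma>_int[OF True] section_integral(1)[OF True True]
      by (subst Bochner_Integration.integral_add) simp_all
    finally show ?thesis using True by (simp add: fibre_average_def scaleR_add_right)
  qed (simp add: fibre_average_def)
qed

end

text \<open>A pull-back section is constant along the fibres.\<close>

lemma fibre_average_pullback:
  assumes "Y \<in> vector_fields M A" "x \<in> M"
  shows "fibre_average (pullback_field M A Y) x = Y x"
proof (rule ext)
  fix c
  show "fibre_average (pullback_field M A Y) x c = Y x c"
  proof (cases "c \<in> charts_at A x")
    case True
    have "(LINT v|dvol A F x. pullback_field M A Y (x, v) c) = (LINT v|dvol A F x. Y x c)"
      using indicatrix_slit[OF finsler True] space_dvol[OF finsler True]
      by (intro Bochner_Integration.integral_cong) (auto simp: pullback_field_def)
    also have "\<dots> = vol_indicatrix A F x *\<^sub>R Y x c"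
      by (simp add: vol_indicatrix_def space_dvol[OF finsler True])
    finally show ?thesis using True vol_indicatrix_pos[OF finsler True] by (simp add: fibre_average_def)
  next
    case False
    then show ?thesis
      using tangent_outside[OF finsler_atlas[OF finsler] vector_fields_tangent[OF finsler_atlas[OF finsler] assms] False]
      by (simp add: fibre_average_def)
  qed
qed

subsection \<open>Linearity of the horizontal lift\<close>

lemma horizontal_field_combination:
  assumes X: "\<And>p. p \<in> M \<Longrightarrow> X p \<in> tangent_space A p" and Y: "\<And>p. p \<in> M \<Longrightarrow> Y p \<in> tangent_space A p"
  shows "horizontal_field M A F (\<lambda>p c. a p *\<^sub>R X p c + b p *\<^sub>R Y p c) =
    (\<lambda>u e. a (fst u) *\<^sub>R horizontal_field M A F X u e + b (fst u) *\<^sub>R horizontal_field M A F Y u e)"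
proof (rule ext)
  fix u
  let ?Z = "\<lambda>p c. a p *\<^sub>R X p c + b p *\<^sub>R Y p c"
  show "horizontal_field M A F ?Z u = (\<lambda>e. a (fst u) *\<^sub>R horizontal_field M A F X u e + b (fst u) *\<^sub>R horizontal_field M A F Y u e)"
  proof (cases "u \<in> slit_bundle M A")
    case True
    then have p: "fst u \<in> M" by (simp add: slit_bundle_iff[OF finsler_atlas[OF finsler]])
    note XY = X[OF p] Y[OF p]
    have Z: "?Z (fst u) \<in> tangent_space A (fst u)"
      by (intro tangent_add[OF finsler_atlas[OF finsler]] tangent_scale[OF finsler_atlas[OF finsler]] XY)
    obtain c where c: "c \<in> charts_at A (fst u)" using charts_at_nonempty[OF finsler_atlas[OF finsler] p] by blast
    have c': "slit_chart A c \<in> charts_at (slit_atlas A) u"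
      unfolding slit_charts_at[OF finsler_atlas[OF finsler] True] using c by blast
    note at = slit_smooth_atlas[OF finsler_atlas[OF finsler]]
    note hl = horizontal_lift_props[OF finsler True]
    have "horizontal_lift A F u (?Z (fst u)) =
        (\<lambda>e. a (fst u) *\<^sub>R horizontal_lift A F u (X (fst u)) e + b (fst u) *\<^sub>R horizontal_lift A F u (Y (fst u)) e)"
    proof (rule tangent_eqI[OF at _ _ c'])
      show "horizontal_lift A F u (?Z (fst u)) \<in> tangent_space (slit_atlas A) u" by (rule hl(1)[OF Z])
      show "(\<lambda>e. a (fst u) *\<^sub>R horizontal_lift A F u (X (fst u)) e + b (fst u) *\<^sub>R horizontal_lift A F u (Y (fst u)) e)
        \<in> tangent_space (slit_atlas A) u"
        by (intro tangent_add[OF at] tangent_scale[OF at] hl(1) XY)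
      show "horizontal_lift A F u (?Z (fst u)) (slit_chart A c) =
        a (fst u) *\<^sub>R horizontal_lift A F u (X (fst u)) (slit_chart A c) + b (fst u) *\<^sub>R horizontal_lift A F u (Y (fst u)) (slit_chart A c)"
        unfolding hl(2)[OF Z c] hl(2)[OF XY(1) c] hl(2)[OF XY(2) c]
        by (simp add: matrix_vector_right_distrib matrix_vector_mult_scaleR)
    qed
    then show ?thesis using True by (simp add: horizontal_field_def[OF finsler])
  qed (simp add: horizontal_field_def[OF finsler])
qed

end

section \<open>The averaged connection\<close>

text \<open>The horizontal lifts of the vectors \<open>X x\<close> form a vector field on the slit bundle, so the
  derivatives in the integrand are the values of a single smooth section.\<close>

lemma averaged_deriv_fibre_average:
  assumes finsler: "finsler_space M A F"
    and conn: "linear_connection (slit_bundle M A) (slit_atlas A) fst A D"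
    and X: "X \<in> vector_fields M A" and Y: "Y \<in> vector_fields M A"
  shows "averaged_deriv M A F D x (X x) Y =
    fibre_average A F (D (pullback_field M A Y) (horizontal_field M A F X)) x"
proof (rule ext)
  fix c
  let ?\<sigma> = "pullback_field M A Y" and ?V = "horizontal_field M A F X"
  note atl = finsler_atlas[OF finsler]
  show "averaged_deriv M A F D x (X x) Y c = fibre_average A F (D ?\<sigma> ?V) x c"
  proof (cases "c \<in> charts_at A x")
    case True
    have "(LINT v|dvol A F x. cov_deriv_at (slit_bundle M A) (slit_atlas A) D ?\<sigma> (x, v) (horizontal_lift A F (x, v) (X x)) c)
      = (LINT v|dvol A F x. D ?\<sigma> ?V (x, v) c)"
    proof (rule Bochner_Integration.integral_cong[OF refl])
      fix v assume "v \<in> space (dvol A F x)"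
      then have u: "(x, v) \<in> slit_bundle M A"
        using indicatrix_slit[OF finsler True] space_dvol[OF finsler True] by blast
      then have "horizontal_lift A F (x, v) (X x) = ?V (x, v)" by (simp add: horizontal_field_def[OF finsler])
      then show "cov_deriv_at (slit_bundle M A) (slit_atlas A) D ?\<sigma> (x, v) (horizontal_lift A F (x, v) (X x)) c
        = D ?\<sigma> ?V (x, v) c"
        using cov_deriv_at_eq[OF slit_smooth_atlas[OF atl] conn slit_has_bumps[OF atl finsler_bumps[OF finsler]]
          pullback_field_section[OF atl Y] horizontal_field_vector_field[OF finsler X] u] by simp
    qed
    then show ?thesis using True by (simp add: averaged_deriv_def fibre_average_def[OF finsler])
  qed (simp add: averaged_deriv_def fibre_average_def[OF finsler])
qed

text \<open>Averaging is linear and commutes with multiplication by functions of the base point. For the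
  Leibniz rule, the derivative of \<open>h \<circ> \<pi>\<close> along the horizontal lift of \<open>X\<close> is the derivative of \<open>h\<close>
  along \<open>X\<close>, a constant on each fibre, and the average of the pull-back of \<open>Y\<close> is \<open>Y\<close>.\<close>

lemma averaged_connection_affine:
  assumes finsler: "finsler_space M A F"
    and conn: "linear_connection (slit_bundle M A) (slit_atlas A) fst A D"
  shows "affine_connection M A (averaged_connection M A F D)"
proof -
  note atl = finsler_atlas[OF finsler]
  let ?sec = "pullback_sections (slit_bundle M A) (slit_atlas A) fst A"
  let ?vf = "vector_fields (slit_bundle M A) (slit_atlas A)"
  let ?\<sigma> = "pullback_field M A" and ?H = "horizontal_field M A F"
  have avg: "averaged_connection M A F D Y X = fibre_average A F (D (?\<sigma> Y) (?H X))"
    if "X \<in> vector_fields M A" "Y \<in> vector_fields M A" for X Y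
    unfolding averaged_connection_def using averaged_deriv_fibre_average[OF finsler conn that] by (rule ext)
  have sec: "D \<sigma> V \<in> ?sec" if "\<sigma> \<in> ?sec" "V \<in> ?vf" for \<sigma> V
    using conn that unfolding linear_connection_def by blast
  have addS: "D (\<lambda>b c. \<sigma> b c + \<tau> b c) V = (\<lambda>b c. D \<sigma> V b c + D \<tau> V b c)"
    if "\<sigma> \<in> ?sec" "\<tau> \<in> ?sec" "V \<in> ?vf" for \<sigma> \<tau> V
    using conn that unfolding linear_connection_def by blast
  have leibniz: "D (\<lambda>b c. h b *\<^sub>R \<sigma> b c) V =
      (\<lambda>b c. dir_deriv (slit_atlas A) h b (V b) *\<^sub>R \<sigma> b c + h b *\<^sub>R D \<sigma> V b c)"
    if "\<sigma> \<in> ?sec" "V \<in> ?vf" "smooth_fun (slit_atlas A) h" for \<sigma> V h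
    using conn that unfolding linear_connection_def by blast
  note addV = connection_add[OF slit_smooth_atlas[OF atl] conn]
    and scaleV = connection_scale[OF slit_smooth_atlas[OF atl] conn]
  note ps = pullback_field_section[OF atl] and hf = horizontal_field_vector_field[OF finsler]
  note tan = vector_fields_tangent[OF atl]
  have int: "integrable (dvol A F x) (\<lambda>v. \<tau> (x, v) c)" if "\<tau> \<in> ?sec" "c \<in> charts_at A x" for \<tau> x c
    by (rule section_integral(1)[OF finsler that(1,2,2)])
  note comb = fibre_average_combination[OF finsler]
  show ?thesis
    unfolding affine_connection_def linear_connection_def vector_fields_def[symmetric]
  proof (intro conjI ballI allI impI)
    fix Y X assume Y: "Y \<in> vector_fields M A" and X: "X \<in> vector_fields M A"
    show "averaged_connection M A F D Y X \<in> vector_fields M A"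
      unfolding avg[OF X Y] by (rule fibre_average_vector_field[OF finsler sec[OF ps[OF Y] hf[OF X]]])
  next
    fix Y X Z assume Y: "Y \<in> vector_fields M A" and X: "X \<in> vector_fields M A" and Z: "Z \<in> vector_fields M A"
    have "?H (\<lambda>b d. X b d + Z b d) = (\<lambda>u e. ?H X u e + ?H Z u e)"
      using horizontal_field_combination[OF finsler tan[OF X] tan[OF Z], of "\<lambda>_. 1" "\<lambda>_. 1"] by simp
    then have D: "D (?\<sigma> Y) (?H (\<lambda>b d. X b d + Z b d)) = (\<lambda>b c. D (?\<sigma> Y) (?H X) b c + D (?\<sigma> Y) (?H Z) b c)"
      using addV[OF ps[OF Y] hf[OF X] hf[OF Z]] by simp
    show "averaged_connection M A F D Y (\<lambda>b d. X b d + Z b d) =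
        (\<lambda>b c. averaged_connection M A F D Y X b c + averaged_connection M A F D Y Z b c)"
      unfolding avg[OF X Y] avg[OF Z Y] avg[OF vector_fields_add[OF atl X Z] Y] D
    proof (rule ext)
      fix x
      show "fibre_average A F (\<lambda>b c. D (?\<sigma> Y) (?H X) b c + D (?\<sigma> Y) (?H Z) b c) x =
        (\<lambda>c. fibre_average A F (D (?\<sigma> Y) (?H X)) x c + fibre_average A F (D (?\<sigma> Y) (?H Z)) x c)"
        using comb[OF sec[OF ps[OF Y] hf[OF Z]] sec[OF ps[OF Y] hf[OF X]] _ int[OF sec[OF ps[OF Y] hf[OF X]]],
            of x "\<lambda>b c. D (?\<sigma> Y) (?H X) b c + D (?\<sigma> Y) (?H Z) b c" 1 1] by simp
    qed
  next
    fix Y X h assume Y: "Y \<in> vector_fields M A" and X: "X \<in> vector_fields M A" and h: "smooth_fun A h"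
    have "?H (\<lambda>b d. h b *\<^sub>R X b d) = (\<lambda>u e. h (fst u) *\<^sub>R ?H X u e)"
      using horizontal_field_combination[OF finsler tan[OF X] tan[OF X], of h "\<lambda>_. 0"] by simp
    then have D: "D (?\<sigma> Y) (?H (\<lambda>b d. h b *\<^sub>R X b d)) = (\<lambda>b c. h (fst b) *\<^sub>R D (?\<sigma> Y) (?H X) b c)"
      using scaleV[OF ps[OF Y] hf[OF X] smooth_fun_pullback[OF atl h]] by simp
    show "averaged_connection M A F D Y (\<lambda>b d. h b *\<^sub>R X b d) = (\<lambda>b c. h b *\<^sub>R averaged_connection M A F D Y X b c)"
      unfolding avg[OF X Y] avg[OF vector_fields_scale[OF atl X h] Y] D
    proof (rule ext)
      fix x
      let ?\<tau> = "D (?\<sigma> Y) (?H X)"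
      have t: "?\<tau> \<in> ?sec" by (rule sec[OF ps[OF Y] hf[OF X]])
      show "fibre_average A F (\<lambda>b c. h (fst b) *\<^sub>R ?\<tau> b c) x = (\<lambda>c. h x *\<^sub>R fibre_average A F ?\<tau> x c)"
        using comb[OF t t _ int[OF t], of x "\<lambda>b c. h (fst b) *\<^sub>R ?\<tau> b c" "h x" 0] by simp
    qed
  next
    fix Y Z X assume Y: "Y \<in> vector_fields M A" and Z: "Z \<in> vector_fields M A" and X: "X \<in> vector_fields M A"
    have "?\<sigma> (\<lambda>b c. Y b c + Z b c) = (\<lambda>u c. ?\<sigma> Y u c + ?\<sigma> Z u c)"
      by (auto simp: pullback_field_def fun_eq_iff)
    then have D: "D (?\<sigma> (\<lambda>b c. Y b c + Z b c)) (?H X) = (\<lambda>b c. D (?\<sigma> Y) (?H X) b c + D (?\<sigma> Z) (?H X) b c)"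
      using addS[OF ps[OF Y] ps[OF Z] hf[OF X]] by simp
    show "averaged_connection M A F D (\<lambda>b c. Y b c + Z b c) X =
        (\<lambda>b c. averaged_connection M A F D Y X b c + averaged_connection M A F D Z X b c)"
      unfolding avg[OF X Y] avg[OF X Z] avg[OF X vector_fields_add[OF atl Y Z]] D
    proof (rule ext)
      fix x
      show "fibre_average A F (\<lambda>b c. D (?\<sigma> Y) (?H X) b c + D (?\<sigma> Z) (?H X) b c) x =
        (\<lambda>c. fibre_average A F (D (?\<sigma> Y) (?H X)) x c + fibre_average A F (D (?\<sigma> Z) (?H X)) x c)"
        using comb[OF sec[OF ps[OF Z] hf[OF X]] sec[OF ps[OF Y] hf[OF X]] _ int[OF sec[OF ps[OF Y] hf[OF X]]],
            of x "\<lambda>b c. D (?\<sigma> Y) (?H X) b c + D (?\<sigma> Z) (?H X) b c" 1 1] by simp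
    qed
  next
    fix Y X h assume Y: "Y \<in> vector_fields M A" and X: "X \<in> vector_fields M A" and h: "smooth_fun A h"
    have "?\<sigma> (\<lambda>b c. h b *\<^sub>R Y b c) = (\<lambda>u c. h (fst u) *\<^sub>R ?\<sigma> Y u c)"
      by (auto simp: pullback_field_def fun_eq_iff)
    then have D: "D (?\<sigma> (\<lambda>b c. h b *\<^sub>R Y b c)) (?H X) =
        (\<lambda>b c. dir_deriv (slit_atlas A) (\<lambda>u. h (fst u)) b (?H X b) *\<^sub>R ?\<sigma> Y b c + h (fst b) *\<^sub>R D (?\<sigma> Y) (?H X) b c)"
      using leibniz[OF ps[OF Y] hf[OF X] smooth_fun_pullback[OF atl h]] by simp
    show "averaged_connection M A F D (\<lambda>b c. h b *\<^sub>R Y b c) X =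
        (\<lambda>b c. dir_deriv A h b (X b) *\<^sub>R Y b c + h b *\<^sub>R averaged_connection M A F D Y X b c)"
      unfolding avg[OF X Y] avg[OF X vector_fields_scale[OF atl Y h]] D
    proof (rule ext)
      fix x
      let ?\<tau> = "D (?\<sigma> Y) (?H X)"
      let ?\<rho> = "\<lambda>b c. dir_deriv (slit_atlas A) (\<lambda>u. h (fst u)) b (?H X b) *\<^sub>R ?\<sigma> Y b c + h (fst b) *\<^sub>R ?\<tau> b c"
      have t: "?\<tau> \<in> ?sec" by (rule sec[OF ps[OF Y] hf[OF X]])
      show "fibre_average A F ?\<rho> x = (\<lambda>c. dir_deriv A h x (X x) *\<^sub>R Y x c + h x *\<^sub>R fibre_average A F ?\<tau> x c)"
      proof (cases "x \<in> M")
        case True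
        have "?\<rho> (x, v) = (\<lambda>c. dir_deriv A h x (X x) *\<^sub>R ?\<sigma> Y (x, v) c + h x *\<^sub>R ?\<tau> (x, v) c)"
          if u: "(x, v) \<in> slit_bundle M A" for v
        proof -
          obtain c where c: "c \<in> charts_at A x" using charts_at_nonempty[OF atl True] by blast
          have Xx: "X x \<in> tangent_space A x" by (rule tan[OF X True])
          have Hu: "?H X (x, v) = horizontal_lift A F (x, v) (X x)"
            using u by (simp add: horizontal_field_def[OF finsler])
          have "dir_deriv (slit_atlas A) (\<lambda>u. h (fst u)) (x, v) (?H X (x, v)) = dir_deriv A h x (X x)"
            using dir_deriv_pullback[OF atl h u, of "?H X (x, v)" "X x" c]
              horizontal_lift_props[OF finsler u, of "X x"] Xx c unfolding Hu by simp
          then show ?thesis by simp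
        qed
        from comb[OF t ps[OF Y] this int[OF ps[OF Y]]]
        show ?thesis unfolding fibre_average_pullback[OF finsler Y True] by simp
      next
        case False
        then have "charts_at A x = {}" "Y x = (\<lambda>_. 0)"
          using charts_at_outside[OF atl] vector_fields_outside[OF atl Y] by blast+
        then show ?thesis by (simp add: fibre_average_def[OF finsler])
      qed
    qed
  qed
qed

theorem theorem4p3:
  fixes M :: "'p set"
    and A :: "('p, real^'n::finite) chart set"
    and F :: "('p, 'n) tpoint \<Rightarrow> real"
    and D :: "(('p, 'n) tpoint \<Rightarrow> ('p, real^'n) tvec) \<Rightarrow>
              (('p, 'n) tpoint \<Rightarrow> (('p, 'n) tpoint, (real^'n) \<times> (real^'n)) tvec) \<Rightarrow>
              (('p, 'n) tpoint \<Rightarrow> ('p, real^'n) tvec)"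
  assumes "finsler_space M A F"
    and "linear_connection (slit_bundle M A) (slit_atlas A) fst A D"
  shows "affine_connection M A (averaged_connection M A F D) \<and>
    (\<forall>x\<in>M. \<forall>X\<in>tangent_space A x. \<forall>Y\<in>vector_fields M A.
       cov_deriv_at M A (averaged_connection M A F D) Y x X = averaged_deriv M A F D x X Y)"
proof (intro conjI ballI)
  show "affine_connection M A (averaged_connection M A F D)"
    by (rule averaged_connection_affine[OF assms])
  fix x X Y assume x: "x \<in> M" and X: "X \<in> tangent_space A x" and Y: "Y \<in> vector_fields M A"
  let ?V = "SOME V. V \<in> vector_fields M A \<and> V x = X"
  obtain V where "V \<in> vector_fields M A" "V x = X"
    by (rule vector_field_extension[OF finsler_atlas[OF assms(1)] finsler_bumps[OF assms(1)] x X])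
  then have "?V \<in> vector_fields M A \<and> ?V x = X"
    using someI_ex[of "\<lambda>V. V \<in> vector_fields M A \<and> V x = X"] by blast
  then show "cov_deriv_at M A (averaged_connection M A F D) Y x X = averaged_deriv M A F D x X Y"
    by (simp add: cov_deriv_at_def averaged_connection_def)
qed

end
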